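(* If $\kappa$ is strictly positive definite and the $A_i$, $i\in I$, are mutually essentially disjoint, i.e. $c_\kappa(A_i\cap A_j)=0$ for all $i\ne j$, then a solution to the problem of minimizing $G_{\kappa,\mathbf f}(\boldsymbol\mu)$ over $\boldsymbol\mu\in\mathcal E^{\boldsymbol\sigma}_{\kappa,\mathbf f}(\mathbf A,\mathbf a,\mathbf g)$ is unique (whenever it exists).
   Context: **Measures and kernels.** $X$ is a locally compact Hausdorff space, $\mathfrak M(X)$ the space of real-valued (signed) Radon measures on $X$, $\mathfrak M^+(X)$ its positive elements. $\nu\in\mathfrak M^+(X)$ is carried by $Q\subset X$ if $X\setminus Q$ is locally $\nu$-negligible (equivalently, $Q$ is $\nu$-measurable and $\nu=\nu|_Q$); $\mathfrak M^+(Q)$ is the set of such $\nu$. $\langle\psi,\nu\rangle:=\int\psi\,d\nu$. A kernel is a symmetric l.s.c. function $\kappa:X\times X\to(-\infty,\infty]$, required to be nonnegative unless $X$ is compact. Write $\kappa(\mu,\nu):=\int\kappa\,d(\mu\otimes\nu)$. The kernel is assumed positive definite: $\kappa(\nu,\nu)\geqslant0$ for every $\nu\in\mathfrak M(X)$ for which it is defined (i.e. $\kappa(\nu^+,\nu^+)+\kappa(\nu^-,\nu^-)$ or $\kappa(\nu^+,\nu^-)$ is finite). $\mathcal E_\kappa(X):=\{\nu\in\mathfrak M(X):\kappa(\nu,\nu)\text{ finite}\}$ is a pre-Hilbert space with inner product $\kappa(\mu,\nu)$ and seminorm $\|\nu\|_\kappa:=\sqrt{\kappa(\nu,\nu)}$;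 $\kappa$ is strictly positive definite if $\|\cdot\|_\kappa$ is a norm. $\mathcal E^+_\kappa(Q):=\mathcal E_\kappa(X)\cap\mathfrak M^+(Q)$. The inner capacity is $c_\kappa(Q):=\bigl[\inf\{\kappa(\nu,\nu):\nu\in\mathcal E_\kappa^+(Q),\ \nu(Q)=1\}\bigr]^{-1}$ ($\inf\varnothing=+\infty$, $1/(+\infty)=0$, $1/0=+\infty$). **Condenser.** $I=I^+\cup I^-$ is a countable index set, $I^+\cap I^-=\varnothing$ ($I^-$ may be empty), $s_i:=+1$ for $i\in I^+$, $s_i:=-1$ for $i\in I^-$. $\mathbf A=(A_i)_{i\in I}$ is a generalized condenser: nonempty Borel sets $A_i\subset X$ such that every compact set meets at most finitely many $A_i$, and $A_i\cap A_j=\varnothing$ for $i\in I^+$, $j\in I^-$. **Vector measures.** $\mathfrak M^+(\mathbf A):=\prod_{i\in I}\mathfrak M^+(A_i)$. A numerical series over $I$ is finite iff it has finite terms and converges absolutely. The energy of $\boldsymbol\mu=(\mu^i)_{i\in I}\in\mathfrak M^+(\mathbf A)$ is $\kappa(\boldsymbol\mu,\boldsymbol\mu):=\sum_{i,j\in I}s_is_j\kappa(\mu^i,\mu^j)$; $\mathcal E^+_\kappa(\mathbf A)$ is the set of $\boldsymbol\mu$ with finite energy. **The problem.** Given: $\mathbf a=(a_i)_{i\in I}$, $a_i>0$; $\mathbf g=(g_i)_{i\in I}$ with continuous $g_i:X\to(0,\infty)$; an external field $\mathbf f=(f_i)_{i\in I}$, where each $f_i:X\to[-\infty,\infty]$ is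 $\mu$-measurable for every $\mu\in\mathfrak M^+(X)$; $I_0\subset I$ (possibly empty); constraints $\xi^i\in\mathfrak M^+(A_i)$, $i\in I_0$, with $\langle g_i,\xi^i\rangle>a_i$. Put $\sigma^i=\xi^i$ for $i\in I_0$, $\sigma^i=\infty$ (no constraint) for $i\in I\setminus I_0$, $\boldsymbol\sigma=(\sigma^i)_{i\in I}$. $\mathcal E^{\boldsymbol\sigma}_{\kappa,\mathbf f}(\mathbf A,\mathbf a,\mathbf g)$ is the set of $\boldsymbol\mu\in\mathcal E_\kappa^+(\mathbf A)$ with $\langle g_i,\mu^i\rangle=a_i$ for all $i\in I$, $\mu^i\leqslant\xi^i$ for all $i\in I_0$, and $\langle\mathbf f,\boldsymbol\mu\rangle:=\sum_{i\in I}\langle f_i,\mu^i\rangle$ finite (every $f_i$ being $\mu^i$-integrable). It is assumed nonempty. $G_{\kappa,\mathbf f}(\boldsymbol\mu):=\kappa(\boldsymbol\mu,\boldsymbol\mu)+2\langle\mathbf f,\boldsymbol\mu\rangle$. A solution is an element of $\mathcal E^{\boldsymbol\sigma}_{\kappa,\mathbf f}(\mathbf A,\mathbf a,\mathbf g)$ at which the infimum of $G_{\kappa,\mathbf f}$ over this class is attained. *)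

theory Defs
  imports "HOL-Analysis.Analysis"
begin

section \<open>Radon measures\<close>

text \<open>
  A positive Radon measure on a locally compact Hausdorff space is represented by the unique Borel
  measure that is finite on compact sets and inner regular (with respect to compact sets) on all
  Borel sets. For this representative a Borel set is null iff it is locally negligible. The
  order \<open>\<le>\<close> of the library on measures is the setwise order here, since all these measures share
  the same \<open>\<sigma>\<close>-algebra.
\<close>

definition radon :: "'a::t2_space measure \<Rightarrow> bool" where
  "radon \<nu> \<longleftrightarrow> sets \<nu> = sets borel \<and>
     (\<forall>K. compact K \<longrightarrow> emeasure \<nu> K < \<infinity>) \<and>
     (\<forall>E\<in>sets borel. emeasure \<nu> E = (SUP K\<in>{K. compact K \<and> K \<subseteq> E}. emeasure \<nu> K))"

text \<open>\<open>\<nu>\<close> is carried by \<open>Q\<close> iff the complement of \<open>Q\<close> is locally negligible.\<close>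

definition carried_by :: "'a::t2_space measure \<Rightarrow> 'a set \<Rightarrow> bool" where
  "carried_by \<nu> Q \<longleftrightarrow> (\<forall>K. compact K \<longrightarrow> K - Q \<in> null_sets (completion \<nu>))"

definition radon_on :: "'a::t2_space set \<Rightarrow> 'a measure set" where
  "radon_on Q = {\<nu>. radon \<nu> \<and> carried_by \<nu> Q}"

text \<open>
  Measurability in the sense of Bourbaki: the restriction to every compact set is measurable for
  the completed measure.
\<close>

definition radon_measurable :: "'a::t2_space measure \<Rightarrow> ('a \<Rightarrow> ereal) \<Rightarrow> bool" where
  "radon_measurable \<nu> \<psi> \<longleftrightarrow>
     (\<forall>K. compact K \<longrightarrow> \<psi> \<in> borel_measurable (completion (restrict_space \<nu> K)))"

text \<open>
  The pairing \<open>\<langle>\<psi>, \<nu>\<rangle>\<close> of an extended real function with a positive measure. Passing to the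
  completion of \<open>\<nu>\<close> would not change it (lemma \<open>nn_integral_completion\<close>). As \<open>\<infinity> - \<infinity> = \<infinity>\<close> in
  \<^typ>\<open>ereal\<close>, for measurable \<open>\<psi>\<close> the value is finite iff \<open>\<psi>\<close> is \<open>\<nu>\<close>-integrable.
\<close>

definition pairing :: "('a \<Rightarrow> ereal) \<Rightarrow> 'a measure \<Rightarrow> ereal" where
  "pairing \<psi> \<nu> =
     enn2ereal (\<integral>\<^sup>+x. e2ennreal (\<psi> x) \<partial>\<nu>) - enn2ereal (\<integral>\<^sup>+x. e2ennreal (- \<psi> x) \<partial>\<nu>)"

text \<open>
  The product is taken in the sense of Radon measures: it lives on the Borel sets of the product
  space, which may be a strictly larger \<open>\<sigma>\<close>-algebra than the product of the two Borel
  \<open>\<sigma>\<close>-algebras (on which a lower semicontinuous kernel need not be measurable). On a locally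
  compact Hausdorff space there is exactly one such measure.
\<close>

definition radon_prod ::
    "'a::t2_space measure \<Rightarrow> 'a measure \<Rightarrow> ('a \<times> 'a) measure" where
  "radon_prod \<mu> \<nu> = (THE \<rho>. radon \<rho> \<and>
     (\<forall>A\<in>sets borel. \<forall>B\<in>sets borel. emeasure \<rho> (A \<times> B) = emeasure \<mu> A * emeasure \<nu> B))"

text \<open>
  A real-valued Radon measure \<open>\<nu>\<close> is encoded by its Jordan decomposition \<open>(\<nu>\<^sup>+, \<nu>\<^sup>-)\<close>. Both parts
  may have infinite total mass, so \<open>\<nu>\<close> need not be a set function on all Borel sets. A pair of
  positive Radon measures is a Jordan decomposition iff its infimum in the lattice of Radon
  measures is \<open>0\<close>.
\<close>

definition signed_radon :: "('a::t2_space measure \<times> 'a measure) set" where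
  "signed_radon = {(\<nu>p, \<nu>n). radon \<nu>p \<and> radon \<nu>n \<and>
     (\<forall>\<rho>. radon \<rho> \<longrightarrow> \<rho> \<le> \<nu>p \<longrightarrow> \<rho> \<le> \<nu>n \<longrightarrow> \<rho> = null_measure borel)}"


section \<open>Kernels, energy and capacity\<close>

definition is_kernel :: "('a::t2_space \<times> 'a \<Rightarrow> ereal) \<Rightarrow> bool" where
  "is_kernel \<kappa> \<longleftrightarrow>
     (\<forall>x y. \<kappa> (x, y) = \<kappa> (y, x)) \<and>
     (\<forall>c. open {z. c < \<kappa> z}) \<and>
     (\<forall>z. \<kappa> z \<noteq> -\<infinity>) \<and>
     (\<not> compact (UNIV :: 'a set) \<longrightarrow> (\<forall>z. 0 \<le> \<kappa> z))"

definition mutual_energy ::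
    "('a::t2_space \<times> 'a \<Rightarrow> ereal) \<Rightarrow> 'a measure \<Rightarrow> 'a measure \<Rightarrow> ereal" where
  "mutual_energy \<kappa> \<mu> \<nu> = pairing \<kappa> (radon_prod \<mu> \<nu>)"

definition signed_energy_defined ::
    "('a::t2_space \<times> 'a \<Rightarrow> ereal) \<Rightarrow> 'a measure \<times> 'a measure \<Rightarrow> bool" where
  "signed_energy_defined \<kappa> = (\<lambda>(\<nu>p, \<nu>n).
     \<bar>mutual_energy \<kappa> \<nu>p \<nu>p + mutual_energy \<kappa> \<nu>n \<nu>n\<bar> \<noteq> \<infinity> \<or> \<bar>mutual_energy \<kappa> \<nu>p \<nu>n\<bar> \<noteq> \<infinity>)"

definition signed_energy ::
    "('a::t2_space \<times> 'a \<Rightarrow> ereal) \<Rightarrow> 'a measure \<times> 'a measure \<Rightarrow> ereal" where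
  "signed_energy \<kappa> = (\<lambda>(\<nu>p, \<nu>n).
     (mutual_energy \<kappa> \<nu>p \<nu>p + mutual_energy \<kappa> \<nu>n \<nu>n)
     - (mutual_energy \<kappa> \<nu>p \<nu>n + mutual_energy \<kappa> \<nu>n \<nu>p))"

definition positive_definite_kernel :: "('a::t2_space \<times> 'a \<Rightarrow> ereal) \<Rightarrow> bool" where
  "positive_definite_kernel \<kappa> \<longleftrightarrow>
     (\<forall>\<nu>\<in>signed_radon. signed_energy_defined \<kappa> \<nu> \<longrightarrow> 0 \<le> signed_energy \<kappa> \<nu>)"

definition finite_energy_measures ::
    "('a::t2_space \<times> 'a \<Rightarrow> ereal) \<Rightarrow> ('a measure \<times> 'a measure) set" where
  "finite_energy_measures \<kappa> =
     {\<nu>\<in>signed_radon. signed_energy_defined \<kappa> \<nu> \<and> \<bar>signed_energy \<kappa> \<nu>\<bar> \<noteq> \<infinity>}"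

definition energy_seminorm ::
    "('a::t2_space \<times> 'a \<Rightarrow> ereal) \<Rightarrow> 'a measure \<times> 'a measure \<Rightarrow> real" where
  "energy_seminorm \<kappa> \<nu> = sqrt (real_of_ereal (signed_energy \<kappa> \<nu>))"

definition strictly_positive_definite_kernel :: "('a::t2_space \<times> 'a \<Rightarrow> ereal) \<Rightarrow> bool" where
  "strictly_positive_definite_kernel \<kappa> \<longleftrightarrow> positive_definite_kernel \<kappa> \<and>
     (\<forall>\<nu>\<in>finite_energy_measures \<kappa>.
        energy_seminorm \<kappa> \<nu> = 0 \<longrightarrow> \<nu> = (null_measure borel, null_measure borel))"

definition finite_energy_on ::
    "('a::t2_space \<times> 'a \<Rightarrow> ereal) \<Rightarrow> 'a set \<Rightarrow> 'a measure set" where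
  "finite_energy_on \<kappa> Q = {\<nu>\<in>radon_on Q. \<bar>mutual_energy \<kappa> \<nu> \<nu>\<bar> \<noteq> \<infinity>}"

text \<open>In \<^typ>\<open>ereal\<close>, \<open>inverse 0 = \<infinity>\<close>, \<open>inverse \<infinity> = 0\<close>, and the infimum of the empty set is \<open>\<infinity>\<close>.\<close>

definition inner_capacity ::
    "('a::t2_space \<times> 'a \<Rightarrow> ereal) \<Rightarrow> 'a set \<Rightarrow> ereal" where
  "inner_capacity \<kappa> Q =
     inverse (INF \<nu>\<in>{\<nu>\<in>finite_energy_on \<kappa> Q. emeasure (completion \<nu>) Q = 1}. mutual_energy \<kappa> \<nu> \<nu>)"


section \<open>Condensers and vector measures\<close>

definition generalized_condenser ::
    "'i set \<Rightarrow> 'i set \<Rightarrow> ('i \<Rightarrow> 'a::t2_space set) \<Rightarrow> bool" where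
  "generalized_condenser Ip In A \<longleftrightarrow>
     countable (Ip \<union> In) \<and> Ip \<inter> In = {} \<and>
     (\<forall>i\<in>Ip \<union> In. A i \<noteq> {} \<and> A i \<in> sets borel) \<and>
     (\<forall>K. compact K \<longrightarrow> finite {i\<in>Ip \<union> In. A i \<inter> K \<noteq> {}}) \<and>
     (\<forall>i\<in>Ip. \<forall>j\<in>In. A i \<inter> A j = {})"

definition plate_sign :: "'i set \<Rightarrow> 'i \<Rightarrow> ereal" where
  "plate_sign Ip i = (if i \<in> Ip then 1 else - 1)"

definition finite_series :: "'k set \<Rightarrow> ('k \<Rightarrow> ereal) \<Rightarrow> bool" where
  "finite_series J t \<longleftrightarrow>
     (\<forall>k\<in>J. \<bar>t k\<bar> \<noteq> \<infinity>) \<and> (\<lambda>k. \<bar>real_of_ereal (t k)\<bar>) summable_on J"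

text \<open>Meaningful only if \<^const>\<open>finite_series\<close> holds.\<close>

definition series_sum :: "'k set \<Rightarrow> ('k \<Rightarrow> ereal) \<Rightarrow> real" where
  "series_sum J t = (\<Sum>\<^sub>\<infinity>k\<in>J. real_of_ereal (t k))"

text \<open>
  Families of measures are functions that are \<^const>\<open>undefined\<close> outside the index set, so that
  equality of functions is equality of families.
\<close>

definition vector_measures ::
    "'i set \<Rightarrow> 'i set \<Rightarrow> ('i \<Rightarrow> 'a::t2_space set) \<Rightarrow> ('i \<Rightarrow> 'a measure) set" where
  "vector_measures Ip In A = (\<Pi>\<^sub>E i\<in>Ip \<union> In. radon_on (A i))"

definition energy_terms ::
    "('a::t2_space \<times> 'a \<Rightarrow> ereal) \<Rightarrow> 'i set \<Rightarrow> ('i \<Rightarrow> 'a measure) \<Rightarrow> 'i \<times> 'i \<Rightarrow> ereal" where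
  "energy_terms \<kappa> Ip \<mu> = (\<lambda>(i, j). plate_sign Ip i * plate_sign Ip j * mutual_energy \<kappa> (\<mu> i) (\<mu> j))"

definition finite_energy_vectors ::
    "('a::t2_space \<times> 'a \<Rightarrow> ereal) \<Rightarrow> 'i set \<Rightarrow> 'i set \<Rightarrow> ('i \<Rightarrow> 'a set) \<Rightarrow> ('i \<Rightarrow> 'a measure) set" where
  "finite_energy_vectors \<kappa> Ip In A =
     {\<mu>\<in>vector_measures Ip In A.
        finite_series ((Ip \<union> In) \<times> (Ip \<union> In)) (energy_terms \<kappa> Ip \<mu>)}"

definition vector_energy ::
    "('a::t2_space \<times> 'a \<Rightarrow> ereal) \<Rightarrow> 'i set \<Rightarrow> 'i set \<Rightarrow> ('i \<Rightarrow> 'a measure) \<Rightarrow> real" where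
  "vector_energy \<kappa> Ip In \<mu> = series_sum ((Ip \<union> In) \<times> (Ip \<union> In)) (energy_terms \<kappa> Ip \<mu>)"


section \<open>The constrained weighted minimum energy problem\<close>

text \<open>The constraint is encoded by \<open>I0\<close> and \<open>\<xi>\<close>; only the values of \<open>\<xi>\<close> on \<open>I0\<close> matter.\<close>

definition admissible ::
    "('a::t2_space \<times> 'a \<Rightarrow> ereal) \<Rightarrow> 'i set \<Rightarrow> 'i set \<Rightarrow> ('i \<Rightarrow> 'a set) \<Rightarrow> ('i \<Rightarrow> real) \<Rightarrow>
     ('i \<Rightarrow> 'a \<Rightarrow> real) \<Rightarrow> ('i \<Rightarrow> 'a \<Rightarrow> ereal) \<Rightarrow> 'i set \<Rightarrow> ('i \<Rightarrow> 'a measure) \<Rightarrow>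
     ('i \<Rightarrow> 'a measure) set" where
  "admissible \<kappa> Ip In A a g f I0 \<xi> =
     {\<mu>\<in>finite_energy_vectors \<kappa> Ip In A.
        (\<forall>i\<in>Ip \<union> In. pairing (\<lambda>x. ereal (g i x)) (\<mu> i) = ereal (a i)) \<and>
        (\<forall>i\<in>I0. \<mu> i \<le> \<xi> i) \<and>
        finite_series (Ip \<union> In) (\<lambda>i. pairing (f i) (\<mu> i))}"

definition gauss_functional ::
    "('a::t2_space \<times> 'a \<Rightarrow> ereal) \<Rightarrow> 'i set \<Rightarrow> 'i set \<Rightarrow> ('i \<Rightarrow> 'a \<Rightarrow> ereal) \<Rightarrow>
     ('i \<Rightarrow> 'a measure) \<Rightarrow> real" where
  "gauss_functional \<kappa> Ip In f \<mu> =
     vector_energy \<kappa> Ip In \<mu> + 2 * series_sum (Ip \<union> In) (\<lambda>i. pairing (f i) (\<mu> i))"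

definition is_solution ::
    "('a::t2_space \<times> 'a \<Rightarrow> ereal) \<Rightarrow> 'i set \<Rightarrow> 'i set \<Rightarrow> ('i \<Rightarrow> 'a set) \<Rightarrow> ('i \<Rightarrow> real) \<Rightarrow>
     ('i \<Rightarrow> 'a \<Rightarrow> real) \<Rightarrow> ('i \<Rightarrow> 'a \<Rightarrow> ereal) \<Rightarrow> 'i set \<Rightarrow> ('i \<Rightarrow> 'a measure) \<Rightarrow>
     ('i \<Rightarrow> 'a measure) \<Rightarrow> bool" where
  "is_solution \<kappa> Ip In A a g f I0 \<xi> \<mu> \<longleftrightarrow>
     \<mu> \<in> admissible \<kappa> Ip In A a g f I0 \<xi> \<and>
     ereal (gauss_functional \<kappa> Ip In f \<mu>) =
       (INF \<nu>\<in>admissible \<kappa> Ip In A a g f I0 \<xi>. ereal (gauss_functional \<kappa> Ip In f \<nu>))"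

end

theory Submission
  imports Defs
begin

text \<open>
  All components of two solutions are absolutely continuous with respect to one finite Radon measure
  \<open>S\<close>, so energies become integrals of densities against \<open>S \<otimes> S\<close>, where \<open>S \<otimes> S\<close> is the Radon product.
  Positive definiteness forces the cross energies of the two solutions to be finite, hence the
  midpoint is admissible, and the parallelogram identity shows that the signed density
  \<open>\<Sum>i. s\<^sub>i (u\<^sub>i - v\<^sub>i)\<close> of the difference has energy \<open>0\<close>. By strict positive definiteness it
  vanishes almost everywhere. Measures of finite energy do not charge the sets \<open>A\<^sub>i \<inter> A\<^sub>j\<close> of capacity
  \<open>0\<close>, so this sum has almost everywhere at most one nonzero term and \<open>u\<^sub>i = v\<^sub>i\<close>.
\<close>

section \<open>Radon measures exhausted by compact sets\<close>

text \<open>The components may have infinite mass and the space need not be sigma-compact, so no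
  reference measure is given in advance. The normalization supplies one: a positive continuous
  \<open>g i\<close> with finite integral makes each component sigma-finite, and there are countably
  many components. The product is the second obstacle. The kernel is measurable for the Borel sets
  of the product space, while Tonelli in its usual form concerns the possibly smaller product
  \<sigma>-algebra; hence a Radon product is built for \<open>S\<close> alone, and the products of
  all measures involved are densities of it. Densities are chosen real-valued and zero off their
  plate at every point. Then the sum over the index set is finite pointwise by local finiteness, a
  signed measure whose two parts may both have infinite mass becomes a real function, and its Jordan
  decomposition is given by the positive and negative parts of that function. All integrability
  rests on one majorant, \<open>plate_sum w\<close> with \<open>w = u + v\<close>: finiteness of its
  energy contains that of all mixed energies of the two solutions, on which admissibility says
  nothing.\<close>

lemma radonD:
  assumes "radon M"
  shows "sets M = sets borel" "space M = UNIV" "compact K \<Longrightarrow> emeasure M K < \<infinity>"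
    "E \<in> sets borel \<Longrightarrow> emeasure M E = (SUP K\<in>{K. compact K \<and> K \<subseteq> E}. emeasure M K)"
  using assms sets_eq_imp_space_eq[of M borel] by (auto simp: radon_def)

lemma radon_inner:
  assumes "radon M" "E \<in> sets borel" "c < emeasure M E"
  obtains K where "compact K" "K \<subseteq> E" "c < emeasure M K"
  using assms radonD(4)[OF assms(1,2)] by (auto simp: less_SUP_iff)

text \<open>
  Unlike inner regularity, this property passes to every absolutely continuous Borel measure, so a
  density of a finite Radon measure is Radon as soon as it is finite on compact sets.
\<close>

definition compactly_exhausted :: "'a::t2_space measure \<Rightarrow> bool" where
  "compactly_exhausted M \<longleftrightarrow> sets M = sets borel \<and>
     (\<forall>E\<in>sets borel. \<exists>\<K>. countable \<K> \<and> (\<forall>K\<in>\<K>. compact K \<and> K \<subseteq> E) \<and> E - \<Union>\<K> \<in> null_sets M)"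

lemma compactly_exhaustedE:
  assumes "compactly_exhausted M" "E \<in> sets borel"
  obtains \<K> where "countable \<K>" "\<And>K. K \<in> \<K> \<Longrightarrow> compact K" "\<And>K. K \<in> \<K> \<Longrightarrow> K \<subseteq> E"
    "E - \<Union>\<K> \<in> null_sets M"
  using assms unfolding compactly_exhausted_def by meson

lemma borel_countable_Union_compact:
  fixes \<K> :: "'a::t2_space set set"
  assumes "countable \<K>" "\<And>K. K \<in> \<K> \<Longrightarrow> compact K"
  shows "\<Union>\<K> \<in> sets borel"
  using assms by (intro sets.countable_Union) (auto intro: borel_compact)

text \<open>On a set of finite measure, countably many compact subsets realize the supremum in inner
  regularity; their union has full measure, and finiteness allows the subtraction that makes the
  rest null. Sigma-finiteness cuts a general Borel set into countably many such pieces.\<close>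

lemma radon_imp_compactly_exhausted:
  fixes M :: "'a::t2_space measure"
  assumes "radon M" "sigma_finite_measure M"
  shows "compactly_exhausted M"
proof -
  note [simp] = radonD(1-3)[OF \<open>radon M\<close>]
  have fin: "\<exists>\<K>. countable \<K> \<and> (\<forall>K\<in>\<K>. compact K \<and> K \<subseteq> E) \<and> E - \<Union>\<K> \<in> null_sets M"
    if E: "E \<in> sets borel" and finE: "emeasure M E < \<infinity>" for E
  proof -
    have ne: "{K. compact K \<and> K \<subseteq> E} \<noteq> {}"
      by (rule ex_in_conv[THEN iffD1], rule exI[of _ "{}"]) simp
    obtain F :: "nat \<Rightarrow> ennreal" where F: "range F \<subseteq> emeasure M ` {K. compact K \<and> K \<subseteq> E}"
      and "(SUP K\<in>{K. compact K \<and> K \<subseteq> E}. emeasure M K) = Sup (range F)"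
      using ennreal_SUP_countable_SUP[OF ne, of "emeasure M"] by blast
    then have eq: "emeasure M E = (SUP n. F n)" using radonD(4)[OF assms(1) E] by argo
    have "\<forall>n. \<exists>K. compact K \<and> K \<subseteq> E \<and> F n = emeasure M K"
      using F by auto
    then obtain C where C: "\<And>n. compact (C n)" "\<And>n. C n \<subseteq> E" "\<And>n. F n = emeasure M (C n)"
      by metis
    have Cb[measurable]: "C n \<in> sets borel" for n using borel_compact[OF C(1)] .
    have "emeasure M E \<le> emeasure M (\<Union>n. C n)"
      unfolding eq C(3) by (intro SUP_least emeasure_mono) auto
    moreover have "emeasure M (\<Union>n. C n) < \<infinity>"
      using C(2) E by (intro le_less_trans[OF emeasure_mono finE]) auto
    then have "emeasure M (E - (\<Union>n. C n)) = emeasure M E - emeasure M (\<Union>n. C n)"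
      using C E by (intro emeasure_Diff) (auto simp: less_top)
    ultimately have "emeasure M (E - (\<Union>n. C n)) = 0"
      using finE by (simp add: diff_eq_0_iff_ennreal)
    then show ?thesis
      using C E by (intro exI[of _ "range C"]) (auto simp: null_sets_def)
  qed
  obtain A :: "nat \<Rightarrow> 'a set" where A: "range A \<subseteq> sets M" "(\<Union>i. A i) = space M"
    "\<And>i. emeasure M (A i) \<noteq> \<infinity>"
    using sigma_finite_measure.sigma_finite[OF assms(2)] by metis
  show ?thesis
    unfolding compactly_exhausted_def
  proof (intro conjI ballI)
    show "sets M = sets borel" by simp
    fix E :: "'a set" assume E: "E \<in> sets borel"
    have "\<exists>\<K>. countable \<K> \<and> (\<forall>K\<in>\<K>. compact K \<and> K \<subseteq> E \<inter> A n) \<and> (E \<inter> A n) - \<Union>\<K> \<in> null_sets M" for n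
    proof (rule fin)
      show m: "E \<inter> A n \<in> sets borel" using A(1) E by auto
      have "emeasure M (E \<inter> A n) \<le> emeasure M (A n)" using A(1) by (intro emeasure_mono) auto
      then show "emeasure M (E \<inter> A n) < \<infinity>" using A(3)[of n] by (simp add: less_top top.not_eq_extremum)
    qed
    then obtain \<K> where \<K>: "\<And>n. countable (\<K> n)"
      "\<And>n K. K \<in> \<K> n \<Longrightarrow> compact K \<and> K \<subseteq> E \<inter> A n" "\<And>n. (E \<inter> A n) - \<Union>(\<K> n) \<in> null_sets M"
      by metis
    have "E - \<Union>(\<Union>n. \<K> n) \<in> null_sets M"
    proof (rule null_sets_subset)
      show "(\<Union>n. (E \<inter> A n) - \<Union>(\<K> n)) \<in> null_sets M" using \<K>(3) by auto
      have "\<Union>(\<Union>n. \<K> n) \<in> sets borel"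
        using \<K> by (intro borel_countable_Union_compact) auto
      then show "E - \<Union>(\<Union>n. \<K> n) \<in> sets M" using E by auto
      show "E - \<Union>(\<Union>n. \<K> n) \<subseteq> (\<Union>n. (E \<inter> A n) - \<Union>(\<K> n))"
      proof
        fix x assume x: "x \<in> E - \<Union>(\<Union>n. \<K> n)"
        obtain n where "x \<in> A n" using A(2) radonD(2)[OF assms(1)] by blast
        with x show "x \<in> (\<Union>n. (E \<inter> A n) - \<Union>(\<K> n))" by auto
      qed
    qed
    then show "\<exists>\<K>. countable \<K> \<and> (\<forall>K\<in>\<K>. compact K \<and> K \<subseteq> E) \<and> E - \<Union>\<K> \<in> null_sets M"
      using \<K>(1) \<K>(2) by (intro exI[of _ "\<Union>n. \<K> n"] conjI) auto
  qed
qed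

text \<open>Finite unions of the countable family increase to a subset of full measure, so
  continuity from below gives inner regularity, on sets of infinite measure as well.\<close>

lemma compactly_exhausted_imp_radon:
  fixes M :: "'a::t2_space measure"
  assumes M: "compactly_exhausted M" and fin: "\<And>K. compact K \<Longrightarrow> emeasure M K < \<infinity>"
  shows "radon M"
  unfolding radon_def
proof (intro conjI allI impI ballI)
  show sets[simp]: "sets M = sets borel" using M by (simp add: compactly_exhausted_def)
  show "emeasure M K < \<infinity>" if "compact K" for K using fin that .
  fix E :: "'a set" assume E: "E \<in> sets borel"
  show "emeasure M E = (SUP K\<in>{K. compact K \<and> K \<subseteq> E}. emeasure M K)" (is "_ = ?S")
  proof (rule antisym)
    show "?S \<le> emeasure M E" using E by (intro SUP_least emeasure_mono) auto
    obtain \<K> where \<K>: "countable \<K>" "\<And>K. K \<in> \<K> \<Longrightarrow> compact K" "\<And>K. K \<in> \<K> \<Longrightarrow> K \<subseteq> E"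
      "E - \<Union>\<K> \<in> null_sets M"
      using compactly_exhaustedE[OF M E] by metis
    \<comment> \<open>Inserting the empty set makes the enumeration meaningful when
      \<open>\<K>\<close> is empty and does not change the union.\<close>
    define C where "C n = \<Union>((from_nat_into (insert {} \<K>)) ` {..<n})" for n :: nat
    have el: "from_nat_into (insert {} \<K>) n \<in> insert {} \<K>" for n
      by (rule from_nat_into) simp
    have C: "compact (C n)" "C n \<subseteq> E" for n
    proof -
      have "compact (from_nat_into (insert {} \<K>) m)" "from_nat_into (insert {} \<K>) m \<subseteq> E" for m
        using el[of m] \<K>(2,3) by (metis compact_empty insertE, metis empty_subsetI insertE)
      then show "compact (C n)" "C n \<subseteq> E" unfolding C_def by auto
    qed
    have UC: "(\<Union>n. C n) = \<Union>\<K>"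
    proof -
      have "(\<Union>n. C n) = \<Union>(range (from_nat_into (insert {} \<K>)))" unfolding C_def by blast
      also have "\<dots> = \<Union>\<K>" using \<K>(1) by (subst range_from_nat_into) auto
      finally show ?thesis .
    qed
    have inc: "incseq C" unfolding C_def incseq_def by fastforce
    have Cb: "range C \<subseteq> sets M" using borel_compact[OF C(1)] by auto
    have "emeasure M E \<le> emeasure M (\<Union>\<K> \<union> (E - \<Union>\<K>))"
      using E borel_countable_Union_compact[OF \<K>(1,2)] by (intro emeasure_mono) auto
    also have "\<dots> = emeasure M (\<Union>\<K>)"
      using \<K>(4) borel_countable_Union_compact[OF \<K>(1,2)] by (intro emeasure_Un_null_set) auto
    also have "\<dots> = (SUP n. emeasure M (C n))"
      using SUP_emeasure_incseq[OF Cb inc] UC by simp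
    also have "\<dots> \<le> ?S" using C by (intro SUP_mono) auto
    finally show "emeasure M E \<le> ?S" .
  qed
qed

lemma compactly_exhausted_absolutely_continuous:
  assumes "compactly_exhausted M" "absolutely_continuous M N" "sets N = sets borel"
  shows "compactly_exhausted N"
  using assms unfolding compactly_exhausted_def absolutely_continuous_def by (meson subsetD)

lemma absolutely_continuous_density:
  assumes "u \<in> borel_measurable M"
  shows "absolutely_continuous M (density M u)"
  using assms unfolding absolutely_continuous_def
  by (auto simp: null_sets_density_iff AE_not_in elim!: eventually_mono dest: AE_not_in)

lemma compactly_exhausted_density:
  assumes "compactly_exhausted M" "u \<in> borel_measurable M"
  shows "compactly_exhausted (density M u)"
  using assms absolutely_continuous_density[OF assms(2)]
  by (intro compactly_exhausted_absolutely_continuous[OF assms(1)]) (auto simp: compactly_exhausted_def)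

text \<open>\<open>S\<close> is the sum of the measures \<open>c n * h n * M n\<close>, where
  \<open>h n\<close> is strictly positive and \<open>M n\<close>-integrable: each summand is finite
  and has the null sets of \<open>M n\<close>. Compact exhaustion survives the countable sum because
  the exhausting families can be united.\<close>

lemma radon_dominating_finite:
  fixes M :: "nat \<Rightarrow> 'a::t2_space measure"
  assumes rad: "\<And>n. radon (M n)" and sf: "\<And>n. sigma_finite_measure (M n)"
  obtains S where "radon S" "finite_measure S" "\<And>n. absolutely_continuous S (M n)"
proof -
  have sets[simp]: "sets (M n) = sets borel" "space (M n) = UNIV" for n using radonD(1,2)[OF rad] by auto
  have "\<exists>h. h \<in> borel_measurable (M n) \<and> integral\<^sup>N (M n) h \<noteq> \<infinity> \<and> (\<forall>x. 0 < h x)" for n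
    using sigma_finite_measure.Ex_finite_integrable_function[OF sf[of n]] by auto
  then obtain h where h: "\<And>n. h n \<in> borel_measurable (M n)" "\<And>n. integral\<^sup>N (M n) (h n) \<noteq> \<infinity>"
    "\<And>n x. 0 < h n x" by metis
  have hb[measurable]: "h n \<in> borel_measurable borel" for n
    using h(1)[of n] by (simp cong: measurable_cong_sets)
  \<comment> \<open>The weight bounds the mass of the n-th summand by \<open>(1/2)^n\<close>. The
    added 1 keeps the weight finite when \<open>M n\<close> is null.\<close>
  define c :: "nat \<Rightarrow> ennreal" where "c n = ennreal ((1/2)^n) / (1 + integral\<^sup>N (M n) (h n))" for n
  define N where "N n = density (M n) (\<lambda>x. c n * h n x)" for n
  define m where "m n E = emeasure (N n) E" for n E
  have c0: "c n > 0" for n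
    using h(2)[of n] by (auto simp: c_def ennreal_zero_less_divide top.not_eq_extremum)
  have mle: "m n E \<le> ennreal ((1/2)^n)" for n E
  proof -
    let ?I = "integral\<^sup>N (M n) (h n)"
    have "m n E \<le> emeasure (N n) (space (N n))" unfolding m_def by (rule emeasure_space)
    also have "\<dots> = c n * ?I"
      unfolding N_def using h(1)[of n] by (simp add: emeasure_density nn_integral_cmult)
    also have "\<dots> \<le> c n * (1 + ?I)"
      using add_increasing[of "1::ennreal" ?I ?I] by (intro mult_left_mono) simp_all
    also have "\<dots> = ennreal ((1/2)^n)"
    proof -
      have "1 + ?I \<noteq> 0" "1 + ?I \<noteq> top" using h(2)[of n] by auto
      then show ?thesis
        unfolding c_def by (subst mult.commute, subst ennreal_times_divide, subst mult.commute) (rule mult_divide_eq_ennreal)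
    qed
    finally show ?thesis .
  qed
  \<comment> \<open>With the series written as an integral over counting measure, the interchange of
    sums in countable additivity becomes an instance of \<open>nn_integral_suminf\<close>.\<close>
  define S where "S = measure_of UNIV (sets borel) (\<lambda>E. \<integral>\<^sup>+n. m n E \<partial>count_space UNIV)"
  have "sigma_algebra UNIV (sets (borel :: 'a measure))"
    using sets.sigma_algebra_axioms[of "borel :: 'a measure"] by simp
  then have em: "emeasure S E = (\<Sum>n. m n E)" if "E \<in> sets borel" for E
    unfolding S_def nn_integral_count_space_nat[symmetric]
  proof (rule emeasure_measure_of_sigma)
    show "positive (sets borel) (\<lambda>E. \<integral>\<^sup>+n. m n E \<partial>count_space UNIV)" by (auto simp: positive_def m_def)
    show "countably_additive (sets borel) (\<lambda>E. \<integral>\<^sup>+n. m n E \<partial>count_space UNIV)"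
    proof (rule countably_additiveI)
      fix A :: "nat \<Rightarrow> 'a set" assume A: "range A \<subseteq> sets borel" "disjoint_family A"
      then have "(\<Sum>i. m n (A i)) = m n (\<Union>i. A i)" for n
        unfolding m_def by (intro suminf_emeasure) (auto simp: N_def)
      then show "(\<Sum>i. \<integral>\<^sup>+n. m n (A i) \<partial>count_space UNIV) = (\<integral>\<^sup>+n. m n (\<Union>i. A i) \<partial>count_space UNIV)"
        by (subst nn_integral_suminf[symmetric]) simp_all
    qed
    show "E \<in> sets borel" by fact
  qed
  have setsS[simp]: "sets S = sets borel" "space S = UNIV"
    unfolding S_def using sets.sigma_sets_eq[of borel] by (auto)
  have finS: "emeasure S UNIV < \<infinity>"
  proof -
    have "emeasure S UNIV \<le> (\<Sum>n. ennreal ((1/2)^n))"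
      by (subst em, simp, intro suminf_le mle summableI)
    also have "\<dots> = ennreal (\<Sum>n. (1/2)^n)" by (intro suminf_ennreal2) (simp_all add: summable_geometric)
    finally show ?thesis by (simp add: le_less_trans)
  qed
  have null: "E \<in> null_sets S \<longleftrightarrow> (\<forall>n. E \<in> null_sets (M n))" if E[measurable]: "E \<in> sets borel" for E
  proof -
    have "m n E = 0 \<longleftrightarrow> E \<in> null_sets (M n)" for n
    proof -
      have "m n E = 0 \<longleftrightarrow> E \<in> null_sets (N n)" by (simp add: m_def null_sets_def N_def)
      also have "\<dots> \<longleftrightarrow> (AE x in M n. x \<in> E \<longrightarrow> c n * h n x = 0)"
        unfolding N_def using h(1)[of n] by (subst null_sets_density_iff) simp_all
      also have "\<dots> \<longleftrightarrow> (AE x in M n. x \<notin> E)"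
        using c0[of n] h(3)[of n] by (intro AE_cong) (auto simp: less_le)
      also have "\<dots> \<longleftrightarrow> E \<in> null_sets (M n)" using E by (simp add: AE_iff_null_sets)
      finally show ?thesis .
    qed
    then show ?thesis using E by (auto simp: null_sets_def em suminf_eq_zero_iff summableI)
  qed
  have "compactly_exhausted S"
    unfolding compactly_exhausted_def
  proof (intro conjI ballI)
    fix E :: "'a set" assume E: "E \<in> sets borel"
    have "\<exists>\<K>. countable \<K> \<and> (\<forall>K\<in>\<K>. compact K \<and> K \<subseteq> E) \<and> E - \<Union>\<K> \<in> null_sets (M n)" for n
      using radon_imp_compactly_exhausted[OF rad sf] E unfolding compactly_exhausted_def by blast
    then obtain \<K> where \<K>: "\<And>n. countable (\<K> n)"
      "\<And>n K. K \<in> \<K> n \<Longrightarrow> compact K \<and> K \<subseteq> E" "\<And>n. E - \<Union>(\<K> n) \<in> null_sets (M n)"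
      by metis
    have b: "\<Union>(\<Union>n. \<K> n) \<in> sets borel"
      using \<K> by (intro borel_countable_Union_compact) auto
    have "E - \<Union>(\<Union>n. \<K> n) \<in> null_sets (M n)" for n
      by (rule null_sets_subset[OF \<K>(3)[of n]]) (use E b in auto)
    then show "\<exists>\<K>. countable \<K> \<and> (\<forall>K\<in>\<K>. compact K \<and> K \<subseteq> E) \<and> E - \<Union>\<K> \<in> null_sets S"
      using \<K>(1,2) E b by (intro exI[of _ "\<Union>n. \<K> n"]) (auto simp: null)
  qed simp
  then have "radon S"
  proof (rule compactly_exhausted_imp_radon)
    fix K :: "'a set"
    have "emeasure S K \<le> emeasure S UNIV"
      using emeasure_space[of S K] by simp
    then show "emeasure S K < \<infinity>" using finS by (rule le_less_trans)
  qed
  moreover have "finite_measure S" using finS by (intro finite_measureI) auto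
  moreover have "absolutely_continuous S (M n)" for n
    unfolding absolutely_continuous_def using null by (auto simp: null_sets_def)
  ultimately show ?thesis using that by blast
qed

section \<open>Products of Radon measures\<close>

text \<open>The sets that can be squeezed between a compact and an open set with arbitrarily small
  difference form a \<sigma>-algebra, and the hypothesis puts the open sets into it. Finiteness of
  \<open>M\<close> enters for complements and for countable unions, where compactness has to be
  restored at a small cost in measure.\<close>

lemma radonI_open_inner_regular:
  fixes M :: "'a::t2_space measure"
  assumes sets[simp]: "sets M = sets borel" and fin: "finite_measure M"
    and opn: "\<And>U c. open U \<Longrightarrow> c < emeasure M U \<Longrightarrow> \<exists>K. compact K \<and> K \<subseteq> U \<and> c < emeasure M K"
  shows "radon M"
proof -
  interpret finite_measure M by fact
  have [simp]: "space M = UNIV" using sets_eq_imp_space_eq[OF sets] by simp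
  let ?P = "\<lambda>E e. \<exists>C U. compact C \<and> C \<subseteq> E \<and> open U \<and> E \<subseteq> U \<and> measure M (U - C) < e"
  have open_case: "?P U e" if U: "open U" and e: "0 < e" for U and e :: real
  proof (cases "measure M U < e")
    case True
    then show ?thesis using U by (intro exI[of _ "{}"] exI[of _ U]) auto
  next
    case False
    then have "ennreal (measure M U - e) < emeasure M U"
      using e by (simp add: emeasure_eq_measure ennreal_lessI)
    from opn[OF U this] obtain C where C: "compact C" "C \<subseteq> U" "measure M U - e < measure M C"
      using False by (auto simp: emeasure_eq_measure ennreal_less_iff)
    then have "measure M (U - C) < e"
      using finite_measure_Diff[of U C] U borel_compact[OF C(1)] by simp
    then show ?thesis using U C by blast
  qed
  have approx: "\<forall>e>0. ?P E e" if "E \<in> sets borel" for E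
  proof -
    have "E \<in> sigma_sets UNIV {U::'a set. open U}"
      using that by (simp add: borel_def)
    then show ?thesis
    proof induction
      case (Basic E)
      then show ?case using open_case by auto
    next
      case Empty
      then show ?case by (intro allI impI exI[of _ "{}"]) auto
    next
      case (Compl E)
      show ?case
      proof (intro allI impI)
        fix e :: real assume "0 < e"
        then obtain C U where CU: "compact C" "C \<subseteq> E" "open U" "E \<subseteq> U" "measure M (U - C) < e / 2"
          using Compl.IH[rule_format, of "e/2"] by auto
        \<comment> \<open>The complement of \<open>U\<close> is closed but possibly not compact; its
          intersection with a compact set of almost full measure is. Such a set exists because the
          whole space is open.\<close>
        obtain K where K: "compact K" "measure M (UNIV - K) < e / 2"
          using open_case[of UNIV "e/2"] \<open>0 < e\<close> by (auto simp: top.extremum_unique)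
        have m: "U \<in> sets borel" "C \<in> sets borel" "K \<in> sets borel"
          using CU K borel_compact by auto
        have "measure M (- C - (K - U)) \<le> measure M ((U - C) \<union> (UNIV - K))"
          using m by (intro finite_measure_mono) auto
        also have "\<dots> \<le> measure M (U - C) + measure M (UNIV - K)"
          using m by (intro measure_Un_le) auto
        finally have "measure M (- C - (K - U)) < e" using CU K by simp
        moreover have "compact (K - U)" "open (- C)"
          using CU K by (auto intro: compact_diff compact_imp_closed)
        ultimately show "?P (UNIV - E) e" using CU by (intro exI[of _ "K - U"] exI[of _ "- C"]) auto
      qed
    next
      case (Union E)
      show ?case
      proof (intro allI impI)
        fix e :: real assume "0 < e"
        \<comment> \<open>These errors sum to \<open>e / 2\<close>; the other half is reserved for
          the tail \<open>B N\<close> below.\<close>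
        have "\<forall>n. \<exists>C U. compact C \<and> C \<subseteq> E n \<and> open U \<and> E n \<subseteq> U \<and> measure M (U - C) < e / 4 * (1/2)^n"
        proof
          fix n
          have "0 < e / 4 * (1/2)^n" using \<open>0 < e\<close> by simp
          then show "\<exists>C U. compact C \<and> C \<subseteq> E n \<and> open U \<and> E n \<subseteq> U \<and> measure M (U - C) < e / 4 * (1/2)^n"
            using Union.IH[of n] by blast
        qed
        then obtain C U where C: "\<And>n. compact (C n)" "\<And>n. C n \<subseteq> E n" and U: "\<And>n. open (U n)"
          "\<And>n. E n \<subseteq> U n" and CU: "\<And>n. measure M (U n - C n) < e / 4 * (1/2)^n" by metis
        have m[simp]: "C n \<in> sets borel" "U n \<in> sets borel" for n
          using borel_compact[OF C(1)] borel_open[OF U(1)] by blast+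
        \<comment> \<open>Only finitely many of the \<open>C n\<close> can be united without losing
          compactness. \<open>B N\<close> is what this discards; it decreases to the empty
          set.\<close>
        define B where "B N = (\<Union>n. C n) - (\<Union>n<N. C n)" for N :: nat
        have Bm: "B N \<in> sets borel" for N unfolding B_def by (intro sets.Diff sets.countable_UN sets.finite_UN) auto
        have "(\<lambda>N. measure M (B N)) \<longlonglongrightarrow> measure M (\<Inter>N. B N)"
          by (intro finite_Lim_measure_decseq) (use Bm in \<open>auto simp: decseq_def\<close>, auto simp: B_def)
        also have "(\<Inter>N. B N) = {}" unfolding B_def by auto
        finally have "(\<lambda>N. measure M (B N)) \<longlonglongrightarrow> 0" by simp
        then have "eventually (\<lambda>N. measure M (B N) < e / 2) sequentially"
          using \<open>0 < e\<close> by (intro order_tendstoD) auto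
        then obtain N where N: "measure M (B N) < e / 2" by (auto simp: eventually_sequentially)
        have sums: "(\<lambda>n. e / 4 * (1/2)^n) sums (e / 4 * 2)"
          by (intro sums_mult) (use geometric_sums[of "1/2::real"] in simp)
        have summ: "summable (\<lambda>n. measure M (U n - C n))"
          by (rule summable_comparison_test'[OF sums_summable[OF sums], of 0])
            (use CU in \<open>auto intro: less_imp_le\<close>)
        have "measure M ((\<Union>n. U n) - (\<Union>n<N. C n)) \<le> measure M ((\<Union>n. U n - C n) \<union> B N)"
        proof (rule finite_measure_mono)
          have "(\<Union>n. U n - C n) \<in> sets borel" by (intro sets.countable_UN) auto
          then show "(\<Union>n. U n - C n) \<union> B N \<in> sets M" using Bm by simp
        qed (auto simp: B_def)
        also have "\<dots> \<le> measure M (\<Union>n. U n - C n) + measure M (B N)"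
          using Bm by (intro measure_Un_le sets.countable_UN) auto
        also have "measure M (\<Union>n. U n - C n) \<le> (\<Sum>n. measure M (U n - C n))"
          using summ by (intro finite_measure_subadditive_countably) auto
        also have "\<dots> \<le> (\<Sum>n. e / 4 * (1/2)^n)"
          using summ sums_summable[OF sums] CU by (intro suminf_le) (auto intro: less_imp_le)
        also have "\<dots> = e / 2" using sums_unique[OF sums] by simp
        finally have "measure M ((\<Union>n. U n) - (\<Union>n<N. C n)) < e" using N by simp
        moreover have "compact (\<Union>n<N. C n)" "open (\<Union>n. U n)" using C U by auto
        moreover have "(\<Union>n<N. C n) \<subseteq> (\<Union>n. E n)" "(\<Union>n. E n) \<subseteq> (\<Union>n. U n)"
          using C(2) U(2) by blast+
        ultimately show "?P (\<Union>n. E n) e" by meson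
      qed
    qed
  qed
  show ?thesis unfolding radon_def
  proof (intro conjI allI impI ballI)
    show "emeasure M K < \<infinity>" for K by (simp add: emeasure_eq_measure)
    fix E :: "'a set" assume E: "E \<in> sets borel"
    show "emeasure M E = (SUP K\<in>{K. compact K \<and> K \<subseteq> E}. emeasure M K)" (is "_ = ?S")
    proof (rule antisym)
      show "?S \<le> emeasure M E" using E by (intro SUP_least emeasure_mono) auto
      show "emeasure M E \<le> ?S"
      proof (rule ennreal_le_epsilon)
        fix e :: real assume "0 < e"
        with approx[OF E] obtain C U where CU: "compact C" "C \<subseteq> E" "open U" "E \<subseteq> U"
          "measure M (U - C) < e" by meson
        have "emeasure M E \<le> emeasure M (C \<union> (U - C))"
          using CU borel_compact[OF CU(1)] by (intro emeasure_mono) auto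
        also have "\<dots> \<le> emeasure M C + emeasure M (U - C)"
          using CU borel_compact[OF CU(1)] by (intro emeasure_subadditive) auto
        also have "\<dots> \<le> ?S + ennreal e"
          using CU \<open>0 < e\<close> by (intro add_mono SUP_upper) (auto simp: emeasure_eq_measure ennreal_leI)
        finally show "emeasure M E \<le> ?S + ennreal e" .
      qed
    qed
  qed simp
qed

section \<open>Sections of Borel sets and existence of the Radon product\<close>

lemma borel_section:
  fixes E :: "('a::t2_space \<times> 'b::t2_space) set"
  assumes "E \<in> sets borel"
  shows "Pair x -` E \<in> sets borel"
proof -
  have "Pair x \<in> borel \<rightarrow>\<^sub>M (borel :: ('a \<times> 'b) measure)"
    by (intro borel_measurable_continuous_onI continuous_intros)
  from measurable_sets[OF this assms] show ?thesis by simp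
qed

lemma borel_Times:
  fixes A :: "'a::t2_space set" and B :: "'b::t2_space set"
  assumes "A \<in> sets borel" "B \<in> sets borel"
  shows "A \<times> B \<in> sets borel"
proof -
  have [measurable]: "fst \<in> (borel :: ('a \<times> 'b) measure) \<rightarrow>\<^sub>M borel"
    "snd \<in> (borel :: ('a \<times> 'b) measure) \<rightarrow>\<^sub>M borel"
    by (auto intro!: borel_measurable_continuous_onI continuous_intros)
  have "fst -` A \<inter> snd -` B \<in> sets (borel :: ('a \<times> 'b) measure)"
    using measurable_sets[of fst "borel :: ('a \<times> 'b) measure" borel A]
      measurable_sets[of snd "borel :: ('a \<times> 'b) measure" borel B] assms by auto
  also have "fst -` A \<inter> snd -` B = A \<times> B" by auto
  finally show ?thesis .
qed

text \<open>The tube lemma needs a compact fibre: inner regularity of \<open>N\<close> first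
  replaces the open section by a compact subset that still has measure above \<open>c\<close>. The
  resulting rectangles are the only link between open sets of the product and the two
  factors.\<close>

lemma section_tube:
  fixes U :: "('a::t2_space \<times> 'b::t2_space) set"
  assumes "radon N" "open U" "c < emeasure N (Pair x -` U)"
  obtains V C where "open V" "x \<in> V" "compact C" "V \<times> C \<subseteq> U" "c < emeasure N C"
proof -
  obtain C where C: "compact C" "C \<subseteq> Pair x -` U" "c < emeasure N C"
    by (rule radon_inner[OF assms(1) borel_section[OF borel_open[OF assms(2)]] assms(3)])
  have "{x} \<times> C \<subseteq> U" using C(2) by auto
  from Elementary_Topology.tube_lemma[OF C(1) assms(2) this] C that show ?thesis by blast
qed

text \<open>For open \<open>E\<close> the tube lemma makes the section measure lower semicontinuous.
  Open sets are an intersection-stable generator of the Borel sets of the product space, so Dynkin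
  induction reaches all of them, including those outside the product \<sigma>-algebra.\<close>

lemma emeasure_section_measurable:
  fixes E :: "('a::t2_space \<times> 'b::t2_space) set"
  assumes N: "radon N" "finite_measure N" and E: "E \<in> sets borel"
  shows "(\<lambda>x. emeasure N (Pair x -` E)) \<in> borel_measurable borel"
proof -
  interpret finite_measure N by fact
  note [simp] = radonD(1,2)[OF N(1)]
  have eq: "sets (borel :: ('a \<times> 'b) measure) = sigma_sets UNIV {U. open U}" by (simp add: borel_def)
  have "Int_stable {U::('a \<times> 'b) set. open U}" by (auto simp: Int_stable_def)
  moreover have "{U. open U} \<subseteq> Pow (UNIV :: ('a \<times> 'b) set)" by simp
  moreover have "E \<in> sigma_sets UNIV {U. open U}" using E eq by simp
  ultimately show ?thesis
  proof (induction rule: sigma_sets_induct_disjoint)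
    case (basic U)
    show ?case
    proof (rule borel_measurableI_greater)
      fix c
      have "\<exists>T. open T \<and> x \<in> T \<and> T \<subseteq> {x. c < emeasure N (Pair x -` U)}"
        if x: "c < emeasure N (Pair x -` U)" for x
      proof -
        have U: "open U" using basic by simp
        from section_tube[OF N(1) U x] obtain V C where
          V: "open V" "x \<in> V" "compact C" "V \<times> C \<subseteq> U" "c < emeasure N C" .
        have "c < emeasure N (Pair y -` U)" if "y \<in> V" for y
          using V that borel_section[of U y] U
          by (intro less_le_trans[OF V(5) emeasure_mono]) auto
        then show ?thesis using V by blast
      qed
      then have "open {x. c < emeasure N (Pair x -` U)}" by (subst open_subopen) blast
      then show "{x \<in> space borel. c < emeasure N (Pair x -` U)} \<in> sets borel" by simp
    qed
  next
    case empty
    show ?case by simp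
  next
    case (compl A)
    have "emeasure N (Pair x -` (UNIV - A)) = emeasure N UNIV - emeasure N (Pair x -` A)" for x
      using compl(1) borel_section[of A x] unfolding vimage_Diff vimage_UNIV
      by (intro emeasure_Diff) (auto simp: eq)
    then show ?case using compl(2) by simp
  next
    case (union A)
    have "emeasure N (Pair x -` (\<Union>i. A i)) = (\<Sum>i. emeasure N (Pair x -` A i))" for x
    proof -
      have "range (\<lambda>i. Pair x -` A i) \<subseteq> sets N"
        using union(2) borel_section[of "A _" x] by (auto simp: eq)
      moreover have "disjoint_family (\<lambda>i. Pair x -` A i)"
        using union(1) by (auto simp: disjoint_family_on_def)
      ultimately show ?thesis unfolding vimage_UN by (simp add: suminf_emeasure)
    qed
    then show ?case using union(3) by simp
  qed
qed

text \<open>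
  The measure is \<open>E \<mapsto> \<integral> N (E\<^sub>x) dM\<close>. For inner regularity on an open set \<open>U\<close>, take a countable union \<open>Q\<close>
  of compact subsets of \<open>U\<close> whose measure is the supremum over all compact subsets. If \<open>Q\<close> missed a part of positive
  measure, the tube lemma would give a compact rectangle inside \<open>U\<close> adding mass to \<open>Q\<close>.
\<close>

lemma radon_product_exists:
  fixes M :: "'a::t2_space measure" and N :: "'b::t2_space measure"
  assumes M: "radon M" "finite_measure M" and N: "radon N" "finite_measure N"
  obtains R :: "('a \<times> 'b) measure" where "radon R" "finite_measure R"
    "\<And>A B. A \<in> sets borel \<Longrightarrow> B \<in> sets borel \<Longrightarrow> emeasure R (A \<times> B) = emeasure M A * emeasure N B"
proof -
  interpret M: finite_measure M by fact
  interpret N: finite_measure N by fact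
  note [simp] = radonD(1,2)[OF M(1)] radonD(1,2)[OF N(1)]
  have meas: "(\<lambda>x. emeasure N (Pair x -` E)) \<in> borel_measurable M"
    if "E \<in> sets borel" for E :: "('a \<times> 'b) set"
    using emeasure_section_measurable[OF N that] by (simp cong: measurable_cong_sets)
  have secN: "Pair x -` E \<in> sets N" if "E \<in> sets borel" for E :: "('a \<times> 'b) set" and x
    using borel_section[OF that, of x] by simp
  define R :: "('a \<times> 'b) measure"
    where "R = measure_of UNIV (sets borel) (\<lambda>E. \<integral>\<^sup>+x. emeasure N (Pair x -` E) \<partial>M)"
  have [simp]: "sets R = sets borel" "space R = UNIV"
    unfolding R_def using sets.sigma_sets_eq[of "borel :: ('a \<times> 'b) measure"] by (auto)
  have "sigma_algebra UNIV (sets (borel :: ('a \<times> 'b) measure))"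
    using sets.sigma_algebra_axioms[of "borel :: ('a \<times> 'b) measure"] by simp
  then have em: "emeasure R E = (\<integral>\<^sup>+x. emeasure N (Pair x -` E) \<partial>M)" if "E \<in> sets borel" for E
    unfolding R_def
  proof (rule emeasure_measure_of_sigma)
    show "positive (sets borel) (\<lambda>E::('a \<times> 'b) set. \<integral>\<^sup>+x. emeasure N (Pair x -` E) \<partial>M)"
      by (simp add: positive_def)
    show "countably_additive (sets borel) (\<lambda>E::('a \<times> 'b) set. \<integral>\<^sup>+x. emeasure N (Pair x -` E) \<partial>M)"
    proof (rule countably_additiveI)
      fix A :: "nat \<Rightarrow> ('a \<times> 'b) set" assume A: "range A \<subseteq> sets borel" "disjoint_family A"
      have "(\<Sum>i. emeasure N (Pair x -` A i)) = emeasure N (Pair x -` (\<Union>i. A i))" for x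
        unfolding vimage_UN
      proof (rule suminf_emeasure)
        show "range (\<lambda>i. Pair x -` A i) \<subseteq> sets N" using A(1) secN by auto
        show "disjoint_family (\<lambda>i. Pair x -` A i)" using A(2) by (auto simp: disjoint_family_on_def)
      qed
      moreover have "(\<Sum>i. \<integral>\<^sup>+x. emeasure N (Pair x -` A i) \<partial>M) = (\<integral>\<^sup>+x. (\<Sum>i. emeasure N (Pair x -` A i)) \<partial>M)"
        using A(1) meas by (intro nn_integral_suminf[symmetric]) auto
      ultimately show "(\<Sum>i. \<integral>\<^sup>+x. emeasure N (Pair x -` A i) \<partial>M) =
          (\<integral>\<^sup>+x. emeasure N (Pair x -` (\<Union>i. A i)) \<partial>M)" by simp
    qed
    show "E \<in> sets borel" by fact
  qed
  have rect: "emeasure R (A \<times> B) = emeasure M A * emeasure N B"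
    if "A \<in> sets borel" "B \<in> sets borel" for A B
  proof -
    have "emeasure R (A \<times> B) = (\<integral>\<^sup>+x. emeasure N B * indicator A x \<partial>M)"
      unfolding em[OF borel_Times[OF that]]
      by (intro nn_integral_cong) (auto simp: indicator_def vimage_def)
    also have "\<dots> = emeasure M A * emeasure N B"
      using that by (subst nn_integral_cmult_indicator) (simp_all add: mult.commute)
    finally show ?thesis .
  qed
  have fin: "finite_measure R"
  proof
    have "emeasure R UNIV = emeasure M UNIV * emeasure N UNIV"
      using rect[of UNIV UNIV] by simp
    then show "emeasure R (space R) \<noteq> \<infinity>"
      using M.emeasure_finite[of UNIV] N.emeasure_finite[of UNIV]
      by (simp add: ennreal_mult_eq_top_iff)
  qed
  interpret R: finite_measure R by fact
  have "radon R"
  proof (rule radonI_open_inner_regular[OF _ fin])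
    fix U :: "('a \<times> 'b) set" and c
    assume U: "open U" and c: "c < emeasure R U"
    show "\<exists>K. compact K \<and> K \<subseteq> U \<and> c < emeasure R K"
    proof (rule ccontr)
      assume neg: "\<not> ?thesis"
      define s where "s = (SUP K\<in>{K. compact K \<and> K \<subseteq> U}. emeasure R K)"
      have "s \<le> c" unfolding s_def using neg by (intro SUP_least) (auto simp: not_less)
      then have sU: "s < emeasure R U" using c by simp
      have ne: "{K. compact K \<and> K \<subseteq> U} \<noteq> {}"
        by (rule ex_in_conv[THEN iffD1], rule exI[of _ "{}"]) simp
      obtain F :: "nat \<Rightarrow> ennreal" where F: "range F \<subseteq> emeasure R ` {K. compact K \<and> K \<subseteq> U}"
        and sF: "s = Sup (range F)"
        using ennreal_SUP_countable_SUP[OF ne, of "emeasure R"] unfolding s_def by blast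
      have "\<forall>n. \<exists>K. compact K \<and> K \<subseteq> U \<and> F n = emeasure R K"
        using F by auto
      then obtain C where C: "\<And>n. compact (C n)" "\<And>n. C n \<subseteq> U" "\<And>n. F n = emeasure R (C n)"
        by metis
      have Cb[simp]: "C n \<in> sets borel" for n using borel_compact[OF C(1)] .
      define Q where "Q = (\<Union>n. C n)"
      have Qb[simp]: "Q \<in> sets borel" unfolding Q_def by (intro sets.countable_UN) auto
      have sQ: "s \<le> emeasure R Q"
        unfolding sF C(3) Q_def by (intro SUP_least emeasure_mono) auto
      \<comment> \<open>\<open>Q\<close> itself need not be compact, but \<open>Q \<union> K\<close>
        is an increasing limit of compact subsets of \<open>U\<close>, each of measure at most
        \<open>s\<close>.\<close>
      have Qs: "emeasure R (Q \<union> K) \<le> s" if K: "compact K" "K \<subseteq> U" for K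
      proof -
        have Kb: "K \<in> sets borel" using borel_compact[OF K(1)] .
        have UQ: "(\<Union>n. (\<Union>i\<le>n. C i) \<union> K) = Q \<union> K" unfolding Q_def by blast
        have sup: "(SUP n. emeasure R ((\<Union>i\<le>n. C i) \<union> K)) = emeasure R (\<Union>n. (\<Union>i\<le>n. C i) \<union> K)"
        proof (rule SUP_emeasure_incseq)
          show "range (\<lambda>n. (\<Union>i\<le>n. C i) \<union> K) \<subseteq> sets R"
            using Kb by (auto intro!: sets.Un sets.finite_UN)
          show "incseq (\<lambda>n. (\<Union>i\<le>n. C i) \<union> K)" unfolding incseq_def by fastforce
        qed
        have "emeasure R ((\<Union>i\<le>n. C i) \<union> K) \<le> s" for n
          unfolding s_def using C K by (intro SUP_upper) (auto intro!: compact_Un compact_UN)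
        then show ?thesis unfolding UQ[symmetric] sup[symmetric] by (rule SUP_least)
      qed
      define q where "q x = emeasure N (Pair x -` Q)" for x
      define h where "h x = emeasure N (Pair x -` U)" for x
      have [measurable]: "q \<in> borel_measurable M" "h \<in> borel_measurable M"
        unfolding q_def h_def using meas U by auto
      have "\<not> (AE x in M. h x \<le> q x)"
      proof
        assume "AE x in M. h x \<le> q x"
        then have "emeasure R U \<le> emeasure R Q"
          using U unfolding em[OF Qb] em[OF borel_open[OF U]] q_def h_def by (intro nn_integral_mono_AE)
        also have "emeasure R Q \<le> s" using Qs[of "{}"] by simp
        finally show False using sU by simp
      qed
      \<comment> \<open>A strict inequality between sections is witnessed by a rational level. There
        are countably many levels, so one fixed \<open>r\<close> must separate \<open>q\<close> and
        \<open>h\<close> on a set that is not null.\<close>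
      moreover have "AE x in M. h x \<le> q x"
        if "\<forall>r::rat. {x. q x < ennreal (of_rat r) \<and> ennreal (of_rat r) < h x} \<in> null_sets M"
      proof -
        have "AE x in M. \<not> (q x < ennreal (of_rat r) \<and> ennreal (of_rat r) < h x)" for r :: rat
          using AE_not_in[OF that[rule_format, of r]] by simp
        then have "AE x in M. \<forall>r::rat. \<not> (q x < ennreal (of_rat r) \<and> ennreal (of_rat r) < h x)"
          by (simp add: AE_all_countable)
        then show ?thesis
        proof (rule AE_mp, intro AE_I2 impI)
          fix x assume *: "\<forall>r::rat. \<not> (q x < ennreal (of_rat r) \<and> ennreal (of_rat r) < h x)"
          show "h x \<le> q x"
          proof (rule ccontr)
            assume "\<not> ?thesis"
            then obtain r where "q x < ennreal (of_rat r)" "ennreal (of_rat r) < h x"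
              using ennreal_rat_dense[of "q x" "h x"] by (auto simp: not_le)
            then show False using * by blast
          qed
        qed
      qed
      ultimately obtain r :: rat
        where r: "{x. q x < ennreal (of_rat r) \<and> ennreal (of_rat r) < h x} \<notin> null_sets M" by blast
      define F' where "F' = {x. q x < ennreal (of_rat r) \<and> ennreal (of_rat r) < h x}"
      have "{x \<in> space M. q x < ennreal (of_rat r) \<and> ennreal (of_rat r) < h x} \<in> sets M"
        by measurable
      then have F'b: "F' \<in> sets borel" unfolding F'_def by simp
      have "0 < emeasure M F'" using r F'b unfolding F'_def by (simp add: null_sets_def zero_less_iff_neq_zero)
      then obtain D where D: "compact D" "D \<subseteq> F'" "0 < emeasure M D"
        by (rule radon_inner[OF M(1) F'b])
      have "\<forall>x\<in>D. \<exists>V K. open V \<and> x \<in> V \<and> compact K \<and> V \<times> K \<subseteq> U \<and> ennreal (of_rat r) < emeasure N K"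
      proof
        fix x assume "x \<in> D"
        then have "ennreal (of_rat r) < emeasure N (Pair x -` U)" using D(2) unfolding F'_def h_def by auto
        from section_tube[OF N(1) U this]
        show "\<exists>V K. open V \<and> x \<in> V \<and> compact K \<and> V \<times> K \<subseteq> U \<and> ennreal (of_rat r) < emeasure N K" by metis
      qed
      then obtain V K where VK: "\<And>x. x \<in> D \<Longrightarrow> open (V x)" "\<And>x. x \<in> D \<Longrightarrow> x \<in> V x"
        "\<And>x. x \<in> D \<Longrightarrow> compact (K x)" "\<And>x. x \<in> D \<Longrightarrow> V x \<times> K x \<subseteq> U"
        "\<And>x. x \<in> D \<Longrightarrow> ennreal (of_rat r) < emeasure N (K x)" by metis
      obtain T where T: "T \<subseteq> D" "finite T" "D \<subseteq> (\<Union>x\<in>T. V x)"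
        using compactE_image[OF D(1), of D V] VK(1,2) by blast
      have Db: "D \<in> sets borel" using borel_compact[OF D(1)] .
      \<comment> \<open>The tubes depend on the point; finitely many cover \<open>D\<close>, so the
        base of one of them meets \<open>D\<close> in positive measure and a single fibre
        \<open>K x\<close> suffices.\<close>
      have "\<exists>x\<in>T. 0 < emeasure M (D \<inter> V x)"
      proof (rule ccontr)
        assume "\<not> ?thesis"
        then have "D \<inter> V x \<in> null_sets M" if "x \<in> T" for x
          using that T(1) VK(1) Db by (auto simp: null_sets_def)
        then have "(\<Union>x\<in>T. D \<inter> V x) \<in> null_sets M" using T(2) by (intro null_sets.finite_UN) auto
        moreover have "(\<Union>x\<in>T. D \<inter> V x) = D" using T(3) by blast
        ultimately show False using D(3) by (auto simp: null_sets_def)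
      qed
      then obtain x where x: "x \<in> T" "0 < emeasure M (D \<inter> V x)" by blast
      then have xD: "x \<in> D" using T(1) by blast
      have "D \<inter> V x \<in> sets borel" using Db VK(1)[OF xD] by auto
      then obtain D' where D': "compact D'" "D' \<subseteq> D \<inter> V x" "0 < emeasure M D'"
        using radon_inner[OF M(1) _ x(2)] by blast
      have Kb: "K x \<in> sets borel" using borel_compact[OF VK(3)[OF xD]] .
      have D'b: "D' \<in> sets borel" using borel_compact[OF D'(1)] .
      have DKb: "D' \<times> K x \<in> sets borel" by (rule borel_Times[OF D'b Kb])
      have DQb: "D' \<times> K x - Q \<in> sets borel" using DKb Qb by (rule sets.Diff)
      have "compact (D' \<times> K x)" using D'(1) VK(3)[OF xD] by (rule compact_Times)
      moreover have "D' \<times> K x \<subseteq> U" using D'(2) VK(4)[OF xD] by blast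
      ultimately have "emeasure R (Q \<union> (D' \<times> K x)) \<le> emeasure R Q" using Qs sQ order.trans by blast
      moreover have "emeasure R (Q \<union> (D' \<times> K x)) = emeasure R Q + emeasure R (D' \<times> K x - Q)"
        using DQb plus_emeasure[of Q R "D' \<times> K x - Q"] by simp
      ultimately have "emeasure R (D' \<times> K x - Q) = 0"
        using R.emeasure_finite[of Q] by (metis add.right_neutral ennreal_add_left_cancel_le infinity_ennreal_def le_zero_eq)
      then have "(\<integral>\<^sup>+y. emeasure N (Pair y -` (D' \<times> K x - Q)) \<partial>M) = 0"
        using em[OF DQb] by simp
      then have "AE y in M. emeasure N (Pair y -` (D' \<times> K x - Q)) = 0"
        using nn_integral_0_iff_AE[OF meas[OF DQb]] by simp
      \<comment> \<open>Over \<open>D'\<close> the section of \<open>Q\<close> has measure below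
        \<open>r\<close> and \<open>K x\<close> has measure above \<open>r\<close>, so
        \<open>Q\<close> cannot contain almost all of \<open>K x\<close> there.\<close>
      moreover have "y \<notin> D'" if y: "emeasure N (Pair y -` (D' \<times> K x - Q)) = 0" for y
      proof
        assume yD: "y \<in> D'"
        have "emeasure N (K x) \<le> emeasure N (Pair y -` Q \<union> Pair y -` (D' \<times> K x - Q))"
          using yD by (intro emeasure_mono sets.Un secN Qb DQb) auto
        also have "\<dots> \<le> emeasure N (Pair y -` Q) + emeasure N (Pair y -` (D' \<times> K x - Q))"
          by (intro emeasure_subadditive secN Qb DQb)
        also have "\<dots> = q y" using y by (simp add: q_def)
        also have "\<dots> < ennreal (of_rat r)" using yD D'(2) D(2) by (auto simp: F'_def)
        finally show False using VK(5)[OF xD] less_asym by blast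
      qed
      ultimately have "AE y in M. y \<notin> D'" by auto
      then have "D' \<in> null_sets M" using D'b by (simp add: AE_iff_null_sets)
      then show False using D'(3) by auto
    qed
  qed simp
  then show ?thesis using that fin rect by blast
qed

section \<open>Uniqueness of the Radon product and integrals against it\<close>

lemma measurable_fst_snd_borel [measurable]:
  "fst \<in> (borel :: ('a::topological_space \<times> 'b::topological_space) measure) \<rightarrow>\<^sub>M borel"
  "snd \<in> (borel :: ('a::topological_space \<times> 'b::topological_space) measure) \<rightarrow>\<^sub>M borel"
  by (auto intro!: borel_measurable_continuous_onI continuous_intros)

lemma sets_pair_borel_subset:
  "sets (borel \<Otimes>\<^sub>M borel) \<subseteq> sets (borel :: ('a::t2_space \<times> 'b::t2_space) measure)"
  unfolding sets_pair_measure
  by (rule sets.sigma_sets_subset'[of _ borel, simplified]) (auto intro: borel_Times)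

text \<open>Rectangles generate the product \<sigma>-algebra, and Dynkin induction gives equality
  only there. A compact \<open>Q\<close> may lie outside it, but it can be separated from any
  disjoint compact set by a finite union of open rectangles. Inner regularity of
  \<open>\<rho>'\<close> on the complement of \<open>Q\<close> in a compact rectangle makes this
  separation tight up to \<open>e\<close>. Exchanging the roles of the two measures gives equality
  on compact sets, and inner regularity extends it to Borel sets.\<close>

lemma radon_eqI_rectangles:
  fixes \<rho> \<rho>' :: "('a::t2_space \<times> 'b::t2_space) measure"
  assumes \<rho>: "radon \<rho>" and \<rho>': "radon \<rho>'"
    and rect: "\<And>A B. A \<in> sets borel \<Longrightarrow> B \<in> sets borel \<Longrightarrow> emeasure \<rho> (A \<times> B) = emeasure \<rho>' (A \<times> B)"
  shows "\<rho> = \<rho>'"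
proof -
  have le: "emeasure \<rho> Q \<le> emeasure \<rho>' Q"
    if \<rho>: "radon \<rho>" and \<rho>': "radon \<rho>'" and Q: "compact Q"
      and rect: "\<And>A B. A \<in> sets borel \<Longrightarrow> B \<in> sets borel \<Longrightarrow> emeasure \<rho> (A \<times> B) = emeasure \<rho>' (A \<times> B)"
    for \<rho> \<rho>' :: "('a \<times> 'b) measure" and Q
  proof -
    note [simp] = radonD(1,2)[OF \<rho>] radonD(1,2)[OF \<rho>']
    \<comment> \<open>The measures may be infinite. All comparisons take place inside this compact
      rectangle, where both are finite and differences can be formed.\<close>
    define KL where "KL = fst ` Q \<times> snd ` Q"
    have c: "compact (fst ` Q)" "compact (snd ` Q)"
      using Q by (auto intro!: compact_continuous_image continuous_intros)
    then have cb: "fst ` Q \<in> sets borel" "snd ` Q \<in> sets borel" by (auto intro: borel_compact)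
    have cKL: "compact KL" unfolding KL_def using c by (rule compact_Times)
    then have KLb[simp]: "KL \<in> sets borel" by (rule borel_compact)
    have Qb[simp]: "Q \<in> sets borel" using Q by (rule borel_compact)
    have QKL: "Q \<subseteq> KL" unfolding KL_def by force
    have finKL: "emeasure \<rho>'' (E \<inter> KL) \<noteq> \<infinity>" if "radon \<rho>''" for \<rho>'' E
    proof -
      have "emeasure \<rho>'' (E \<inter> KL) \<le> emeasure \<rho>'' KL"
        using radonD(1)[OF that] by (intro emeasure_mono) auto
      then show ?thesis using radonD(3)[OF that cKL] by auto
    qed
    have eq: "emeasure \<rho> (E \<inter> KL) = emeasure \<rho>' (E \<inter> KL)"
      if E: "E \<in> sets (borel \<Otimes>\<^sub>M borel)" for E :: "('a \<times> 'b) set"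
    proof -
      let ?G = "{a \<times> b |a b. a \<in> sets (borel :: 'a measure) \<and> b \<in> sets (borel :: 'b measure)}"
      have Gb: "sigma_sets (UNIV \<times> UNIV) ?G \<subseteq> sets borel"
        using sets_pair_borel_subset unfolding sets_pair_measure by simp
      have "Int_stable ?G" by (rule Int_stable_pair_measure_generator)
      moreover have "?G \<subseteq> Pow (UNIV \<times> UNIV)" by auto
      moreover have "E \<in> sigma_sets (UNIV \<times> UNIV) ?G" using E unfolding sets_pair_measure by simp
      ultimately show ?thesis
      proof (induction rule: sigma_sets_induct_disjoint)
        case (basic E)
        then obtain A B where AB: "E = A \<times> B" "A \<in> sets borel" "B \<in> sets borel" by auto
        have "E \<inter> KL = (A \<inter> fst ` Q) \<times> (B \<inter> snd ` Q)" unfolding AB KL_def by auto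
        then show ?case using rect AB cb by auto
      next
        case empty
        show ?case by simp
      next
        case (compl E)
        have "E \<inter> KL \<in> sets borel" using compl(1) Gb by (auto intro!: sets.Int)
        have "emeasure \<rho>'' ((UNIV \<times> UNIV - E) \<inter> KL) = emeasure \<rho>'' KL - emeasure \<rho>'' (E \<inter> KL)"
          if r: "radon \<rho>''" for \<rho>''
        proof -
          have "(UNIV \<times> UNIV - E) \<inter> KL = KL - (E \<inter> KL)" by auto
          then show ?thesis
            using finKL[OF r, of E] radonD(1)[OF r] \<open>E \<inter> KL \<in> sets borel\<close> emeasure_Diff[of \<rho>'' "E \<inter> KL" KL] by simp
        qed
        moreover have "emeasure \<rho> KL = emeasure \<rho>' KL" unfolding KL_def using rect cb by simp
        ultimately show ?case using \<rho> \<rho>' compl(2) by simp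
      next
        case (union A)
        have "emeasure \<rho>'' ((\<Union>i. A i) \<inter> KL) = (\<Sum>i. emeasure \<rho>'' (A i \<inter> KL))"
          if r: "radon \<rho>''" for \<rho>''
        proof -
          have "range (\<lambda>i. A i \<inter> KL) \<subseteq> sets \<rho>''"
            using union(2) Gb radonD(1)[OF r] by (auto intro!: sets.Int)
          moreover have "disjoint_family (\<lambda>i. A i \<inter> KL)"
            using union(1) by (auto simp: disjoint_family_on_def)
          ultimately show ?thesis by (simp add: suminf_emeasure Int_UN_distrib2 UN_extend_simps del: UN_simps)
        qed
        then show ?case using union(3) \<rho> \<rho>' by simp
      qed
    qed
    show ?thesis
    proof (rule ennreal_le_epsilon)
      fix e :: real assume e: "0 < e" and "emeasure \<rho>' Q < top"
      define W where "W = KL - Q"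
      have Wb: "W \<in> sets borel" unfolding W_def using KLb Qb by (rule sets.Diff)
      have Wfin: "emeasure \<rho>' W \<noteq> \<infinity>" using finKL[OF \<rho>', of "- Q"] unfolding W_def by (simp add: Diff_eq inf_commute)
      obtain C where C: "compact C" "C \<subseteq> W" "emeasure \<rho>' W \<le> emeasure \<rho>' C + ennreal e"
      proof (cases "emeasure \<rho>' W \<le> ennreal e")
        case True
        then show ?thesis using that[of "{}"] by simp
      next
        case False
        then have "emeasure \<rho>' W - ennreal e < emeasure \<rho>' W"
          using e Wfin by (intro ennreal_between) (auto simp: less_top[symmetric] intro: gr_zeroI)
        then obtain C where "compact C" "C \<subseteq> W" "emeasure \<rho>' W - ennreal e < emeasure \<rho>' C"
          by (rule radon_inner[OF \<rho>' Wb])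
        moreover from this have "emeasure \<rho>' W \<le> ennreal e + emeasure \<rho>' C"
          by (meson ennreal_minus_le_iff less_imp_le)
        ultimately show ?thesis using that[of C] by (simp add: add.commute)
      qed
      have Cb[simp]: "C \<in> sets borel" using C(1) by (rule borel_compact)
      have "open (- C)" using C(1) compact_imp_closed by blast
      moreover have "Q \<subseteq> - C" using C(2) W_def by blast
      ultimately have "\<forall>z\<in>Q. \<exists>A B. open A \<and> open B \<and> z \<in> A \<times> B \<and> A \<times> B \<subseteq> - C"
        by (metis open_prod_def subsetD)
      then obtain A B where AB: "\<And>z. z \<in> Q \<Longrightarrow> open (A z)" "\<And>z. z \<in> Q \<Longrightarrow> open (B z)"
        "\<And>z. z \<in> Q \<Longrightarrow> z \<in> A z \<times> B z" "\<And>z. z \<in> Q \<Longrightarrow> A z \<times> B z \<subseteq> - C" by metis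
      obtain T where T: "T \<subseteq> Q" "finite T" "Q \<subseteq> (\<Union>z\<in>T. A z \<times> B z)"
      proof (rule compactE_image[OF Q, of Q "\<lambda>z. A z \<times> B z"])
        show "open (A z \<times> B z)" if "z \<in> Q" for z using AB(1,2)[OF that] by (rule open_Times)
        show "Q \<subseteq> (\<Union>z\<in>Q. A z \<times> B z)" using AB(3) by blast
      qed
      \<comment> \<open>As a finite union of open rectangles, \<open>Z\<close> belongs to the
        product \<sigma>-algebra, where the two measures agree inside \<open>KL\<close>. It covers
        \<open>Q\<close> and avoids \<open>C\<close>, so for \<open>\<rho>'\<close> it exceeds
        \<open>Q\<close> inside \<open>KL\<close> by at most \<open>e\<close>.\<close>
      define Z where "Z = (\<Union>z\<in>T. A z \<times> B z)"
      have Zp: "Z \<in> sets (borel \<Otimes>\<^sub>M borel)"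
        unfolding Z_def using T AB(1,2) by (intro sets.finite_UN pair_measureI) auto
      then have Zb: "Z \<in> sets borel" using sets_pair_borel_subset by blast
      have ZC: "Z \<subseteq> - C" unfolding Z_def using T(1) AB(4) by blast
      have "emeasure \<rho> Q \<le> emeasure \<rho> (Z \<inter> KL)"
        using T(3) QKL Zb unfolding Z_def[symmetric] by (intro emeasure_mono) auto
      also have "\<dots> = emeasure \<rho>' (Z \<inter> KL)" by (rule eq[OF Zp])
      also have "\<dots> \<le> emeasure \<rho>' (Q \<union> (W - C))"
        using ZC sets.Un[OF Qb sets.Diff[OF Wb Cb]] by (intro emeasure_mono) (auto simp: W_def)
      also have "\<dots> \<le> emeasure \<rho>' Q + emeasure \<rho>' (W - C)"
        using sets.Diff[OF Wb Cb] by (intro emeasure_subadditive) auto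
      also have "emeasure \<rho>' (W - C) = emeasure \<rho>' W - emeasure \<rho>' C"
        using C Wb radonD(3)[OF \<rho>' C(1)] by (intro emeasure_Diff) auto
      also have "\<dots> \<le> ennreal e"
        using C(3) Wfin by (auto simp: ennreal_minus_le_iff add.commute)
      finally show "emeasure \<rho> Q \<le> emeasure \<rho>' Q + ennreal e" by simp
    qed
  qed
  have "emeasure \<rho> Q = emeasure \<rho>' Q" if "compact Q" for Q
    using le[OF \<rho> \<rho>' that rect] le[OF \<rho>' \<rho> that rect[symmetric]] by (rule antisym)
  then have "emeasure \<rho> E = emeasure \<rho>' E" if "E \<in> sets borel" for E
    unfolding radonD(4)[OF \<rho> that] radonD(4)[OF \<rho>' that] by (intro SUP_cong) auto
  then show ?thesis using radonD(1)[OF \<rho>] radonD(1)[OF \<rho>'] by (intro measure_eqI) auto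
qed

text \<open>Uniqueness is what discharges the definite description: any Radon measure with the right
  rectangle values is the product.\<close>

lemma radon_prod_eqI:
  assumes "radon \<rho>"
    and "\<And>A B. A \<in> sets borel \<Longrightarrow> B \<in> sets borel \<Longrightarrow> emeasure \<rho> (A \<times> B) = emeasure \<mu> A * emeasure \<nu> B"
  shows "radon_prod \<mu> \<nu> = \<rho>"
  unfolding radon_prod_def using assms by (intro the_equality) (auto intro!: radon_eqI_rectangles)

text \<open>The integrand is measurable for the product \<sigma>-algebra, and on that
  \<sigma>-algebra \<open>R\<close> coincides with the ordinary product measure
  \<open>S \<Otimes>\<^sub>M S\<close>, so Tonelli applies.\<close>

lemma radon_rectangles_nn_integral:
  fixes S :: "'a::t2_space measure" and R :: "('a \<times> 'a) measure"
  assumes S: "sets S = sets borel" "sigma_finite_measure S" and R: "sets R = sets borel"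
    and rect: "\<And>A B. A \<in> sets borel \<Longrightarrow> B \<in> sets borel \<Longrightarrow> emeasure R (A \<times> B) = emeasure S A * emeasure S B"
    and u[measurable]: "u \<in> borel_measurable borel" and v[measurable]: "v \<in> borel_measurable borel"
  shows "(\<integral>\<^sup>+z. u (fst z) * v (snd z) \<partial>R) = (\<integral>\<^sup>+x. u x \<partial>S) * (\<integral>\<^sup>+x. v x \<partial>S)"
proof -
  interpret S: sigma_finite_measure S by fact
  have [simp]: "space S = UNIV" "space R = UNIV" using sets_eq_imp_space_eq[OF S(1)] sets_eq_imp_space_eq[OF R] by auto
  let ?D = "distr R (borel \<Otimes>\<^sub>M borel) (\<lambda>z. z)"
  have SS: "sets (S \<Otimes>\<^sub>M S) = sets (borel \<Otimes>\<^sub>M (borel :: 'a measure))"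
    using S(1) by (intro sets_pair_measure_cong) auto
  have id: "(\<lambda>z. z) \<in> R \<rightarrow>\<^sub>M (borel \<Otimes>\<^sub>M borel)"
    using sets_pair_borel_subset R by (auto intro!: measurableI simp: space_pair_measure)
  have "S \<Otimes>\<^sub>M S = ?D"
  proof (rule pair_measure_eqI[OF S(2,2)])
    fix A B assume AB: "A \<in> sets S" "B \<in> sets S"
    then have "A \<times> B \<in> sets (borel \<Otimes>\<^sub>M borel)" using S(1) by auto
    then have "emeasure ?D (A \<times> B) = emeasure R (A \<times> B)"
      using emeasure_distr[OF id, of "A \<times> B"] by simp
    then show "emeasure S A * emeasure S B = emeasure ?D (A \<times> B)"
      using rect AB S(1) by simp
  qed (simp add: SS)
  have uS[measurable]: "u \<in> borel_measurable S" "v \<in> borel_measurable S"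
    using u v by (simp_all cong: measurable_cong_sets add: S(1))
  have "(\<integral>\<^sup>+z. u (fst z) * v (snd z) \<partial>R) = (\<integral>\<^sup>+z. u (fst z) * v (snd z) \<partial>?D)"
    by (subst nn_integral_distr[OF id]) measurable
  also have "\<dots> = (\<integral>\<^sup>+z. u (fst z) * v (snd z) \<partial>(S \<Otimes>\<^sub>M S))" by (simp add: \<open>S \<Otimes>\<^sub>M S = ?D\<close>)
  also have "\<dots> = (\<integral>\<^sup>+x. \<integral>\<^sup>+y. u x * v y \<partial>S \<partial>S)"
    using measurable_compose[OF measurable_fst uS(1), of S] measurable_compose[OF measurable_snd uS(2), of S]
    by (subst S.nn_integral_fst[symmetric]) (auto intro: borel_measurable_times_ennreal)
  also have "\<dots> = (\<integral>\<^sup>+x. u x \<partial>S) * (\<integral>\<^sup>+x. v x \<partial>S)"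
    by (simp add: nn_integral_cmult nn_integral_multc)
  finally show ?thesis .
qed

text \<open>Rectangle values factor by the preceding product formula. Inner regularity is inherited
  from \<open>R\<close> through compact exhaustion, and a compact set has finite measure because it
  lies in the rectangle of its two compact projections.\<close>

lemma radon_prod_density:
  fixes S :: "'a::t2_space measure" and R :: "('a \<times> 'a) measure"
  assumes S: "radon S" "finite_measure S" and R: "radon R" "finite_measure R"
    and rect: "\<And>A B. A \<in> sets borel \<Longrightarrow> B \<in> sets borel \<Longrightarrow> emeasure R (A \<times> B) = emeasure S A * emeasure S B"
    and u[measurable]: "u \<in> borel_measurable borel" and v[measurable]: "v \<in> borel_measurable borel"
    and ru: "radon (density S u)" and rv: "radon (density S v)"
  shows "radon_prod (density S u) (density S v) = density R (\<lambda>z. u (fst z) * v (snd z))"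
proof (rule radon_prod_eqI)
  have sf: "sigma_finite_measure S" "sigma_finite_measure R"
    using S(2) R(2) by (auto simp: finite_measure_def)
  note [simp] = radonD(1,2)[OF S(1)] radonD(1,2)[OF R(1)]
  let ?w = "\<lambda>z. u (fst z) * v (snd z)"
  have [measurable]: "?w \<in> borel_measurable R" by (simp cong: measurable_cong_sets)
  have uS[measurable]: "u \<in> borel_measurable S" "v \<in> borel_measurable S"
    using u v by (simp_all cong: measurable_cong_sets)
  show r: "emeasure (density R ?w) (A \<times> B) = emeasure (density S u) A * emeasure (density S v) B"
    if AB[measurable]: "A \<in> sets borel" "B \<in> sets borel" for A B
  proof -
    have "emeasure (density R ?w) (A \<times> B) = (\<integral>\<^sup>+z. ?w z * indicator (A \<times> B) z \<partial>R)"
      using borel_Times[OF AB] by (subst emeasure_density) auto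
    also have "\<dots> = (\<integral>\<^sup>+z. (u (fst z) * indicator A (fst z)) * (v (snd z) * indicator B (snd z)) \<partial>R)"
      by (intro nn_integral_cong) (auto simp: indicator_def)
    also have "\<dots> = (\<integral>\<^sup>+x. u x * indicator A x \<partial>S) * (\<integral>\<^sup>+x. v x * indicator B x \<partial>S)"
      by (rule radon_rectangles_nn_integral[OF _ sf(1) _ rect]) (auto intro: borel_measurable_times_ennreal)
    finally show ?thesis using AB by (simp add: emeasure_density)
  qed
  show "radon (density R ?w)"
  proof (rule compactly_exhausted_imp_radon)
    show "compactly_exhausted (density R ?w)"
      using radon_imp_compactly_exhausted[OF R(1) sf(2)] by (rule compactly_exhausted_density) measurable
    fix Q :: "('a \<times> 'a) set" assume Q: "compact Q"
    have c: "compact (fst ` Q)" "compact (snd ` Q)"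
      using Q by (auto intro!: compact_continuous_image continuous_intros)
    have b: "fst ` Q \<in> sets borel" "snd ` Q \<in> sets borel" using c by (auto intro: borel_compact)
    have "emeasure (density R ?w) Q \<le> emeasure (density R ?w) (fst ` Q \<times> snd ` Q)"
      using borel_Times[OF b] by (intro emeasure_mono) (auto intro: rev_image_eqI)
    also have "\<dots> = emeasure (density S u) (fst ` Q) * emeasure (density S v) (snd ` Q)" by (rule r[OF b])
    also have "\<dots> < \<infinity>" using radonD(3)[OF ru c(1)] radonD(3)[OF rv c(2)] by (simp add: ennreal_mult_less_top)
    finally show "emeasure (density R ?w) Q < \<infinity>" .
  qed
qed

section \<open>Energy of measures with a density\<close>

text \<open>\<open>R\<close> stands for the Radon product of \<open>S\<close> with itself, specified
  by its values on rectangles rather than through \<open>radon_prod\<close>. It is the one measure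
  against which all energies are computed.\<close>

locale energy_setting =
  fixes \<kappa> :: "'a::t2_space \<times> 'a \<Rightarrow> ereal" and S :: "'a measure" and R :: "('a \<times> 'a) measure"
  assumes kernel: "is_kernel \<kappa>"
    and S: "radon S" "finite_measure S" and R: "radon R" "finite_measure R"
    and rect: "\<And>A B. A \<in> sets borel \<Longrightarrow> B \<in> sets borel \<Longrightarrow> emeasure R (A \<times> B) = emeasure S A * emeasure S B"
begin

lemma sets_S [simp, measurable_cong]: "sets S = sets borel" and space_S [simp]: "space S = UNIV"
  using radonD(1,2)[OF S(1)] by auto

lemma sets_R [simp, measurable_cong]: "sets R = sets borel" and space_R [simp]: "space R = UNIV"
  using radonD(1,2)[OF R(1)] by auto

lemma sigma_finite_S: "sigma_finite_measure S" and sigma_finite_R: "sigma_finite_measure R"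
  using S R by (auto simp: finite_measure_def)

lemma kernel_measurable [measurable]: "\<kappa> \<in> borel_measurable borel"
  using kernel by (intro borel_measurableI_greater) (auto simp: is_kernel_def)

lemma kernel_neq_MInf [simp]: "\<kappa> z \<noteq> -\<infinity>"
  using kernel unfolding is_kernel_def by blast

lemma kernel_nonneg: "\<not> compact (UNIV :: 'a set) \<Longrightarrow> 0 \<le> \<kappa> z"
  using kernel unfolding is_kernel_def by blast

text \<open>Real densities, in contrast to \<open>ennreal\<close> ones, can be subtracted and split
  into positive and negative parts pointwise.\<close>

definition weighted_measure :: "('a \<Rightarrow> real) \<Rightarrow> 'a measure" where
  "weighted_measure u = density S (\<lambda>x. ennreal (u x))"

definition radon_density :: "('a \<Rightarrow> real) \<Rightarrow> bool" where
  "radon_density u \<longleftrightarrow> u \<in> borel_measurable borel \<and> (\<forall>x. 0 \<le> u x) \<and> radon (weighted_measure u)"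

lemma radon_densityD: assumes "radon_density u" shows "u \<in> borel_measurable borel" "0 \<le> u x" "radon (weighted_measure u)"
  using assms by (auto simp: radon_density_def)

text \<open>With the absolute value of the kernel the integral is monotone in nonnegative densities,
  although the kernel may take negative values; hence finiteness passes from a majorant to
  everything below it.\<close>

definition abs_energy :: "('a \<Rightarrow> real) \<Rightarrow> ('a \<Rightarrow> real) \<Rightarrow> ennreal" where
  "abs_energy u v = (\<integral>\<^sup>+z. e2ennreal \<bar>\<kappa> z\<bar> * ennreal (u (fst z) * v (snd z)) \<partial>R)"

text \<open>
  As \<open>real_of_ereal \<infinity> = 0\<close>, this represents the energy only if \<open>{\<kappa> = \<infinity>}\<close> is null for the weighted
  product, which holds if \<open>abs_energy u v\<close> is finite.
\<close>

definition weighted_kernel :: "('a \<Rightarrow> real) \<Rightarrow> ('a \<Rightarrow> real) \<Rightarrow> 'a \<times> 'a \<Rightarrow> real" where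
  "weighted_kernel u v z = real_of_ereal (\<kappa> z) * (u (fst z) * v (snd z))"

text \<open>This is the bilinear extension of the mutual energy from measures to signed
  densities.\<close>

definition energy_form :: "('a \<Rightarrow> real) \<Rightarrow> ('a \<Rightarrow> real) \<Rightarrow> real" where
  "energy_form u v = (\<integral>z. weighted_kernel u v z \<partial>R)"

lemma sets_weighted_measure [simp, measurable_cong]: "sets (weighted_measure u) = sets borel" and space_weighted_measure [simp]: "space (weighted_measure u) = UNIV"
  by (auto simp: weighted_measure_def)

lemma emeasure_weighted_measure:
  assumes "u \<in> borel_measurable borel" "E \<in> sets borel"
  shows "emeasure (weighted_measure u) E = (\<integral>\<^sup>+x. ennreal (u x) * indicator E x \<partial>S)"
  using assms unfolding weighted_measure_def by (subst emeasure_density) auto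

lemma radon_weighted_measure:
  assumes u: "u \<in> borel_measurable borel" and fin: "\<And>K. compact K \<Longrightarrow> emeasure (weighted_measure u) K < \<infinity>"
  shows "radon (weighted_measure u)"
proof (rule compactly_exhausted_imp_radon[OF _ fin])
  show "compactly_exhausted (weighted_measure u)" unfolding weighted_measure_def
    using u by (intro compactly_exhausted_density radon_imp_compactly_exhausted S sigma_finite_S) simp
qed

lemma radon_density_mono:
  assumes w: "radon_density w" and u: "u \<in> borel_measurable borel" "\<And>x. 0 \<le> u x" "\<And>x. u x \<le> w x"
  shows "radon_density u"
  unfolding radon_density_def
proof (intro conjI allI radon_weighted_measure u)
  note [measurable] = radon_densityD(1)[OF w] u(1)
  fix K :: "'a set" assume K: "compact K"
  have [measurable]: "K \<in> sets borel" using K by (rule borel_compact)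
  have "emeasure (weighted_measure u) K \<le> emeasure (weighted_measure w) K"
    using u(3) by (auto simp: emeasure_weighted_measure intro!: nn_integral_mono mult_right_mono ennreal_leI)
  also have "\<dots> < \<infinity>" using radonD(3)[OF radon_densityD(3)[OF w] K] .
  finally show "emeasure (weighted_measure u) K < \<infinity>" .
qed

lemma radon_density_add:
  assumes u: "radon_density u" and v: "radon_density v"
  shows "radon_density (\<lambda>x. u x + v x)"
proof -
  note [measurable] = radon_densityD(1)[OF u] radon_densityD(1)[OF v]
  have "emeasure (weighted_measure (\<lambda>x. u x + v x)) K < \<infinity>" if K: "compact K" for K
  proof -
    have [measurable]: "K \<in> sets borel" using K by (rule borel_compact)
    have "emeasure (weighted_measure (\<lambda>x. u x + v x)) K = emeasure (weighted_measure u) K + emeasure (weighted_measure v) K"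
      using radon_densityD(2)[OF u] radon_densityD(2)[OF v]
      by (simp add: emeasure_weighted_measure distrib_right nn_integral_add)
    then show ?thesis using radonD(3)[OF radon_densityD(3)[OF u] K] radonD(3)[OF radon_densityD(3)[OF v] K] by simp
  qed
  then show ?thesis using radon_densityD[OF u] radon_densityD[OF v] unfolding radon_density_def by (auto intro: radon_weighted_measure)
qed

lemma e2ennreal_abs: "e2ennreal \<bar>x\<bar> = e2ennreal x + e2ennreal (- x)"
proof (cases x)
  case (real r)
  then show ?thesis by (cases "0 \<le> r") (auto simp: ennreal_neg)
qed (auto simp: e2ennreal_neg)

lemma abs_energy_split:
  assumes [measurable]: "u \<in> borel_measurable borel" "v \<in> borel_measurable borel"
  shows "abs_energy u v = (\<integral>\<^sup>+z. e2ennreal (\<kappa> z) * ennreal (u (fst z) * v (snd z)) \<partial>R) +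
    (\<integral>\<^sup>+z. e2ennreal (- \<kappa> z) * ennreal (u (fst z) * v (snd z)) \<partial>R)"
  unfolding abs_energy_def e2ennreal_abs distrib_right by (intro nn_integral_add) measurable

lemma mutual_energy_weighted_measure:
  assumes u: "radon_density u" and v: "radon_density v"
  shows "mutual_energy \<kappa> (weighted_measure u) (weighted_measure v) =
    enn2ereal (\<integral>\<^sup>+z. e2ennreal (\<kappa> z) * ennreal (u (fst z) * v (snd z)) \<partial>R) -
    enn2ereal (\<integral>\<^sup>+z. e2ennreal (- \<kappa> z) * ennreal (u (fst z) * v (snd z)) \<partial>R)"
proof -
  note [measurable] = radon_densityD(1)[OF u] radon_densityD(1)[OF v]
  have "radon_prod (weighted_measure u) (weighted_measure v) = density R (\<lambda>z. ennreal (u (fst z)) * ennreal (v (snd z)))"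
    using radon_densityD(3)[OF u] radon_densityD(3)[OF v] unfolding weighted_measure_def
    by (intro radon_prod_density[OF S R rect]) auto
  also have "\<dots> = density R (\<lambda>z. ennreal (u (fst z) * v (snd z)))"
    using radon_densityD(2)[OF u] radon_densityD(2)[OF v] by (simp add: ennreal_mult)
  finally show ?thesis
    unfolding mutual_energy_def pairing_def
    by (simp add: nn_integral_density mult.commute)
qed

text \<open>Since \<open>\<infinity> - \<infinity> = \<infinity>\<close> in \<open>ereal\<close>,
  the difference of the positive and the negative part of the integral is finite only if both are,
  that is, only if their sum is.\<close>

lemma mutual_energy_finite_iff:
  assumes u: "radon_density u" and v: "radon_density v"
  shows "\<bar>mutual_energy \<kappa> (weighted_measure u) (weighted_measure v)\<bar> \<noteq> \<infinity> \<longleftrightarrow> abs_energy u v < \<infinity>"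
proof -
  have *: "\<bar>enn2ereal a - enn2ereal b\<bar> \<noteq> \<infinity> \<longleftrightarrow> a + b < \<infinity>" for a b
    by (cases a; cases b) auto
  show ?thesis
    unfolding mutual_energy_weighted_measure[OF u v] abs_energy_split[OF radon_densityD(1)[OF u] radon_densityD(1)[OF v]] * by simp
qed

lemma weighted_kernel_measurable [measurable]:
  assumes [measurable]: "u \<in> borel_measurable borel" "v \<in> borel_measurable borel"
  shows "weighted_kernel u v \<in> borel_measurable borel"
  unfolding weighted_kernel_def by measurable

text \<open>Domination by a pair of nonnegative densities of finite absolute energy is the only
  source of integrability for signed densities.\<close>

lemma integrable_weighted_kernel:
  assumes w: "radon_density w" "radon_density w'" "abs_energy w w' < \<infinity>"
    and [measurable]: "d \<in> borel_measurable borel" "e \<in> borel_measurable borel"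
    and d: "\<And>x. \<bar>d x\<bar> \<le> w x" "\<And>x. \<bar>e x\<bar> \<le> w' x"
  shows "integrable R (weighted_kernel d e)"
proof (rule integrableI_bounded)
  note [measurable] = radon_densityD(1)[OF w(1)]
  have "ennreal (norm (weighted_kernel d e z)) \<le> e2ennreal \<bar>\<kappa> z\<bar> * ennreal (w (fst z) * w' (snd z))" for z
  proof -
    have "ennreal (norm (weighted_kernel d e z)) = ennreal \<bar>real_of_ereal (\<kappa> z)\<bar> * ennreal (\<bar>d (fst z)\<bar> * \<bar>e (snd z)\<bar>)"
      by (subst ennreal_mult[symmetric]) (simp_all add: weighted_kernel_def abs_mult real_of_ereal_pos)
    also have "\<dots> \<le> e2ennreal \<bar>\<kappa> z\<bar> * ennreal (w (fst z) * w' (snd z))"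
      using radon_densityD(2)[OF w(1)] d by (intro mult_mono ennreal_leI) (cases "\<kappa> z", auto)
    finally show ?thesis .
  qed
  then have "(\<integral>\<^sup>+z. ennreal (norm (weighted_kernel d e z)) \<partial>R) \<le> abs_energy w w'"
    unfolding abs_energy_def by (intro nn_integral_mono) auto
  then show "(\<integral>\<^sup>+z. ennreal (norm (weighted_kernel d e z)) \<partial>R) < \<infinity>" using w(3) by (rule le_less_trans)
qed measurable

lemma mutual_energy_eq_energy_form:
  assumes u: "radon_density u" and v: "radon_density v" and fin: "abs_energy u v < \<infinity>"
  shows "mutual_energy \<kappa> (weighted_measure u) (weighted_measure v) = ereal (energy_form u v)"
proof -
  note [measurable] = radon_densityD(1)[OF u] radon_densityD(1)[OF v]
  let ?w = "\<lambda>z. u (fst z) * v (snd z)"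
  have w0: "0 \<le> ?w z" for z using radon_densityD(2)[OF u] radon_densityD(2)[OF v] by simp
  have int: "integrable R (weighted_kernel u v)"
    using radon_densityD(2)[OF u] radon_densityD(2)[OF v] by (intro integrable_weighted_kernel[OF u v fin]) auto
  have "AE z in R. e2ennreal \<bar>\<kappa> z\<bar> * ennreal (?w z) \<noteq> \<infinity>"
    using fin unfolding abs_energy_def by (intro nn_integral_noteq_infinite) auto
  then have ae: "AE z in R. ennreal (weighted_kernel u v z) = e2ennreal (\<kappa> z) * ennreal (?w z) \<and>
      ennreal (- weighted_kernel u v z) = e2ennreal (- \<kappa> z) * ennreal (?w z)"
  proof (rule AE_mp, intro AE_I2 impI)
    fix z assume z: "e2ennreal \<bar>\<kappa> z\<bar> * ennreal (?w z) \<noteq> \<infinity>"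
    show "ennreal (weighted_kernel u v z) = e2ennreal (\<kappa> z) * ennreal (?w z) \<and>
      ennreal (- weighted_kernel u v z) = e2ennreal (- \<kappa> z) * ennreal (?w z)"
    proof (cases "\<kappa> z")
      case (real r)
      have "ennreal (r * ?w z) = ennreal r * ennreal (?w z)"
        "ennreal ((- r) * ?w z) = ennreal (- r) * ennreal (?w z)"
        by (rule ennreal_mult''[OF w0])+
      then show ?thesis using real by (simp add: weighted_kernel_def)
    next
      case PInf
      then have "ennreal (?w z) = 0" using z by (auto simp: ennreal_top_mult split: if_splits)
      then show ?thesis using PInf w0[of z] by (simp add: weighted_kernel_def)
    next
      case MInf
      then show ?thesis using kernel_neq_MInf[of z] by blast
    qed
  qed
  have "(\<integral>\<^sup>+z. ennreal (weighted_kernel u v z) \<partial>R) = (\<integral>\<^sup>+z. e2ennreal (\<kappa> z) * ennreal (?w z) \<partial>R)"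
    "(\<integral>\<^sup>+z. ennreal (- weighted_kernel u v z) \<partial>R) = (\<integral>\<^sup>+z. e2ennreal (- \<kappa> z) * ennreal (?w z) \<partial>R)"
    using ae by (auto intro!: nn_integral_cong_AE)
  moreover have "(\<integral>\<^sup>+z. ennreal (weighted_kernel u v z) \<partial>R) \<noteq> \<infinity>" "(\<integral>\<^sup>+z. ennreal (- weighted_kernel u v z) \<partial>R) \<noteq> \<infinity>"
    using int by (auto simp: real_integrable_def)
  moreover have "ereal (enn2real a - enn2real b) = enn2ereal a - enn2ereal b"
    if "a \<noteq> \<infinity>" "b \<noteq> \<infinity>" for a b using that by (cases a; cases b) auto
  ultimately show ?thesis
    unfolding mutual_energy_weighted_measure[OF u v] energy_form_def real_lebesgue_integral_def[OF int] by metis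
qed

lemma abs_energy_mono:
  assumes "\<And>x y. u x * v y \<le> u' x * v' y"
  shows "abs_energy u v \<le> abs_energy u' v'"
  unfolding abs_energy_def by (intro nn_integral_mono mult_left_mono ennreal_leI assms) auto

text \<open>On a compact space lower semicontinuity bounds the kernel from below, as the open sets
  where it exceeds \<open>- n\<close> cover the compact product, and both measures have finite mass.
  On a noncompact space the kernel has no negative part.\<close>

lemma negative_energy_finite:
  assumes u: "radon_density u" and v: "radon_density v"
  shows "(\<integral>\<^sup>+z. e2ennreal (- \<kappa> z) * ennreal (u (fst z) * v (snd z)) \<partial>R) < \<infinity>"
proof (cases "compact (UNIV :: 'a set)")
  case False
  then show ?thesis using kernel_nonneg by (simp add: e2ennreal_neg)
next
  case True
  note [measurable] = radon_densityD(1)[OF u] radon_densityD(1)[OF v]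
  have c: "compact (UNIV :: ('a \<times> 'a) set)"
    using compact_Times[OF True True] by simp
  have op: "open {z. ereal (- real n) < \<kappa> z}" for n using kernel unfolding is_kernel_def by blast
  have "UNIV \<subseteq> (\<Union>n\<in>UNIV. {z. ereal (- real n) < \<kappa> z})"
  proof
    fix z
    have "\<exists>n. ereal (- real n) < \<kappa> z"
    proof (cases "\<kappa> z")
      case (real r)
      then show ?thesis using reals_Archimedean2[of "- r"] by (auto simp: minus_less_iff)
    qed (use kernel_neq_MInf[of z] in auto)
    then show "z \<in> (\<Union>n\<in>UNIV. {z. ereal (- real n) < \<kappa> z})" by auto
  qed
  then obtain T :: "nat set" where T: "finite T" "UNIV \<subseteq> (\<Union>n\<in>T. {z. ereal (- real n) < \<kappa> z})"
    using compactE_image[OF c, of UNIV "\<lambda>n. {z. ereal (- real n) < \<kappa> z}"] op by metis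
  define m where "m = real (Max (insert 0 T))"
  have m: "e2ennreal (- \<kappa> z) \<le> ennreal m" for z
  proof -
    obtain n where n: "n \<in> T" "ereal (- real n) < \<kappa> z" using T(2) by blast
    have "real n \<le> m" unfolding m_def using n T(1) by simp
    then have "- \<kappa> z \<le> ereal m" using n(2) by (cases "\<kappa> z") auto
    then show ?thesis using e2ennreal_mono[of "- \<kappa> z" "ereal m"] by simp
  qed
  have "(\<integral>\<^sup>+z. e2ennreal (- \<kappa> z) * ennreal (u (fst z) * v (snd z)) \<partial>R) \<le>
     (\<integral>\<^sup>+z. ennreal m * (ennreal (u (fst z)) * ennreal (v (snd z))) \<partial>R)"
    using m radon_densityD(2)[OF u] radon_densityD(2)[OF v] by (intro nn_integral_mono mult_mono) (auto simp: ennreal_mult)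
  also have "\<dots> = ennreal m * ((\<integral>\<^sup>+x. ennreal (u x) \<partial>S) * (\<integral>\<^sup>+x. ennreal (v x) \<partial>S))"
    by (subst nn_integral_cmult, measurable)
      (subst radon_rectangles_nn_integral[OF _ sigma_finite_S _ rect], auto)
  also have "\<dots> = ennreal m * (emeasure (weighted_measure u) UNIV * emeasure (weighted_measure v) UNIV)"
    by (simp add: emeasure_weighted_measure)
  also have "\<dots> < \<infinity>"
    using radonD(3)[OF radon_densityD(3)[OF u] True] radonD(3)[OF radon_densityD(3)[OF v] True]
    by (simp add: ennreal_mult_less_top)
  finally show ?thesis .
qed

text \<open>A common minorant of the two measures vanishes on the zero set of each density, and
  these two sets cover the space.\<close>

lemma disjoint_in_signed_radon:
  assumes p: "radon_density p" and n: "radon_density n" and disj: "\<And>x. p x = 0 \<or> n x = 0"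
  shows "(weighted_measure p, weighted_measure n) \<in> signed_radon"
  unfolding signed_radon_def
proof (clarify, intro conjI allI impI radon_densityD[OF p] radon_densityD[OF n])
  note [measurable] = radon_densityD(1)[OF p] radon_densityD(1)[OF n]
  fix \<rho> assume \<rho>: "radon \<rho>" "\<rho> \<le> weighted_measure p" "\<rho> \<le> weighted_measure n"
  note [simp] = radonD(1,2)[OF \<rho>(1)]
  have z: "emeasure \<rho> {x. u x = 0} = 0" if le: "\<rho> \<le> weighted_measure u" and [measurable]: "u \<in> borel_measurable borel" for u
  proof -
    have "emeasure \<rho> {x. u x = 0} \<le> emeasure (weighted_measure u) {x. u x = 0}"
      using le by (intro le_measureD3) auto
    also have "\<dots> = (\<integral>\<^sup>+x. ennreal (u x) * indicator {x. u x = 0} x \<partial>S)"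
      by (intro emeasure_weighted_measure) measurable
    also have "(\<lambda>x. ennreal (u x) * indicator {x. u x = 0} x) = (\<lambda>x. 0)" by (auto simp: fun_eq_iff split: split_indicator)
    finally show ?thesis by simp
  qed
  have "emeasure \<rho> UNIV \<le> emeasure \<rho> ({x. p x = 0} \<union> {x. n x = 0})"
    using disj by (intro emeasure_mono) auto
  also have "\<dots> \<le> emeasure \<rho> {x. p x = 0} + emeasure \<rho> {x. n x = 0}"
    by (intro emeasure_subadditive) auto
  also have "\<dots> = 0" using z[OF \<rho>(2)] z[OF \<rho>(3)] by simp
  finally have "emeasure \<rho> UNIV = 0" by simp
  then have "emeasure \<rho> E = 0" for E
    using emeasure_space[of \<rho> E] by simp
  then show "\<rho> = null_measure borel" by (intro measure_eqI) auto
qed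

text \<open>This is the polarization formula behind the parallelogram identity. The two mixed terms
  enter only through their sum.\<close>

lemma energy_form_combination:
  assumes w: "radon_density w" "abs_energy w w < \<infinity>"
    and [measurable]: "p \<in> borel_measurable borel" "q \<in> borel_measurable borel"
    and pq: "\<And>x. \<bar>p x\<bar> \<le> w x" "\<And>x. \<bar>q x\<bar> \<le> w x"
  shows "energy_form (\<lambda>x. a * p x + b * q x) (\<lambda>x. a * p x + b * q x) =
    a\<^sup>2 * energy_form p p + a * b * (energy_form p q + energy_form q p) + b\<^sup>2 * energy_form q q"
proof -
  have int[simp]: "integrable R (weighted_kernel p p)" "integrable R (weighted_kernel p q)" "integrable R (weighted_kernel q p)" "integrable R (weighted_kernel q q)"
    using pq by (auto intro!: integrable_weighted_kernel[OF w(1,1,2)])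
  have "weighted_kernel (\<lambda>x. a * p x + b * q x) (\<lambda>x. a * p x + b * q x) =
    (\<lambda>z. a\<^sup>2 * weighted_kernel p p z + a * b * (weighted_kernel p q z + weighted_kernel q p z) + b\<^sup>2 * weighted_kernel q q z)"
    by (auto simp: fun_eq_iff weighted_kernel_def algebra_simps power2_eq_square)
  then show ?thesis unfolding energy_form_def by simp
qed

text \<open>
  An infinite mutual energy would make the energy of the signed measure \<open>-\<infinity>\<close>.
\<close>

lemma disjoint_abs_energy_finite:
  assumes pd: "positive_definite_kernel \<kappa>"
    and p: "radon_density p" and n: "radon_density n" and disj: "\<And>x. p x = 0 \<or> n x = 0"
    and fin: "abs_energy p p < \<infinity>" "abs_energy n n < \<infinity>"
  shows "abs_energy p n < \<infinity>" "abs_energy n p < \<infinity>"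
proof -
  have m: "mutual_energy \<kappa> (weighted_measure p) (weighted_measure p) = ereal (energy_form p p)" "mutual_energy \<kappa> (weighted_measure n) (weighted_measure n) = ereal (energy_form n n)"
    using mutual_energy_eq_energy_form p n fin by blast+
  have "signed_energy_defined \<kappa> (weighted_measure p, weighted_measure n)" by (simp add: signed_energy_defined_def m)
  then have "0 \<le> signed_energy \<kappa> (weighted_measure p, weighted_measure n)"
    using pd disjoint_in_signed_radon[OF p n disj] unfolding positive_definite_kernel_def by blast
  then have ge: "0 \<le> ereal (energy_form p p + energy_form n n) - (mutual_energy \<kappa> (weighted_measure p) (weighted_measure n) + mutual_energy \<kappa> (weighted_measure n) (weighted_measure p))"
    by (simp add: signed_energy_def m)
  \<comment> \<open>The negative part of the integral is always finite, so a mutual energy that is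
    not finite can only be \<open>+\<infinity>\<close>.\<close>
  have inf: "mutual_energy \<kappa> (weighted_measure u) (weighted_measure v) = \<infinity>" if u: "radon_density u" and v: "radon_density v" and "\<not> abs_energy u v < \<infinity>" for u v
  proof -
    let ?b = "\<integral>\<^sup>+z. e2ennreal (- \<kappa> z) * ennreal (u (fst z) * v (snd z)) \<partial>R"
    have "?b < \<infinity>" by (rule negative_energy_finite[OF u v])
    moreover have "(\<integral>\<^sup>+z. e2ennreal (\<kappa> z) * ennreal (u (fst z) * v (snd z)) \<partial>R) = \<infinity>"
      using that(3) \<open>?b < \<infinity>\<close> unfolding abs_energy_split[OF radon_densityD(1)[OF u] radon_densityD(1)[OF v]]
      by (auto simp: less_top[symmetric])
    ultimately show ?thesis unfolding mutual_energy_weighted_measure[OF u v] by (cases ?b) auto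
  qed
  have neq: "mutual_energy \<kappa> (weighted_measure p) (weighted_measure n) \<noteq> \<infinity>" "mutual_energy \<kappa> (weighted_measure n) (weighted_measure p) \<noteq> \<infinity>" using ge by auto
  show "abs_energy p n < \<infinity>" using inf[OF p n] neq by blast
  show "abs_energy n p < \<infinity>" using inf[OF n p] neq by blast
qed

text \<open>
  The previous lemma applies to the positive and negative parts of \<open>u - v\<close>. What remains of \<open>u\<close> and \<open>v\<close> is their
  minimum, all of whose energies are controlled by those of \<open>u\<close> and \<open>v\<close>.
\<close>

lemma abs_energy_add_finite:
  assumes pd: "positive_definite_kernel \<kappa>"
    and u: "radon_density u" and v: "radon_density v" and fin: "abs_energy u u < \<infinity>" "abs_energy v v < \<infinity>"
  shows "abs_energy (\<lambda>x. u x + v x) (\<lambda>x. u x + v x) < \<infinity>"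
proof -
  note [measurable] = radon_densityD(1)[OF u] radon_densityD(1)[OF v]
  define p where "p x = max (u x - v x) 0" for x
  define n where "n x = max (v x - u x) 0" for x
  have bnd: "0 \<le> p x" "p x \<le> u x" "0 \<le> n x" "n x \<le> v x" for x
    using radon_densityD(2)[OF u, of x] radon_densityD(2)[OF v, of x] by (auto simp: p_def n_def)
  have [measurable]: "p \<in> borel_measurable borel" "n \<in> borel_measurable borel"
    unfolding p_def n_def by measurable
  have p: "radon_density p" and n: "radon_density n" using radon_density_mono[OF u] radon_density_mono[OF v] bnd by auto
  have "abs_energy p p \<le> abs_energy u u" "abs_energy n n \<le> abs_energy v v"
    using bnd by (auto intro!: abs_energy_mono mult_mono order.trans[OF bnd(1,2)] order.trans[OF bnd(3,4)])
  then have "abs_energy p p < \<infinity>" "abs_energy n n < \<infinity>" using fin le_less_trans by blast+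
  moreover have disj: "p x = 0 \<or> n x = 0" for x by (auto simp: p_def n_def)
  ultimately have pn: "abs_energy p n < \<infinity>" "abs_energy n p < \<infinity>"
    using disjoint_abs_energy_finite[OF pd p n disj] by blast+
  \<comment> \<open>Each of the two mixed products costs one extra copy of
    \<open>u x * u y + v x * v y\<close>, which together with the original copy gives the factor
    3.\<close>
  have le: "(u x + v x) * (u y + v y) \<le> 3 * (u x * u y) + 3 * (v x * v y) + p x * n y + n x * p y" for x y
  proof -
    \<comment> \<open>In the expansion of \<open>(p x + k) * (n y + l)\<close>, the term
      \<open>p x * l\<close> also occurs in \<open>u x * u y\<close>, the terms
      \<open>k * n y\<close> and \<open>k * l\<close> in \<open>v x * v y\<close>; only
      \<open>p x * n y\<close> is left over.\<close>
    have *: "u x * v y \<le> p x * n y + u x * u y + v x * v y" for x y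
    proof -
      define k l where "k = min (u x) (v x)" and "l = min (u y) (v y)"
      have e: "u x = p x + k" "v x = n x + k" "u y = p y + l" "v y = n y + l"
        by (auto simp: p_def n_def k_def l_def)
      have "0 \<le> k" "0 \<le> l" using radon_densityD(2)[OF u] radon_densityD(2)[OF v] by (auto simp: k_def l_def)
      then have "0 \<le> p x * p y" "0 \<le> k * p y" "0 \<le> n x * n y" "0 \<le> n x * l" "0 \<le> k * l"
        using bnd by auto
      then show ?thesis unfolding e by (simp add: algebra_simps)
    qed
    have "v x * u y \<le> n x * p y + u x * u y + v x * v y"
    proof -
      define k l where "k = min (u x) (v x)" and "l = min (u y) (v y)"
      have e: "u x = p x + k" "v x = n x + k" "u y = p y + l" "v y = n y + l"
        by (auto simp: p_def n_def k_def l_def)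
      have "0 \<le> k" "0 \<le> l" using radon_densityD(2)[OF u] radon_densityD(2)[OF v] by (auto simp: k_def l_def)
      then have "0 \<le> p x * p y" "0 \<le> k * n y" "0 \<le> n x * n y" "0 \<le> p x * l" "0 \<le> k * l"
        using bnd by auto
      then show ?thesis unfolding e by (simp add: algebra_simps)
    qed
    with *[of x y] show ?thesis by (simp add: algebra_simps)
  qed
  have "abs_energy (\<lambda>x. u x + v x) (\<lambda>x. u x + v x) \<le>
    (\<integral>\<^sup>+z. 3 * (e2ennreal \<bar>\<kappa> z\<bar> * ennreal (u (fst z) * u (snd z))) +
          3 * (e2ennreal \<bar>\<kappa> z\<bar> * ennreal (v (fst z) * v (snd z))) +
          e2ennreal \<bar>\<kappa> z\<bar> * ennreal (p (fst z) * n (snd z)) +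
          e2ennreal \<bar>\<kappa> z\<bar> * ennreal (n (fst z) * p (snd z)) \<partial>R)"
    unfolding abs_energy_def
  proof (rule nn_integral_mono)
    fix z :: "'a \<times> 'a"
    let ?x = "fst z" and ?y = "snd z"
    have "ennreal ((u ?x + v ?x) * (u ?y + v ?y)) \<le>
      ennreal (3 * (u ?x * u ?y) + 3 * (v ?x * v ?y) + p ?x * n ?y + n ?x * p ?y)"
      by (intro ennreal_leI le)
    also have "\<dots> = 3 * ennreal (u ?x * u ?y) + 3 * ennreal (v ?x * v ?y) +
        ennreal (p ?x * n ?y) + ennreal (n ?x * p ?y)"
      using bnd radon_densityD(2)[OF u] radon_densityD(2)[OF v] by (simp add: ennreal_plus ennreal_mult)
    finally have "e2ennreal \<bar>\<kappa> z\<bar> * ennreal ((u ?x + v ?x) * (u ?y + v ?y)) \<le>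
      e2ennreal \<bar>\<kappa> z\<bar> * (3 * ennreal (u ?x * u ?y) + 3 * ennreal (v ?x * v ?y) +
        ennreal (p ?x * n ?y) + ennreal (n ?x * p ?y))" by (rule mult_left_mono) simp
    then show "e2ennreal \<bar>\<kappa> z\<bar> * ennreal ((u ?x + v ?x) * (u ?y + v ?y)) \<le>
      3 * (e2ennreal \<bar>\<kappa> z\<bar> * ennreal (u ?x * u ?y)) + 3 * (e2ennreal \<bar>\<kappa> z\<bar> * ennreal (v ?x * v ?y)) +
      e2ennreal \<bar>\<kappa> z\<bar> * ennreal (p ?x * n ?y) + e2ennreal \<bar>\<kappa> z\<bar> * ennreal (n ?x * p ?y)"
      by (simp add: distrib_left mult.left_commute)
  qed
  also have "\<dots> = 3 * abs_energy u u + 3 * abs_energy v v + abs_energy p n + abs_energy n p"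
    unfolding abs_energy_def by (simp add: nn_integral_add nn_integral_cmult)
  also have "\<dots> < \<infinity>" using fin pn by (simp add: ennreal_mult_less_top)
  finally show ?thesis .
qed

text \<open>Positive and negative parts of \<open>d\<close> are the densities of a Jordan pair, both
  dominated by \<open>w\<close>, and the signed energy of this pair equals
  \<open>energy_form d d\<close>. The assumptions on the kernel thereby become statements about
  signed densities.\<close>

lemma
  assumes w: "radon_density w" "abs_energy w w < \<infinity>"
    and d[measurable]: "d \<in> borel_measurable borel" and dw: "\<And>x. \<bar>d x\<bar> \<le> w x"
  shows energy_form_nonneg: "positive_definite_kernel \<kappa> \<Longrightarrow> 0 \<le> energy_form d d"
    and energy_form_eq_0_imp: "strictly_positive_definite_kernel \<kappa> \<Longrightarrow> energy_form d d = 0 \<Longrightarrow> AE x in S. d x = 0"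
proof -
  define p where "p x = max (d x) 0" for x
  define n where "n x = max (- d x) 0" for x
  have bnd: "0 \<le> p x" "p x \<le> w x" "0 \<le> n x" "n x \<le> w x" for x
    using dw[of x] radon_densityD(2)[OF w(1), of x] by (auto simp: p_def n_def)
  have [measurable]: "p \<in> borel_measurable borel" "n \<in> borel_measurable borel"
    unfolding p_def n_def by measurable
  have p: "radon_density p" and n: "radon_density n" using radon_density_mono[OF w(1)] bnd by auto
  have sr: "(weighted_measure p, weighted_measure n) \<in> signed_radon"
    by (rule disjoint_in_signed_radon[OF p n]) (auto simp: p_def n_def)
  have fin: "abs_energy u v < \<infinity>" if "u = p \<or> u = n" "v = p \<or> v = n" for u v
    by (rule le_less_trans[OF abs_energy_mono w(2)])
      (use that bnd radon_densityD(2)[OF w(1)] in \<open>auto intro!: mult_mono\<close>)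
  have m: "mutual_energy \<kappa> (weighted_measure p) (weighted_measure p) = ereal (energy_form p p)" "mutual_energy \<kappa> (weighted_measure n) (weighted_measure n) = ereal (energy_form n n)"
    "mutual_energy \<kappa> (weighted_measure p) (weighted_measure n) = ereal (energy_form p n)" "mutual_energy \<kappa> (weighted_measure n) (weighted_measure p) = ereal (energy_form n p)"
    using mutual_energy_eq_energy_form p n fin by blast+
  have "energy_form (\<lambda>x. 1 * p x + (-1) * n x) (\<lambda>x. 1 * p x + (-1) * n x) = energy_form p p - (energy_form p n + energy_form n p) + energy_form n n"
    using bnd by (subst energy_form_combination[OF w]) auto
  also have "(\<lambda>x. 1 * p x + (-1) * n x) = d" by (auto simp: p_def n_def)
  finally have se: "signed_energy \<kappa> (weighted_measure p, weighted_measure n) = ereal (energy_form d d)"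
    by (simp add: signed_energy_def m)
  have def: "signed_energy_defined \<kappa> (weighted_measure p, weighted_measure n)" by (simp add: signed_energy_defined_def m)
  show "0 \<le> energy_form d d" if "positive_definite_kernel \<kappa>"
  proof -
    have "0 \<le> signed_energy \<kappa> (weighted_measure p, weighted_measure n)"
      using that sr def unfolding positive_definite_kernel_def by blast
    then show ?thesis by (simp add: se)
  qed
  show "AE x in S. d x = 0" if spd: "strictly_positive_definite_kernel \<kappa>" and B0: "energy_form d d = 0"
  proof -
    have "(weighted_measure p, weighted_measure n) \<in> finite_energy_measures \<kappa>"
      unfolding finite_energy_measures_def using sr def se by simp
    moreover have "energy_seminorm \<kappa> (weighted_measure p, weighted_measure n) = 0" by (simp add: energy_seminorm_def se B0)
    ultimately have "(weighted_measure p, weighted_measure n) = (null_measure borel, null_measure borel)"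
      using spd unfolding strictly_positive_definite_kernel_def by blast
    then have "emeasure (weighted_measure p) UNIV = 0" "emeasure (weighted_measure n) UNIV = 0" by auto
    then have "AE x in S. ennreal (p x) = 0" "AE x in S. ennreal (n x) = 0"
      by (simp_all add: emeasure_weighted_measure nn_integral_0_iff_AE)
    then show ?thesis by eventually_elim (auto simp: p_def n_def ennreal_eq_0_iff)
  qed
qed

end

section \<open>Vector measures on a locally finite family of plates\<close>

text \<open>The finite sums below run over an index set that varies with the point. As integrals
  over one fixed counting measure they are measurable in the point.\<close>

lemma borel_measurable_nn_integral_count_space:
  assumes "countable J" and "\<And>i. i \<in> J \<Longrightarrow> f i \<in> borel_measurable M"
  shows "(\<lambda>x. \<integral>\<^sup>+i. f i x \<partial>count_space J) \<in> borel_measurable M"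
proof -
  interpret sigma_finite_measure "count_space J"
    using assms(1) by (rule sigma_finite_measure_count_space_countable)
  have "(\<lambda>(i, x). f i x) \<in> borel_measurable (count_space J \<Otimes>\<^sub>M M)"
    using assms by (intro measurable_pair_measure_countable1) auto
  from measurable_pair_swap[OF this]
  have "(\<lambda>(x, i). f i x) \<in> borel_measurable (M \<Otimes>\<^sub>M count_space J)" by (simp add: case_prod_beta')
  then show ?thesis by (intro borel_measurable_nn_integral) (simp add: case_prod_beta')
qed

text \<open>Local finiteness makes the sum over the plates finite at every point. Together with
  nonemptiness of the plates it makes \<open>J\<close> finite when the space is compact.\<close>

locale condenser_setting = energy_setting \<kappa> S R
  for \<kappa> :: "'a::t2_space \<times> 'a \<Rightarrow> ereal" and S R +
  fixes J :: "'i set" and A :: "'i \<Rightarrow> 'a set"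
  assumes countable_J: "countable J"
    and locally_finite: "compact K \<Longrightarrow> finite {i\<in>J. A i \<inter> K \<noteq> {}}"
    and plate_nonempty: "i \<in> J \<Longrightarrow> A i \<noteq> {}"
begin

definition plates_at :: "'a \<Rightarrow> 'i set" where "plates_at x = {i\<in>J. x \<in> A i}"

lemma mem_plates_at [simp]: "i \<in> plates_at x \<longleftrightarrow> i \<in> J \<and> x \<in> A i"
  by (simp add: plates_at_def)

lemma finite_plates_at [simp]: "finite (plates_at x)"
  using locally_finite[of "{x}"] by (simp add: plates_at_def)

lemma countable_JJ: "countable (J \<times> J)"
  using countable_J by simp

text \<open>Applied to \<open>s i * u i\<close>, this is the density of the signed measure that the
  vector measure with densities \<open>u i\<close> represents.\<close>

definition plate_sum :: "('i \<Rightarrow> 'a \<Rightarrow> real) \<Rightarrow> 'a \<Rightarrow> real" where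
  "plate_sum h x = (\<Sum>i\<in>plates_at x. h i x)"

definition plate_supported :: "('i \<Rightarrow> 'a \<Rightarrow> real) \<Rightarrow> bool" where
  "plate_supported h \<longleftrightarrow> (\<forall>i\<in>J. h i \<in> borel_measurable borel \<and> (\<forall>x. x \<notin> A i \<longrightarrow> h i x = 0))"

lemma plate_supportedD: "plate_supported h \<Longrightarrow> i \<in> J \<Longrightarrow> h i \<in> borel_measurable borel"
  "plate_supported h \<Longrightarrow> i \<in> J \<Longrightarrow> x \<notin> A i \<Longrightarrow> h i x = 0"
  by (auto simp: plate_supported_def)

lemma nn_integral_plates:
  assumes "\<And>i. i \<in> J \<Longrightarrow> x \<notin> A i \<Longrightarrow> f i = 0"
  shows "(\<integral>\<^sup>+i. f i \<partial>count_space J) = (\<Sum>i\<in>plates_at x. f i)"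
  using assms by (intro nn_integral_count_space') auto

text \<open>The summation range depends on the point, so the sum is rewritten as a difference of two
  integrals over the counting measure on \<open>J\<close>, one for each sign.\<close>

lemma plate_sum_measurable:
  assumes h: "plate_supported h"
  shows "plate_sum h \<in> borel_measurable borel"
proof -
  have sum: "(\<integral>\<^sup>+i. ennreal (c * h i x) \<partial>count_space J) = (\<Sum>i\<in>plates_at x. ennreal (c * h i x))" for c x
    using plate_supportedD(2)[OF h] by (intro nn_integral_plates) simp
  have "plate_sum h x = enn2real (\<integral>\<^sup>+i. ennreal (1 * h i x) \<partial>count_space J) -
      enn2real (\<integral>\<^sup>+i. ennreal ((-1) * h i x) \<partial>count_space J)" for x
  proof -
    have "enn2real (\<Sum>i\<in>plates_at x. ennreal (c * h i x)) = (\<Sum>i\<in>plates_at x. max 0 (c * h i x))" for c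
      by (subst enn2real_sum) (auto simp: enn2real_ennreal max_def ennreal_neg intro!: sum.cong)
    then show ?thesis unfolding sum plate_sum_def
      by (simp only: sum_subtractf[symmetric]) (auto intro!: sum.cong)
  qed
  moreover have "(\<lambda>x. \<integral>\<^sup>+i. ennreal (c * h i x) \<partial>count_space J) \<in> borel_measurable borel" for c
    using plate_supportedD(1)[OF h] by (intro borel_measurable_nn_integral_count_space countable_J) auto
  ultimately show ?thesis
    by (subst measurable_cong) (assumption, intro borel_measurable_diff borel_measurable_enn2real)
qed

lemma le_plate_sum:
  assumes "plate_supported w" "\<And>i x. i \<in> J \<Longrightarrow> 0 \<le> w i x" "i \<in> J"
  shows "w i x \<le> plate_sum w x"
proof (cases "x \<in> A i")
  case True
  then show ?thesis unfolding plate_sum_def using assms by (intro member_le_sum) auto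
next
  case False
  then show ?thesis using plate_supportedD(2)[OF assms(1,3) False] assms(2)
    unfolding plate_sum_def by (auto intro!: sum_nonneg)
qed

lemma abs_plate_sum_le:
  assumes "\<And>i x. i \<in> J \<Longrightarrow> \<bar>h i x\<bar> \<le> w i x"
  shows "\<bar>plate_sum h x\<bar> \<le> plate_sum w x"
  unfolding plate_sum_def by (rule order.trans[OF sum_abs sum_mono]) (auto simp: assms)

text \<open>Infinitely many measures are added, but only finitely many plates meet a given compact
  set, so its measure is a finite sum of finite terms.\<close>

lemma radon_density_plate_sum:
  assumes u: "plate_supported u" "\<And>i. i \<in> J \<Longrightarrow> radon_density (u i)"
  shows "radon_density (plate_sum u)"
  unfolding radon_density_def
proof (intro conjI allI radon_weighted_measure plate_sum_measurable u(1))
  have nn: "0 \<le> u i x" if "i \<in> J" for i x using radon_densityD(2)[OF u(2)[OF that]] .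
  show "0 \<le> plate_sum u x" for x unfolding plate_sum_def using nn by (auto intro!: sum_nonneg)
  fix K :: "'a set" assume K: "compact K"
  then have [measurable]: "K \<in> sets borel" by (rule borel_compact)
  have "ennreal (plate_sum u x) * indicator K x = (\<integral>\<^sup>+i. ennreal (u i x) * indicator K x \<partial>count_space J)" for x
  proof -
    have "(\<integral>\<^sup>+i. ennreal (u i x) * indicator K x \<partial>count_space J) = (\<Sum>i\<in>plates_at x. ennreal (u i x) * indicator K x)"
      using plate_supportedD(2)[OF u(1)] by (intro nn_integral_plates) simp
    also have "\<dots> = (\<Sum>i\<in>plates_at x. ennreal (u i x)) * indicator K x" by (simp add: sum_distrib_right)
    also have "(\<Sum>i\<in>plates_at x. ennreal (u i x)) = ennreal (plate_sum u x)"
      unfolding plate_sum_def using nn by (intro sum_ennreal) auto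
    finally show ?thesis by simp
  qed
  then have "emeasure (weighted_measure (plate_sum u)) K = (\<integral>\<^sup>+x. \<integral>\<^sup>+i. ennreal (u i x) * indicator K x \<partial>count_space J \<partial>S)"
    by (simp add: emeasure_weighted_measure plate_sum_measurable u(1))
  also have "\<dots> = (\<integral>\<^sup>+i. \<integral>\<^sup>+x. ennreal (u i x) * indicator K x \<partial>S \<partial>count_space J)"
    using plate_supportedD(1)[OF u(1)] countable_J by (intro nn_integral_count_space_nn_integral) auto
  also have "\<dots> = (\<integral>\<^sup>+i. emeasure (weighted_measure (u i)) K \<partial>count_space J)"
    using plate_supportedD(1)[OF u(1)] by (intro nn_integral_cong) (simp add: emeasure_weighted_measure)
  also have "\<dots> = (\<Sum>i\<in>{i\<in>J. A i \<inter> K \<noteq> {}}. emeasure (weighted_measure (u i)) K)"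
  proof (rule nn_integral_count_space'[OF locally_finite[OF K]])
    fix i assume i: "i \<in> J" "i \<notin> {i\<in>J. A i \<inter> K \<noteq> {}}"
    have "emeasure (weighted_measure (u i)) K = (\<integral>\<^sup>+x. ennreal (u i x) * indicator K x \<partial>S)"
      using plate_supportedD(1)[OF u(1)] i by (simp add: emeasure_weighted_measure)
    also have "(\<lambda>x. ennreal (u i x) * indicator K x) = (\<lambda>x. 0)"
    proof
      fix x
      have "x \<in> K \<Longrightarrow> u i x = 0" using plate_supportedD(2)[OF u(1) i(1), of x] i by blast
      then show "ennreal (u i x) * indicator K x = 0" by (auto split: split_indicator)
    qed
    finally show "emeasure (weighted_measure (u i)) K = 0" by simp
  qed auto
  also have "\<dots> < \<infinity>"
    using locally_finite[OF K] radonD(3)[OF radon_densityD(3)[OF u(2)] K] by (simp add: ennreal_sum_less_top)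
  finally show "emeasure (weighted_measure (plate_sum u)) K < \<infinity>" .
qed

text \<open>At each pair of points the product of the two plate sums is a finite double sum, and all
  terms are nonnegative, so Tonelli moves the index pairs outside.\<close>

lemma abs_energy_plate_sum:
  assumes u: "plate_supported u" "\<And>i x. i \<in> J \<Longrightarrow> 0 \<le> u i x"
  shows "abs_energy (plate_sum u) (plate_sum u) = (\<integral>\<^sup>+p. abs_energy (u (fst p)) (u (snd p)) \<partial>count_space (J \<times> J))"
proof -
  let ?f = "\<lambda>p z. e2ennreal \<bar>\<kappa> z\<bar> * ennreal (u (fst p) (fst z) * u (snd p) (snd z))"
  have "e2ennreal \<bar>\<kappa> z\<bar> * ennreal (plate_sum u (fst z) * plate_sum u (snd z)) = (\<integral>\<^sup>+p. ?f p z \<partial>count_space (J \<times> J))" for z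
  proof -
    have "(\<integral>\<^sup>+p. ?f p z \<partial>count_space (J \<times> J)) = (\<Sum>p\<in>plates_at (fst z) \<times> plates_at (snd z). ?f p z)"
    proof (rule nn_integral_count_space')
      fix p assume p: "p \<in> J \<times> J" "p \<notin> plates_at (fst z) \<times> plates_at (snd z)"
      then have "u (fst p) (fst z) = 0 \<or> u (snd p) (snd z) = 0"
        using plate_supportedD(2)[OF u(1)] by (auto simp: mem_Times_iff)
      then show "?f p z = 0" by auto
    qed auto
    also have "\<dots> = e2ennreal \<bar>\<kappa> z\<bar> * ennreal (\<Sum>p\<in>plates_at (fst z) \<times> plates_at (snd z). u (fst p) (fst z) * u (snd p) (snd z))"
      using u(2) by (subst sum_distrib_left[symmetric], subst sum_ennreal) auto
    also have "(\<Sum>p\<in>plates_at (fst z) \<times> plates_at (snd z). u (fst p) (fst z) * u (snd p) (snd z)) = plate_sum u (fst z) * plate_sum u (snd z)"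
      unfolding plate_sum_def by (simp add: sum_product sum.cartesian_product case_prod_beta')
    finally show ?thesis by simp
  qed
  then have "abs_energy (plate_sum u) (plate_sum u) = (\<integral>\<^sup>+z. \<integral>\<^sup>+p. ?f p z \<partial>count_space (J \<times> J) \<partial>R)"
    unfolding abs_energy_def by simp
  also have "\<dots> = (\<integral>\<^sup>+p. \<integral>\<^sup>+z. ?f p z \<partial>R \<partial>count_space (J \<times> J))"
  proof (rule nn_integral_count_space_nn_integral[OF countable_JJ])
    fix p assume "p \<in> J \<times> J"
    then have [measurable]: "u (fst p) \<in> borel_measurable borel" "u (snd p) \<in> borel_measurable borel"
      using plate_supportedD(1)[OF u(1)] by auto
    show "?f p \<in> borel_measurable R" by measurable
  qed
  finally show ?thesis unfolding abs_energy_def .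
qed

text \<open>
  Convergence of the energy series bounds the integrals of \<open>\<bar>\<kappa>\<bar>\<close>: on a noncompact space \<open>\<kappa>\<close> is
  nonnegative, and on a compact space there are only finitely many plates.
\<close>

lemma abs_energy_plate_sum_finite:
  assumes u: "plate_supported u" "\<And>i. i \<in> J \<Longrightarrow> radon_density (u i)"
    and s: "\<And>i. \<bar>s i\<bar> = 1"
    and fs: "finite_series (J \<times> J) (\<lambda>(i, j). s i * s j * mutual_energy \<kappa> (weighted_measure (u i)) (weighted_measure (u j)))"
  shows "abs_energy (plate_sum u) (plate_sum u) < \<infinity>"
proof -
  let ?t = "\<lambda>p. s (fst p) * s (snd p) * mutual_energy \<kappa> (weighted_measure (u (fst p))) (weighted_measure (u (snd p)))"
  have fs': "finite_series (J \<times> J) ?t" using fs by (simp add: case_prod_beta')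
  have abs_t: "\<bar>?t p\<bar> = \<bar>mutual_energy \<kappa> (weighted_measure (u (fst p))) (weighted_measure (u (snd p)))\<bar>" for p
    by (simp add: ereal_abs_mult s)
  have fin: "abs_energy (u (fst p)) (u (snd p)) < \<infinity>" if p: "p \<in> J \<times> J" for p
  proof -
    have "\<bar>?t p\<bar> \<noteq> \<infinity>"
      using fs'[unfolded finite_series_def, THEN conjunct1, THEN bspec, OF p] .
    then show ?thesis using mutual_energy_finite_iff[OF u(2) u(2), of "fst p" "snd p"] p
      unfolding abs_t by (auto simp only: mem_Times_iff)
  qed
  have "(\<integral>\<^sup>+p. abs_energy (u (fst p)) (u (snd p)) \<partial>count_space (J \<times> J)) < \<infinity>"
  proof (cases "compact (UNIV :: 'a set)")
    case True
    have "{i\<in>J. A i \<inter> UNIV \<noteq> {}} = J" using plate_nonempty by auto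
    then have "finite (J \<times> J)" using locally_finite[OF True] by simp
    then show ?thesis using fin by (simp add: nn_integral_count_space_finite ennreal_sum_less_top)
  next
    case False
    have eq: "abs_energy (u (fst p)) (u (snd p)) = ennreal (norm \<bar>real_of_ereal (?t p)\<bar>)" if p: "p \<in> J \<times> J" for p
    proof -
      have a: "radon_density (u (fst p))" "radon_density (u (snd p))" using u(2) p by auto
      have "e2ennreal (- \<kappa> z) = 0" "\<bar>\<kappa> z\<bar> = \<kappa> z" for z using kernel_nonneg[OF False, of z] by (auto simp: e2ennreal_neg)
      then have "mutual_energy \<kappa> (weighted_measure (u (fst p))) (weighted_measure (u (snd p))) = enn2ereal (abs_energy (u (fst p)) (u (snd p)))"
        unfolding mutual_energy_weighted_measure[OF a] abs_energy_def by (simp add: zero_ennreal.rep_eq)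
      then have "\<bar>?t p\<bar> = enn2ereal (abs_energy (u (fst p)) (u (snd p)))"
        using abs_t[of p] by (simp only: abs_ereal_ge0 enn2ereal_nonneg)
      then have "\<bar>real_of_ereal (?t p)\<bar> = real_of_ereal (enn2ereal (abs_energy (u (fst p)) (u (snd p))))"
        by (simp only: abs_real_of_ereal)
      then show ?thesis using fin[OF p] by (cases "abs_energy (u (fst p)) (u (snd p))") auto
    qed
    have "Infinite_Sum.abs_summable_on (\<lambda>p. real_of_ereal (?t p)) (J \<times> J)"
      using fs'[unfolded finite_series_def, THEN conjunct2] unfolding real_norm_def .
    then have "integrable (count_space (J \<times> J)) (\<lambda>p. real_of_ereal (?t p))"
      unfolding abs_summable_equivalent Infinite_Set_Sum.abs_summable_on_def .
    then show ?thesis using eq by (auto simp: integrable_iff_bounded cong: nn_integral_cong_simp)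
  qed
  then show ?thesis using abs_energy_plate_sum[OF u(1)] radon_densityD(2)[OF u(2)] by simp
qed

text \<open>This reduces the energy of a vector of densities to that of a single signed density.
  Fubini over index pairs and points is justified by the finite absolute energy of the
  majorant.\<close>

lemma energy_form_plate_sum:
  assumes h: "plate_supported h" and w: "plate_supported w" "\<And>i. i \<in> J \<Longrightarrow> radon_density (w i)"
    and hw: "\<And>i x. i \<in> J \<Longrightarrow> \<bar>h i x\<bar> \<le> w i x"
    and fin: "abs_energy (plate_sum w) (plate_sum w) < \<infinity>"
  shows "(\<lambda>p. norm (energy_form (h (fst p)) (h (snd p)))) summable_on (J \<times> J)"
    and "(\<Sum>\<^sub>\<infinity>p\<in>J \<times> J. energy_form (h (fst p)) (h (snd p))) = energy_form (plate_sum h) (plate_sum h)"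
proof -
  let ?f = "\<lambda>p z. weighted_kernel (h (fst p)) (h (snd p)) z"
  let ?M = "count_space (J \<times> J)"
  interpret M: sigma_finite_measure ?M
    by (rule sigma_finite_measure_count_space_countable[OF countable_JJ])
  interpret R: sigma_finite_measure R by (rule sigma_finite_R)
  interpret pair_sigma_finite ?M R ..
  have w0: "0 \<le> w i x" if "i \<in> J" for i x using radon_densityD(2)[OF w(2)[OF that]] .
  have fm: "?f p \<in> borel_measurable R" if "p \<in> J \<times> J" for p
  proof -
    have [measurable]: "h (fst p) \<in> borel_measurable borel" "h (snd p) \<in> borel_measurable borel"
      using plate_supportedD(1)[OF h] that by auto
    show ?thesis by measurable
  qed
  have meas: "(\<lambda>(p, z). ?f p z) \<in> borel_measurable (?M \<Otimes>\<^sub>M R)"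
    using fm countable_JJ by (intro measurable_pair_measure_countable1) auto
  have bound: "ennreal (norm (?f p z)) \<le> e2ennreal \<bar>\<kappa> z\<bar> * ennreal (w (fst p) (fst z) * w (snd p) (snd z))"
    if "p \<in> J \<times> J" for p z
  proof -
    have "ennreal (norm (?f p z)) = ennreal \<bar>real_of_ereal (\<kappa> z)\<bar> * ennreal (\<bar>h (fst p) (fst z)\<bar> * \<bar>h (snd p) (snd z)\<bar>)"
      by (subst ennreal_mult[symmetric]) (simp_all add: weighted_kernel_def abs_mult real_of_ereal_pos)
    also have "\<dots> \<le> e2ennreal \<bar>\<kappa> z\<bar> * ennreal (w (fst p) (fst z) * w (snd p) (snd z))"
    proof (rule mult_mono)
      show "ennreal \<bar>real_of_ereal (\<kappa> z)\<bar> \<le> e2ennreal \<bar>\<kappa> z\<bar>" by (cases "\<kappa> z") auto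
      show "ennreal (\<bar>h (fst p) (fst z)\<bar> * \<bar>h (snd p) (snd z)\<bar>) \<le> ennreal (w (fst p) (fst z) * w (snd p) (snd z))"
        using hw w0 that by (intro ennreal_leI mult_mono) auto
    qed auto
    finally show ?thesis .
  qed
  have int: "integrable (?M \<Otimes>\<^sub>M R) (\<lambda>(p, z). ?f p z)"
  proof (rule integrableI_bounded[OF meas])
    have "(\<integral>\<^sup>+x. ennreal (norm (case x of (p, z) \<Rightarrow> ?f p z)) \<partial>(?M \<Otimes>\<^sub>M R)) =
        (\<integral>\<^sup>+p. \<integral>\<^sup>+z. ennreal (norm (?f p z)) \<partial>R \<partial>?M)"
      using meas by (subst R.nn_integral_fst[symmetric]) auto
    also have "\<dots> \<le> (\<integral>\<^sup>+p. abs_energy (w (fst p)) (w (snd p)) \<partial>?M)"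
      unfolding abs_energy_def using bound by (intro nn_integral_mono) auto
    also have "\<dots> = abs_energy (plate_sum w) (plate_sum w)" using abs_energy_plate_sum[OF w(1) w0] by simp
    finally show "(\<integral>\<^sup>+x. ennreal (norm (case x of (p, z) \<Rightarrow> ?f p z)) \<partial>(?M \<Otimes>\<^sub>M R)) < \<infinity>"
      using fin by (rule le_less_trans)
  qed
  have int1: "integrable ?M (\<lambda>p. energy_form (h (fst p)) (h (snd p)))"
    using integrable_fst[OF int] unfolding energy_form_def .
  then have as: "Infinite_Set_Sum.abs_summable_on (\<lambda>p. energy_form (h (fst p)) (h (snd p))) (J \<times> J)"
    unfolding Infinite_Set_Sum.abs_summable_on_def .
  then show "(\<lambda>p. norm (energy_form (h (fst p)) (h (snd p)))) summable_on (J \<times> J)"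
    unfolding abs_summable_equivalent[symmetric] .
  have pt: "(\<integral>p. ?f p z \<partial>?M) = weighted_kernel (plate_sum h) (plate_sum h) z" for z
  proof -
    have z0: "?f p z = 0" if p: "p \<in> J \<times> J" "p \<notin> plates_at (fst z) \<times> plates_at (snd z)" for p
    proof -
      have "h (fst p) (fst z) = 0 \<or> h (snd p) (snd z) = 0"
        using plate_supportedD(2)[OF h] p by (auto simp: mem_Times_iff)
      then show ?thesis by (auto simp: weighted_kernel_def)
    qed
    have sub: "{p \<in> J \<times> J. ?f p z \<noteq> 0} \<subseteq> plates_at (fst z) \<times> plates_at (snd z)" using z0 by blast
    have "(\<integral>p. ?f p z \<partial>?M) = (\<Sum>p\<in>{p \<in> J \<times> J. ?f p z \<noteq> 0}. ?f p z)"
      by (rule lebesgue_integral_count_space_finite_support) (rule finite_subset[OF sub], simp)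
    also have "\<dots> = (\<Sum>p\<in>plates_at (fst z) \<times> plates_at (snd z). ?f p z)"
      using sub by (intro sum.mono_neutral_left) auto
    also have "\<dots> = weighted_kernel (plate_sum h) (plate_sum h) z"
      unfolding plate_sum_def weighted_kernel_def sum_distrib_left[symmetric]
      by (simp add: sum_product sum.cartesian_product case_prod_beta')
    finally show ?thesis .
  qed
  have "(\<Sum>\<^sub>\<infinity>p\<in>J \<times> J. energy_form (h (fst p)) (h (snd p))) = infsetsum (\<lambda>p. energy_form (h (fst p)) (h (snd p))) (J \<times> J)"
    by (rule infsetsum_infsum[OF as, symmetric])
  also have "\<dots> = (\<integral>p. \<integral>z. ?f p z \<partial>R \<partial>?M)" by (simp add: infsetsum_def energy_form_def)
  also have "\<dots> = (\<integral>z. \<integral>p. ?f p z \<partial>?M \<partial>R)" using Fubini_integral[OF int] by simp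
  also have "\<dots> = energy_form (plate_sum h) (plate_sum h)" unfolding pt energy_form_def ..
  finally show "(\<Sum>\<^sub>\<infinity>p\<in>J \<times> J. energy_form (h (fst p)) (h (snd p))) = energy_form (plate_sum h) (plate_sum h)" .
qed

lemma energy_form_scale: "energy_form (\<lambda>x. a * u x) (\<lambda>x. b * v x) = a * b * energy_form u v"
proof -
  have "weighted_kernel (\<lambda>x. a * u x) (\<lambda>x. b * v x) = (\<lambda>z. a * b * weighted_kernel u v z)"
    by (auto simp: weighted_kernel_def fun_eq_iff)
  then show ?thesis by (simp add: energy_form_def)
qed

text \<open>The family \<open>h\<close> ranges over everything below one majorant \<open>w\<close>,
  so the same statement serves both solutions and their midpoint.\<close>

lemma signed_energy_series:
  assumes w: "plate_supported w" "\<And>i. i \<in> J \<Longrightarrow> radon_density (w i)" and fin: "abs_energy (plate_sum w) (plate_sum w) < \<infinity>"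
    and h: "plate_supported h" "\<And>i x. i \<in> J \<Longrightarrow> 0 \<le> h i x" "\<And>i x. i \<in> J \<Longrightarrow> h i x \<le> w i x"
    and s: "\<And>i. \<bar>s i\<bar> = 1" and \<mu>: "\<And>i. i \<in> J \<Longrightarrow> \<mu> i = weighted_measure (h i)"
  shows "finite_series (J \<times> J) (\<lambda>(i, j). ereal (s i) * ereal (s j) * mutual_energy \<kappa> (\<mu> i) (\<mu> j))"
    and "series_sum (J \<times> J) (\<lambda>(i, j). ereal (s i) * ereal (s j) * mutual_energy \<kappa> (\<mu> i) (\<mu> j)) =
      energy_form (plate_sum (\<lambda>i x. s i * h i x)) (plate_sum (\<lambda>i x. s i * h i x))"
proof -
  let ?h = "\<lambda>i x. s i * h i x"
  let ?t = "\<lambda>(i, j). ereal (s i) * ereal (s j) * mutual_energy \<kappa> (\<mu> i) (\<mu> j)"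
  have w0: "0 \<le> w i x" if "i \<in> J" for i x using radon_densityD(2)[OF w(2)[OF that]] .
  have t: "?t p = ereal (energy_form (?h (fst p)) (?h (snd p)))" if p: "p \<in> J \<times> J" for p
  proof -
    obtain i j where ij: "p = (i, j)" "i \<in> J" "j \<in> J" using p by auto
    have ad: "radon_density (h i)" "radon_density (h j)"
      using radon_density_mono[OF w(2)] plate_supportedD(1)[OF h(1)] h(2,3) ij by auto
    have "h i x * h j y \<le> plate_sum w x * plate_sum w y" for x y
      using order.trans[OF h(3) le_plate_sum[OF w(1) w0]] order.trans[OF w0 le_plate_sum[OF w(1) w0]] h(2) ij
      by (intro mult_mono) auto
    then have "abs_energy (h i) (h j) < \<infinity>"
      by (intro le_less_trans[OF abs_energy_mono fin])
    from mutual_energy_eq_energy_form[OF ad this] show ?thesis using \<mu> ij by (simp add: energy_form_scale)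
  qed
  have fh: "plate_supported ?h" using h(1) by (auto simp: plate_supported_def)
  have hw: "\<bar>?h i x\<bar> \<le> w i x" if "i \<in> J" for i x using h(2,3)[OF that] by (simp add: abs_mult s)
  note BT = energy_form_plate_sum[OF fh w hw fin]
  show "finite_series (J \<times> J) ?t"
    unfolding finite_series_def
  proof
    show "\<forall>p\<in>J \<times> J. \<bar>?t p\<bar> \<noteq> \<infinity>"
    proof
      fix p assume p: "p \<in> J \<times> J"
      show "\<bar>?t p\<bar> \<noteq> \<infinity>" unfolding t[OF p] by simp
    qed
    have "(\<lambda>p. \<bar>real_of_ereal (?t p)\<bar>) summable_on J \<times> J \<longleftrightarrow>
      (\<lambda>p. norm (energy_form (?h (fst p)) (?h (snd p)))) summable_on J \<times> J"
      by (rule summable_on_cong) (simp only: t real_of_ereal.simps real_norm_def)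
    then show "(\<lambda>p. \<bar>real_of_ereal (?t p)\<bar>) summable_on J \<times> J" using BT(1) by simp
  qed
  have "series_sum (J \<times> J) ?t = (\<Sum>\<^sub>\<infinity>p\<in>J \<times> J. energy_form (?h (fst p)) (?h (snd p)))"
    unfolding series_sum_def by (rule infsum_cong) (simp only: t real_of_ereal.simps)
  then show "series_sum (J \<times> J) ?t = energy_form (plate_sum ?h) (plate_sum ?h)" using BT(2) by simp
qed

end

section \<open>Sets of capacity zero and midpoints\<close>

text \<open>A compact subset of \<open>- A\<close> equals its own difference with \<open>A\<close>,
  and inner regularity makes such subsets detect the measure of \<open>- A\<close>.\<close>

lemma carried_by_iff:
  assumes M: "radon M" and A: "A \<in> sets borel"
  shows "carried_by M A \<longleftrightarrow> emeasure M (- A) = 0"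
proof
  note [simp] = radonD(1,2)[OF M]
  assume c: "carried_by M A"
  show "emeasure M (- A) = 0"
  proof (rule ccontr)
    assume "emeasure M (- A) \<noteq> 0"
    then have "0 < emeasure M (- A)" by (simp add: zero_less_iff_neq_zero)
    moreover have "- A \<in> sets borel" using A by auto
    ultimately obtain K where K: "compact K" "K \<subseteq> - A" "0 < emeasure M K"
      using radon_inner[OF M] by blast
    have "K - A = K" using K by auto
    then have "K \<in> null_sets (completion M)" using c K(1) by (metis carried_by_def)
    then have "K \<in> null_sets M" using borel_compact[OF K(1)] by (subst (asm) null_sets_completion_iff) auto
    then show False using K(3) by auto
  qed
next
  note [simp] = radonD(1,2)[OF M]
  assume z: "emeasure M (- A) = 0"
  show "carried_by M A"
    unfolding carried_by_def
  proof (intro allI impI)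
    fix K :: "'a set" assume K: "compact K"
    have mA: "- A \<in> sets borel" using A by auto
    then have n: "- A \<in> null_sets M" using z by (auto simp: null_sets_def)
    have "K - A \<in> null_sets M" using borel_compact[OF K] A
      by (intro null_sets_subset[OF n]) auto
    then show "K - A \<in> null_sets (completion M)" by (rule null_sets_completionI)
  qed
qed

text \<open>By the Markov inequality the sets where \<open>n * g\<close> is at least 1 have finite
  measure; they cover the space because \<open>g\<close> is strictly positive. This is where the
  normalization makes Radon-Nikodym available.\<close>

lemma sigma_finite_if_pairing_finite:
  fixes M :: "'a::t2_space measure"
  assumes M: "radon M" and g: "continuous_on UNIV g" "\<And>x. 0 < g x"
    and p: "pairing (\<lambda>x. ereal (g x)) M = ereal a"
  shows "sigma_finite_measure M"
proof
  note [simp] = radonD(1,2)[OF M]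
  have gb[measurable]: "g \<in> borel_measurable borel" using g(1) by (rule borel_measurable_continuous_onI)
  have [measurable]: "g \<in> borel_measurable M" by (simp cong: measurable_cong_sets)
  have "ennreal (- g x) = 0" for x using g(2)[of x] by (simp add: ennreal_neg less_imp_le)
  then have "enn2ereal (\<integral>\<^sup>+x. ennreal (g x) \<partial>M) = ereal a"
    using p by (simp add: pairing_def zero_ennreal.rep_eq)
  then have fin: "(\<integral>\<^sup>+x. ennreal (g x) \<partial>M) < \<infinity>" by (cases "\<integral>\<^sup>+x. ennreal (g x) \<partial>M") auto
  let ?C = "\<lambda>n::nat. {x \<in> space M. 1 \<le> ennreal (real n) * ennreal (g x)}"
  have C: "?C n \<in> sets M" "emeasure M (?C n) \<noteq> \<infinity>" for n
  proof -
    show "?C n \<in> sets M" by measurable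
    have "emeasure M ({x \<in> UNIV. 1 \<le> ennreal (real n) * ennreal (g x)} \<inter> space M) \<le>
        ennreal (real n) * (\<integral>\<^sup>+x. ennreal (g x) * indicator UNIV x \<partial>M)"
      using nn_integral_Markov_inequality[of "\<lambda>x. ennreal (g x)" UNIV M "ennreal (real n)"] by simp
    also have "\<dots> < \<infinity>" using fin by (simp add: ennreal_mult_less_top)
    finally show "emeasure M (?C n) \<noteq> \<infinity>" by (simp add: Int_def less_top)
  qed
  have "x \<in> (\<Union>n. ?C n)" for x
  proof -
    obtain n where "1 / g x < real n" using reals_Archimedean2 by blast
    then have "1 \<le> real n * g x" using g(2)[of x] by (simp add: field_simps)
    then have "1 \<le> ennreal (real n * g x)" by (simp add: ennreal_le_iff2 flip: ennreal_1)
    then have "1 \<le> ennreal (real n) * ennreal (g x)"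
      using ennreal_mult''[of "g x" "real n"] g(2)[of x] by (simp add: less_imp_le)
    then show ?thesis by (auto intro: exI[of _ n])
  qed
  then show "\<exists>\<C>. countable \<C> \<and> \<C> \<subseteq> sets M \<and> \<Union>\<C> = space M \<and> (\<forall>C\<in>\<C>. emeasure M C \<noteq> \<infinity>)"
    using C by (intro exI[of _ "range ?C"]) auto
qed

text \<open>Sigma-finiteness makes the Radon-Nikodym derivative finite almost everywhere, and the
  measure is carried by \<open>A\<close>. Changing the derivative on a null set gives a version that
  is real and vanishes off \<open>A\<close> at every point, as the pointwise plate sums
  require.\<close>

lemma radon_eq_density:
  fixes S M :: "'a::t2_space measure"
  assumes S: "radon S" "finite_measure S" and M: "radon M" "sigma_finite_measure M"
    and ac: "absolutely_continuous S M" and A: "A \<in> sets borel" "carried_by M A"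
  obtains u :: "'a \<Rightarrow> real" where "u \<in> borel_measurable borel" "\<And>x. 0 \<le> u x" "\<And>x. x \<notin> A \<Longrightarrow> u x = 0"
    "M = density S (\<lambda>x. ennreal (u x))"
proof -
  interpret finite_measure S by fact
  note [simp] = radonD(1,2)[OF S(1)] radonD(1,2)[OF M(1)]
  obtain f where f[measurable]: "f \<in> borel_measurable S" and Mf: "density S f = M"
    using Radon_Nikodym[OF ac] by auto
  have fb[measurable]: "f \<in> borel_measurable borel" using f by (simp cong: measurable_cong_sets)
  have fin: "AE x in S. f x \<noteq> \<infinity>"
    using sigma_finite_iff_density_finite[OF f] M(2) Mf by simp
  have mA: "- A \<in> sets borel" using A(1) by auto
  have "- A \<in> null_sets (density S f)"
    using carried_by_iff[OF M(1) A(1)] A(2) Mf mA by (auto simp: null_sets_def)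
  then have zero: "AE x in S. x \<in> - A \<longrightarrow> f x = 0" using null_sets_density_iff[OF f] by blast
  define u where "u x = enn2real (f x) * indicator A x" for x
  have um: "u \<in> borel_measurable borel" unfolding u_def using A(1) by measurable
  have "density S (\<lambda>x. ennreal (u x)) = density S f"
  proof (rule density_cong)
    show "(\<lambda>x. ennreal (u x)) \<in> borel_measurable S" using um by (simp cong: measurable_cong_sets)
    show "AE x in S. ennreal (u x) = f x"
      using fin zero by eventually_elim (auto simp: u_def less_top indicator_def)
  qed fact
  then show ?thesis using that[of u] um Mf by (simp add: u_def)
qed

text \<open>External fields are measurable only on compact sets and for the completed measure. Borel
  versions on the members of an exhausting family are glued along a null set; \<open>\<phi>\<close>
  will extract the positive or the negative part.\<close>

lemma radon_measurable_AE_borel: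
  fixes S :: "'a::t2_space measure"
  assumes S: "radon S" "finite_measure S" and \<psi>: "radon_measurable S \<psi>"
    and \<phi>: "\<phi> \<in> borel \<rightarrow>\<^sub>M (borel :: ennreal measure)"
  obtains F where "F \<in> borel_measurable borel" "AE x in S. \<phi> (\<psi> x) = F x"
proof -
  note [simp] = radonD(1,2)[OF S(1)]
  have "sigma_finite_measure S" using S(2) by (auto simp: finite_measure_def)
  then obtain \<K> where \<K>: "countable \<K>" "\<And>K. K \<in> \<K> \<Longrightarrow> compact K" "UNIV - \<Union>\<K> \<in> null_sets S"
    using compactly_exhaustedE[OF radon_imp_compactly_exhausted[OF S(1)], of UNIV] by (metis sets.top space_borel)
  have "\<exists>G. G \<in> borel_measurable borel \<and> (\<forall>x. x \<notin> K \<longrightarrow> G x = 0) \<and> (AE x in S. x \<in> K \<longrightarrow> \<phi> (\<psi> x) = G x)"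
    if K: "K \<in> \<K>" for K
  proof -
    have Kb: "K \<in> sets borel" using \<K>(2)[OF K] by (rule borel_compact)
    have "(\<lambda>x. \<phi> (\<psi> x)) \<in> borel_measurable (completion (restrict_space S K))"
      using \<psi> \<K>(2)[OF K] \<phi> unfolding radon_measurable_def by (auto intro: measurable_compose)
    then obtain G where G: "G \<in> borel_measurable (restrict_space S K)"
      "AE x in restrict_space S K. \<phi> (\<psi> x) = G x"
      using completion_ex_borel_measurable by blast
    have "(\<lambda>x. G x * indicator K x) \<in> borel_measurable borel"
      using G(1) Kb by (subst (asm) borel_measurable_restrict_space_iff_ennreal) (auto cong: measurable_cong_sets)
    moreover have "AE x in S. x \<in> K \<longrightarrow> \<phi> (\<psi> x) = G x * indicator K x"
      using G(2) Kb by (subst (asm) AE_restrict_space_iff) auto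
    ultimately show ?thesis by (intro exI[of _ "\<lambda>x. G x * indicator K x"]) auto
  qed
  then obtain G where G: "\<And>K. K \<in> \<K> \<Longrightarrow> G K \<in> borel_measurable borel"
    "\<And>K x. K \<in> \<K> \<Longrightarrow> x \<notin> K \<Longrightarrow> G K x = 0" "\<And>K. K \<in> \<K> \<Longrightarrow> AE x in S. x \<in> K \<longrightarrow> \<phi> (\<psi> x) = G K x"
    by metis
  have "AE x in S. \<forall>K\<in>\<K>. x \<in> K \<longrightarrow> \<phi> (\<psi> x) = G K x"
    unfolding AE_ball_countable[OF \<K>(1)] using G(3) by blast
  moreover have "AE x in S. x \<in> \<Union>\<K>" using AE_not_in[OF \<K>(3)] by auto
  \<comment> \<open>Each version is 0 outside its compact set and agrees with the function inside,
    so the supremum selects the right value wherever some member contains the point.\<close>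
  ultimately have "AE x in S. \<phi> (\<psi> x) = (SUP K\<in>\<K>. G K x)"
  proof eventually_elim
    case (elim x)
    then obtain K where K: "K \<in> \<K>" "x \<in> K" by blast
    show ?case
    proof (rule antisym)
      show "\<phi> (\<psi> x) \<le> (SUP K\<in>\<K>. G K x)" using elim(1) K by (intro SUP_upper2[of K]) auto
      show "(SUP K\<in>\<K>. G K x) \<le> \<phi> (\<psi> x)"
      proof (rule SUP_least)
        fix L assume "L \<in> \<K>"
        then show "G L x \<le> \<phi> (\<psi> x)" using elim(1) G(2)[of L x] by (cases "x \<in> L") auto
      qed
    qed
  qed
  then show ?thesis using that[of "\<lambda>x. SUP K\<in>\<K>. G K x"] G(1) \<K>(1) by (auto intro: borel_measurable_SUP)
qed

section \<open>Capacity zero and finite energy\<close>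

lemma null_measure_borel_radon: "radon (null_measure borel :: 'a::t2_space measure)"
  by (auto simp: radon_def intro!: antisym SUP_least)

text \<open>Positive definiteness is formulated for Jordan pairs; here it is applied to the pair of
  \<open>\<nu>\<close> and the zero measure, whose energies with \<open>\<nu>\<close> and itself
  vanish.\<close>

lemma mutual_energy_self_nonneg:
  fixes \<nu> :: "'a::t2_space measure"
  assumes pd: "positive_definite_kernel \<kappa>" and \<nu>: "radon \<nu>" "\<bar>mutual_energy \<kappa> \<nu> \<nu>\<bar> \<noteq> \<infinity>"
  shows "0 \<le> mutual_energy \<kappa> \<nu> \<nu>"
proof -
  let ?z = "null_measure borel :: 'a measure"
  have "radon_prod \<nu> ?z = null_measure borel" "radon_prod ?z \<nu> = null_measure borel" "radon_prod ?z ?z = null_measure borel"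
    by (auto intro!: radon_prod_eqI null_measure_borel_radon)
  then have m: "mutual_energy \<kappa> \<nu> ?z = 0" "mutual_energy \<kappa> ?z \<nu> = 0" "mutual_energy \<kappa> ?z ?z = 0"
    unfolding mutual_energy_def pairing_def by (auto simp: nn_integral_null_measure zero_ennreal.rep_eq)
  have "(\<nu>, ?z) \<in> signed_radon"
    unfolding signed_radon_def
  proof (clarify, intro conjI allI impI \<nu>(1) null_measure_borel_radon)
    fix \<rho> :: "'a measure" assume \<rho>: "radon \<rho>" "\<rho> \<le> ?z"
    have s: "sets \<rho> = sets borel" using radonD(1)[OF \<rho>(1)] .
    have "emeasure \<rho> E \<le> emeasure ?z E" for E using \<rho>(2) s by (intro le_measureD3) auto
    then show "\<rho> = ?z" using s by (intro measure_eqI) auto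
  qed
  moreover have "signed_energy_defined \<kappa> (\<nu>, ?z)" using \<nu>(2) by (simp add: signed_energy_defined_def m)
  ultimately have "0 \<le> signed_energy \<kappa> (\<nu>, ?z)" using pd unfolding positive_definite_kernel_def by blast
  then show ?thesis by (simp add: signed_energy_def m)
qed

context energy_setting
begin

text \<open>If \<open>Q\<close> were charged, the restriction to a compact subset of positive
  measure, normalized to mass 1, would compete in the infimum with finite energy and force positive
  capacity.\<close>

lemma emeasure_weighted_measure_capacity_zero:
  assumes pd: "positive_definite_kernel \<kappa>" and u: "radon_density u" and fin: "abs_energy u u < \<infinity>"
    and Q: "Q \<in> sets borel" and cap: "inner_capacity \<kappa> Q = 0"
  shows "emeasure (weighted_measure u) Q = 0"
proof (rule ccontr)
  note [measurable] = radon_densityD(1)[OF u]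
  assume "\<not> ?thesis"
  then have "0 < emeasure (weighted_measure u) Q" by (simp add: zero_less_iff_neq_zero)
  then obtain K where K: "compact K" "K \<subseteq> Q" "0 < emeasure (weighted_measure u) K"
    by (rule radon_inner[OF radon_densityD(3)[OF u] Q])
  have Kb[measurable]: "K \<in> sets borel" using borel_compact[OF K(1)] .
  obtain m where m: "emeasure (weighted_measure u) K = ennreal m" "0 < m"
    using K(3) radonD(3)[OF radon_densityD(3)[OF u] K(1)] by (cases "emeasure (weighted_measure u) K") auto
  \<comment> \<open>\<open>m\<close> is the mass of \<open>K\<close>, so \<open>t\<close> has total
    mass 1.\<close>
  define t where "t x = (1 / m) * (u x * indicator K x)" for x
  have tm[measurable]: "t \<in> borel_measurable borel" unfolding t_def by measurable
  have t0: "0 \<le> t x" for x using m radon_densityD(2)[OF u] by (simp add: t_def)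
  have tE: "emeasure (weighted_measure t) E = ennreal (1 / m) * (\<integral>\<^sup>+x. ennreal (u x) * indicator (K \<inter> E) x \<partial>S)" if [measurable]: "E \<in> sets borel" for E
  proof -
    have "emeasure (weighted_measure t) E = (\<integral>\<^sup>+x. ennreal (1 / m) * (ennreal (u x) * indicator (K \<inter> E) x) \<partial>S)"
      unfolding emeasure_weighted_measure[OF tm that] t_def using m radon_densityD(2)[OF u]
      by (intro nn_integral_cong, subst ennreal_mult) (auto split: split_indicator)
    also have "\<dots> = ennreal (1 / m) * (\<integral>\<^sup>+x. ennreal (u x) * indicator (K \<inter> E) x \<partial>S)"
      by (intro nn_integral_cmult) measurable
    finally show ?thesis .
  qed
  have mass: "ennreal (1 / m) * (\<integral>\<^sup>+x. ennreal (u x) * indicator K x \<partial>S) = 1"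
    using m by (simp add: emeasure_weighted_measure[symmetric] ennreal_mult[symmetric])
  have Emono: "emeasure (weighted_measure t) E \<le> 1" if E: "E \<in> sets borel" for E
    unfolding tE[OF E] mass[symmetric] by (intro mult_left_mono nn_integral_mono) (auto split: split_indicator)
  have rt: "radon (weighted_measure t)"
  proof (rule radon_weighted_measure[OF tm])
    fix C :: "'a set" assume "compact C"
    then have "emeasure (weighted_measure t) C \<le> 1" by (intro Emono borel_compact)
    then show "emeasure (weighted_measure t) C < \<infinity>" by (rule le_less_trans) simp
  qed
  then have at: "radon_density t" using tm t0 by (simp add: radon_density_def)
  have "abs_energy t t \<le> (\<integral>\<^sup>+z. ennreal ((1 / m)\<^sup>2) * (e2ennreal \<bar>\<kappa> z\<bar> * ennreal (u (fst z) * u (snd z))) \<partial>R)"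
    unfolding abs_energy_def
  proof (rule nn_integral_mono)
    fix z
    have "t (fst z) * t (snd z) \<le> (1 / m)\<^sup>2 * (u (fst z) * u (snd z))"
      using m(2) radon_densityD(2)[OF u] by (auto simp: t_def power2_eq_square split: split_indicator)
    then have "ennreal (t (fst z) * t (snd z)) \<le> ennreal ((1 / m)\<^sup>2) * ennreal (u (fst z) * u (snd z))"
      using ennreal_leI radon_densityD(2)[OF u] by (fastforce simp: ennreal_mult[symmetric])
    then show "e2ennreal \<bar>\<kappa> z\<bar> * ennreal (t (fst z) * t (snd z)) \<le>
        ennreal ((1 / m)\<^sup>2) * (e2ennreal \<bar>\<kappa> z\<bar> * ennreal (u (fst z) * u (snd z)))"
      by (subst mult.left_commute) (rule mult_left_mono, auto)
  qed
  also have "\<dots> = ennreal ((1 / m)\<^sup>2) * abs_energy u u"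
    unfolding abs_energy_def by (intro nn_integral_cmult) measurable
  also have "\<dots> < \<infinity>" using fin by (simp add: ennreal_mult_less_top)
  finally have ft: "abs_energy t t < \<infinity>" .
  have fe: "\<bar>mutual_energy \<kappa> (weighted_measure t) (weighted_measure t)\<bar> \<noteq> \<infinity>" using mutual_energy_finite_iff[OF at at] ft by simp
  have "K \<inter> - Q = {}" using K(2) by blast
  moreover have "- Q \<in> sets borel" using Q by auto
  ultimately have "emeasure (weighted_measure t) (- Q) = 0" using tE[of "- Q"] by simp
  then have "carried_by (weighted_measure t) Q" using carried_by_iff[OF rt Q] by simp
  moreover have "emeasure (weighted_measure t) Q = 1" using tE[OF Q] mass K(2) by (simp add: Int_absorb2)
  moreover have "emeasure (completion (weighted_measure t)) Q = emeasure (weighted_measure t) Q" using Q by simp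
  ultimately have mem: "weighted_measure t \<in> {\<nu> \<in> finite_energy_on \<kappa> Q. emeasure (completion \<nu>) Q = 1}"
    using rt fe by (simp add: finite_energy_on_def radon_on_def)
  let ?I = "INF \<nu>\<in>{\<nu>\<in>finite_energy_on \<kappa> Q. emeasure (completion \<nu>) Q = 1}. mutual_energy \<kappa> \<nu> \<nu>"
  have "?I \<le> mutual_energy \<kappa> (weighted_measure t) (weighted_measure t)" using mem by (rule INF_lower)
  \<comment> \<open>The value \<open>-\<infinity>\<close> must be excluded, since its inverse in
    \<open>ereal\<close> is 0 and would be consistent with capacity 0.\<close>
  moreover have "0 \<le> ?I"
  proof (rule INF_greatest)
    fix \<nu> assume "\<nu> \<in> {\<nu> \<in> finite_energy_on \<kappa> Q. emeasure (completion \<nu>) Q = 1}"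
    then have "radon \<nu>" "\<bar>mutual_energy \<kappa> \<nu> \<nu>\<bar> \<noteq> \<infinity>"
      unfolding finite_energy_on_def radon_on_def mem_Collect_eq by (simp_all only: not_False_eq_True simp_thms)
    then show "0 \<le> mutual_energy \<kappa> \<nu> \<nu>" by (rule mutual_energy_self_nonneg[OF pd])
  qed
  ultimately have "inverse ?I \<noteq> 0" using fe by (cases ?I) auto
  then show False using cap by (simp add: inner_capacity_def)
qed

text \<open>The integrand \<open>G\<close> is merely almost everywhere equal to a Borel function,
  which is the form in which the external fields arrive.\<close>

lemma emeasure_weighted_measure_mid:
  assumes u: "radon_density u" and v: "radon_density v" and E: "E \<in> sets borel"
  shows "emeasure (weighted_measure (\<lambda>x. (u x + v x) / 2)) E = (emeasure (weighted_measure u) E + emeasure (weighted_measure v) E) / 2"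
    and nn_integral_weighted_measure_mid: "F \<in> borel_measurable borel \<Longrightarrow> AE x in S. G x = F x \<Longrightarrow>
      (\<integral>\<^sup>+x. G x \<partial>weighted_measure (\<lambda>x. (u x + v x) / 2)) = ((\<integral>\<^sup>+x. G x \<partial>weighted_measure u) + (\<integral>\<^sup>+x. G x \<partial>weighted_measure v)) / 2"
proof -
  note [measurable] = radon_densityD(1)[OF u] radon_densityD(1)[OF v]
  let ?h = "\<lambda>x. (u x + v x) / 2"
  have h: "ennreal (?h x) = (ennreal (u x) + ennreal (v x)) / 2" for x
    using radon_densityD(2)[OF u] radon_densityD(2)[OF v] by (simp add: ennreal_plus[symmetric] divide_ennreal[symmetric] del: ennreal_plus)
  have mid: "(\<integral>\<^sup>+x. G x \<partial>weighted_measure ?h) = ((\<integral>\<^sup>+x. G x \<partial>weighted_measure u) + (\<integral>\<^sup>+x. G x \<partial>weighted_measure v)) / 2"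
    if [measurable]: "F \<in> borel_measurable borel" and GF: "AE x in S. G x = F x" for F G
  proof -
    have r: "(\<integral>\<^sup>+x. G x \<partial>weighted_measure d) = (\<integral>\<^sup>+x. ennreal (d x) * F x \<partial>S)" if [measurable]: "d \<in> borel_measurable borel" for d
    proof -
      have "(\<integral>\<^sup>+x. G x \<partial>weighted_measure d) = (\<integral>\<^sup>+x. F x \<partial>weighted_measure d)"
        using GF unfolding weighted_measure_def by (intro nn_integral_cong_AE) (auto simp: AE_density elim!: eventually_mono)
      also have "\<dots> = (\<integral>\<^sup>+x. ennreal (d x) * F x \<partial>S)" unfolding weighted_measure_def by (intro nn_integral_density) auto
      finally show ?thesis .
    qed
    have "(\<integral>\<^sup>+x. ennreal (?h x) * F x \<partial>S) = (\<integral>\<^sup>+x. (ennreal (u x) * F x + ennreal (v x) * F x) / 2 \<partial>S)"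
      unfolding h by (intro nn_integral_cong) (simp add: divide_ennreal_def algebra_simps)
    also have "\<dots> = ((\<integral>\<^sup>+x. ennreal (u x) * F x \<partial>S) + (\<integral>\<^sup>+x. ennreal (v x) * F x \<partial>S)) / 2"
      by (subst nn_integral_divide) (auto simp: nn_integral_add)
    finally show ?thesis using r[of ?h] r[of u] r[of v] by simp
  qed
  then show "F \<in> borel_measurable borel \<Longrightarrow> AE x in S. G x = F x \<Longrightarrow>
      (\<integral>\<^sup>+x. G x \<partial>weighted_measure ?h) = ((\<integral>\<^sup>+x. G x \<partial>weighted_measure u) + (\<integral>\<^sup>+x. G x \<partial>weighted_measure v)) / 2" by blast
  show "emeasure (weighted_measure ?h) E = (emeasure (weighted_measure u) E + emeasure (weighted_measure v) E) / 2"
    using mid[of "indicator E" "indicator E"] E by (simp add: nn_integral_indicator)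
qed

text \<open>Finite pairings force all four integrals of positive and negative parts to be finite, so
  averaging commutes with the subtraction.\<close>

lemma pairing_weighted_measure_mid:
  assumes u: "radon_density u" and v: "radon_density v"
    and F: "F \<in> borel_measurable borel" "AE x in S. e2ennreal (\<psi> x) = F x"
    and G: "G \<in> borel_measurable borel" "AE x in S. e2ennreal (- \<psi> x) = G x"
    and p: "pairing \<psi> (weighted_measure u) = ereal a" "pairing \<psi> (weighted_measure v) = ereal b"
  shows "pairing \<psi> (weighted_measure (\<lambda>x. (u x + v x) / 2)) = ereal ((a + b) / 2)"
proof -
  have *: "enn2ereal ((x + y) / 2) - enn2ereal ((x' + y') / 2) = ereal ((a + b) / 2)"
    if "enn2ereal x - enn2ereal x' = ereal a" "enn2ereal y - enn2ereal y' = ereal b" for x x' y y'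
  proof -
    have "x \<noteq> top" "x' \<noteq> top" using that(1) by (cases x; cases x'; auto)+
    moreover have "y \<noteq> top" "y' \<noteq> top" using that(2) by (cases y; cases y'; auto)+
    moreover have "(ennreal r + ennreal s) / 2 = ennreal ((r + s) / 2)" if "0 \<le> r" "0 \<le> s" for r s
      using that by (simp add: ennreal_plus[symmetric] divide_ennreal[symmetric] del: ennreal_plus)
    ultimately show ?thesis using that by (cases x; cases x'; cases y; cases y') (auto simp: field_simps)
  qed
  show ?thesis
    using p unfolding pairing_def
    by (subst nn_integral_weighted_measure_mid[OF u v sets.top F, simplified], subst nn_integral_weighted_measure_mid[OF u v sets.top G, simplified]) (rule *)
qed

end

section \<open>Uniqueness of the solution\<close>

lemma ennreal_mid_le:
  "a \<le> c \<Longrightarrow> b \<le> c \<Longrightarrow> (a + b) / 2 \<le> (c :: ennreal)"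
proof -
  assume "a \<le> c" "b \<le> c"
  then have "(a + b) / 2 \<le> (c + c) / 2" by (intro divide_right_mono_ennreal add_mono)
  also have "(c + c) / 2 = c * 2 / 2" by (simp add: mult_2_right)
  also have "\<dots> = c" by (rule mult_divide_eq_ennreal) auto
  finally show ?thesis .
qed

lemma finite_series_cong:
  assumes "\<And>k. k \<in> J \<Longrightarrow> t k = t' k"
  shows "finite_series J t \<longleftrightarrow> finite_series J t'"
  using assms summable_on_cong[of J "\<lambda>k. \<bar>real_of_ereal (t k)\<bar>" "\<lambda>k. \<bar>real_of_ereal (t' k)\<bar>"]
  by (simp add: finite_series_def)

theorem corollary4p5:
  fixes \<kappa> :: "'a::t2_space \<times> 'a \<Rightarrow> ereal"
    and Ip In I0 :: "'i set"
    and A :: "'i \<Rightarrow> 'a set"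
    and a :: "'i \<Rightarrow> real"
    and g :: "'i \<Rightarrow> 'a \<Rightarrow> real"
    and f :: "'i \<Rightarrow> 'a \<Rightarrow> ereal"
    and \<xi> :: "'i \<Rightarrow> 'a measure"
  assumes "locally_compact_space (euclidean :: 'a topology)"
    and "is_kernel \<kappa>"
    and "positive_definite_kernel \<kappa>"
    and "generalized_condenser Ip In A"
    and "\<forall>i\<in>Ip \<union> In. 0 < a i"
    and "\<forall>i\<in>Ip \<union> In. continuous_on UNIV (g i) \<and> (\<forall>x. 0 < g i x)"
    and "\<forall>i\<in>Ip \<union> In. \<forall>\<nu>. radon \<nu> \<longrightarrow> radon_measurable \<nu> (f i)"
    and "I0 \<subseteq> Ip \<union> In"
    and "\<forall>i\<in>I0. \<xi> i \<in> radon_on (A i) \<and> ereal (a i) < pairing (\<lambda>x. ereal (g i x)) (\<xi> i)"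
    and "admissible \<kappa> Ip In A a g f I0 \<xi> \<noteq> {}"
    and "strictly_positive_definite_kernel \<kappa>"
    and "\<forall>i\<in>Ip \<union> In. \<forall>j\<in>Ip \<union> In. i \<noteq> j \<longrightarrow> inner_capacity \<kappa> (A i \<inter> A j) = 0"
  shows "\<exists>\<^sub>\<le>\<^sub>1 \<mu>. is_solution \<kappa> Ip In A a g f I0 \<xi> \<mu>"
  unfolding Uniq_def
proof (intro allI impI)
  fix \<mu> \<nu> assume sol: "is_solution \<kappa> Ip In A a g f I0 \<xi> \<mu>" "is_solution \<kappa> Ip In A a g f I0 \<xi> \<nu>"
  define J where "J = Ip \<union> In"
  note pd = assms(3) and spd = assms(11)
  have cond: "countable J" "\<And>i. i \<in> J \<Longrightarrow> A i \<noteq> {}" "\<And>i. i \<in> J \<Longrightarrow> A i \<in> sets borel"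
    "\<And>K. compact K \<Longrightarrow> finite {i\<in>J. A i \<inter> K \<noteq> {}}"
    using assms(4) unfolding generalized_condenser_def J_def by auto
  have adm\<mu>: "\<mu> \<in> admissible \<kappa> Ip In A a g f I0 \<xi>" and adm\<nu>: "\<nu> \<in> admissible \<kappa> Ip In A a g f I0 \<xi>"
    using sol by (auto simp: is_solution_def)
  have ext: "\<mu> \<in> (\<Pi>\<^sub>E i\<in>J. radon_on (A i))" "\<nu> \<in> (\<Pi>\<^sub>E i\<in>J. radon_on (A i))"
    using adm\<mu> adm\<nu> by (auto simp: admissible_def finite_energy_vectors_def vector_measures_def J_def)
  have gc: "continuous_on UNIV (g i)" "0 < g i x" if "i \<in> J" for i x using assms(6) that by (auto simp: J_def)
  have adm_props: "radon (\<mu> i)" "carried_by (\<mu> i) (A i)" "pairing (\<lambda>x. ereal (g i x)) (\<mu> i) = ereal (a i)"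
    "sigma_finite_measure (\<mu> i)"
    if "\<mu> \<in> admissible \<kappa> Ip In A a g f I0 \<xi>" "i \<in> J" for \<mu> i
  proof -
    show r: "radon (\<mu> i)" "carried_by (\<mu> i) (A i)"
      using that by (auto simp: admissible_def finite_energy_vectors_def vector_measures_def J_def radon_on_def PiE_iff)
    show p: "pairing (\<lambda>x. ereal (g i x)) (\<mu> i) = ereal (a i)" using that by (auto simp: admissible_def J_def)
    show "sigma_finite_measure (\<mu> i)" by (rule sigma_finite_if_pairing_finite[OF r(1) gc[OF that(2)] p])
  qed
  show "\<mu> = \<nu>"
  \<comment> \<open>The enumeration of the components below requires a nonempty set of
    measures.\<close>
  proof (cases "J = {}")
    case True
    then show ?thesis using ext by auto
  next
    case False

    \<comment> \<open>A common reference measure and densities for both solutions\<close>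
    define \<M> where "\<M> = \<mu> ` J \<union> \<nu> ` J"
    have \<M>: "countable \<M>" "\<M> \<noteq> {}" using cond(1) False by (auto simp: \<M>_def)
    have rM: "radon M" "sigma_finite_measure M" if "M \<in> \<M>" for M
      using that adm_props[OF adm\<mu>] adm_props[OF adm\<nu>] by (auto simp: \<M>_def)
    obtain S where S: "radon S" "finite_measure S" and ac0: "\<And>n. absolutely_continuous S (from_nat_into \<M> n)"
      using radon_dominating_finite[of "from_nat_into \<M>"] rM from_nat_into[OF \<M>(2)] by metis
    have ac: "absolutely_continuous S M" if "M \<in> \<M>" for M
      using ac0 from_nat_into_surj[OF \<M>(1) that] by metis
    obtain R :: "('a \<times> 'a) measure" where R: "radon R" "finite_measure R"
      "\<And>A B. A \<in> sets borel \<Longrightarrow> B \<in> sets borel \<Longrightarrow> emeasure R (A \<times> B) = emeasure S A * emeasure S B"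
    proof (rule radon_product_exists[OF S S])
      fix R :: "('a \<times> 'a) measure"
      assume R: "radon R" "finite_measure R"
        "\<And>A B. A \<in> sets borel \<Longrightarrow> B \<in> sets borel \<Longrightarrow> emeasure R (A \<times> B) = emeasure S A * emeasure S B"
      show thesis by (rule that[OF R])
    qed
    interpret condenser_setting \<kappa> S R J A
      by (rule condenser_setting.intro[OF energy_setting.intro condenser_setting_axioms.intro])
        (fact assms(2) S R cond)+
    have "\<exists>u. \<rho> i = weighted_measure u \<and> u \<in> borel_measurable borel \<and> (\<forall>x. 0 \<le> u x) \<and> (\<forall>x. x \<notin> A i \<longrightarrow> u x = 0)"
      if i: "i \<in> J" and "\<rho> \<in> {\<mu>, \<nu>}" for i \<rho>
    proof -
      have \<rho>M: "\<rho> i \<in> \<M>" and \<rho>: "\<rho> \<in> admissible \<kappa> Ip In A a g f I0 \<xi>" using that adm\<mu> adm\<nu> by (auto simp: \<M>_def)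
      obtain u :: "'a \<Rightarrow> real" where "u \<in> borel_measurable borel" "\<And>x. 0 \<le> u x" "\<And>x. x \<notin> A i \<Longrightarrow> u x = 0"
        "\<rho> i = density S (\<lambda>x. ennreal (u x))"
        using radon_eq_density[OF S rM[OF \<rho>M] ac[OF \<rho>M] cond(3)[OF i] adm_props(2)[OF \<rho> i]]
        by blast
      then show ?thesis by (auto simp: weighted_measure_def)
    qed
    then have ex: "i \<in> J \<Longrightarrow> \<rho> \<in> {\<mu>, \<nu>} \<Longrightarrow>
        \<exists>u. \<rho> i = weighted_measure u \<and> u \<in> borel_measurable borel \<and> (\<forall>x. 0 \<le> u x) \<and> (\<forall>x. x \<notin> A i \<longrightarrow> u x = 0)" for i \<rho> .
    \<comment> \<open>One choice function covers both solutions, so facts about densities can be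
      stated for \<open>\<rho>\<close> in \<open>{\<mu>, \<nu>}\<close>.\<close>
    define D where "D \<rho> i = (SOME u. \<rho> i = weighted_measure u \<and> u \<in> borel_measurable borel \<and> (\<forall>x. 0 \<le> u x) \<and>
        (\<forall>x. x \<notin> A i \<longrightarrow> u x = 0))" for \<rho> i
    have D: "\<rho> i = weighted_measure (D \<rho> i)" "D \<rho> i \<in> borel_measurable borel" "0 \<le> D \<rho> i x" "x \<notin> A i \<Longrightarrow> D \<rho> i x = 0"
      if "i \<in> J" "\<rho> \<in> {\<mu>, \<nu>}" for i \<rho> x
      using someI_ex[OF ex[OF that], folded D_def] by blast+
    \<comment> \<open>\<open>w\<close> is the common majorant of all densities that occur, and
      \<open>h\<close> is the density of the midpoint.\<close>
    define u v w h where "u = D \<mu>" and "v = D \<nu>" and "w = (\<lambda>i x. u i x + v i x)"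
      and "h = (\<lambda>i x. (u i x + v i x) / 2)"
    have \<mu>u: "\<mu> i = weighted_measure (u i)" and \<nu>v: "\<nu> i = weighted_measure (v i)" if "i \<in> J" for i
      using D(1)[OF that] by (auto simp: u_def v_def)
    have u: "radon_density (u i)" and v: "radon_density (v i)" if "i \<in> J" for i
      using D(1-3)[OF that] adm_props(1)[OF adm\<mu> that] adm_props(1)[OF adm\<nu> that]
      by (auto simp: u_def v_def radon_density_def)
    have fu: "plate_supported u" and fv: "plate_supported v" using D(2,4) by (auto simp: plate_supported_def u_def v_def)
    have fw: "plate_supported w" and fh: "plate_supported h" using fu fv
      by (auto simp: plate_supported_def w_def h_def intro!: borel_measurable_add borel_measurable_divide)
    have w: "radon_density (w i)" if "i \<in> J" for i unfolding w_def using u v that by (intro radon_density_add)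
    have nn: "0 \<le> u i x" "0 \<le> v i x" if "i \<in> J" for i x using radon_densityD(2)[OF u] radon_densityD(2)[OF v] that by auto
    define s :: "'i \<Rightarrow> real" where "s i = (if i \<in> Ip then 1 else -1)" for i
    have s: "\<bar>s i\<bar> = 1" and ps: "plate_sign Ip i = ereal (s i)" for i by (auto simp: s_def plate_sign_def one_ereal_def)
    have fin: "abs_energy (plate_sum (D \<rho>)) (plate_sum (D \<rho>)) < \<infinity>" if \<rho>: "\<rho> \<in> {\<mu>, \<nu>}" for \<rho>
    proof (rule abs_energy_plate_sum_finite[where s = "plate_sign Ip"])
      show "plate_supported (D \<rho>)" using \<rho> fu fv by (auto simp: u_def v_def)
      show "radon_density (D \<rho> i)" if "i \<in> J" for i using \<rho> u[OF that] v[OF that] by (auto simp: u_def v_def)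
      show "\<bar>plate_sign Ip i\<bar> = 1" for i by (simp add: plate_sign_def)
      have "finite_series (J \<times> J) (energy_terms \<kappa> Ip \<rho>)"
        using \<rho> adm\<mu> adm\<nu> by (auto simp: admissible_def finite_energy_vectors_def J_def)
      moreover have "finite_series (J \<times> J) (energy_terms \<kappa> Ip \<rho>) \<longleftrightarrow>
         finite_series (J \<times> J) (\<lambda>(i, j). plate_sign Ip i * plate_sign Ip j * mutual_energy \<kappa> (weighted_measure (D \<rho> i)) (weighted_measure (D \<rho> j)))"
      proof (rule finite_series_cong)
        fix p assume "p \<in> J \<times> J"
        then have "\<rho> (fst p) = weighted_measure (D \<rho> (fst p))" "\<rho> (snd p) = weighted_measure (D \<rho> (snd p))" using D(1)[OF _ \<rho>] by auto
        then show "energy_terms \<kappa> Ip \<rho> p =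
            (\<lambda>(i, j). plate_sign Ip i * plate_sign Ip j * mutual_energy \<kappa> (weighted_measure (D \<rho> i)) (weighted_measure (D \<rho> j))) p"
          by (simp add: energy_terms_def case_prod_beta')
      qed
      ultimately show "finite_series (J \<times> J) (\<lambda>(i, j). plate_sign Ip i * plate_sign Ip j * mutual_energy \<kappa> (weighted_measure (D \<rho> i)) (weighted_measure (D \<rho> j)))"
        by blast
    qed
    have tw: "plate_sum w = (\<lambda>x. plate_sum u x + plate_sum v x)" by (auto simp: plate_sum_def w_def sum.distrib)
    \<comment> \<open>The bound is applied to the summed densities of the two solutions, not plate
      by plate; it thus yields convergence of the whole double series of mixed energies.\<close>
    have finw: "abs_energy (plate_sum w) (plate_sum w) < \<infinity>"
      unfolding tw using fin[of \<mu>] fin[of \<nu>] radon_density_plate_sum[OF fu u] radon_density_plate_sum[OF fv v]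
      by (intro abs_energy_add_finite[OF pd]) (auto simp: u_def v_def)
    have atw: "radon_density (plate_sum w)" using radon_density_plate_sum[OF fw w] .

    \<comment> \<open>Admissibility of the midpoint\<close>
    define \<theta> where "\<theta> = (\<lambda>i. if i \<in> J then weighted_measure (h i) else undefined)"
    have hnn: "0 \<le> h i x" "h i x \<le> w i x" if "i \<in> J" for i x using nn[OF that] by (auto simp: h_def w_def)
    have hadm: "radon_density (h i)" if "i \<in> J" for i
      using radon_density_mono[OF w[OF that]] plate_supportedD(1)[OF fh that] hnn[OF that] by blast
    define sg :: "('i \<Rightarrow> 'a \<Rightarrow> real) \<Rightarrow> 'i \<Rightarrow> 'a \<Rightarrow> real" where "sg = (\<lambda>d i x. s i * d i x)"
    have energy: "finite_series (J \<times> J) (energy_terms \<kappa> Ip \<rho>)" (is ?fs)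
      "vector_energy \<kappa> Ip In \<rho> = energy_form (plate_sum (sg d)) (plate_sum (sg d))" (is ?ve)
      if "plate_supported d" "\<And>i x. i \<in> J \<Longrightarrow> 0 \<le> d i x" "\<And>i x. i \<in> J \<Longrightarrow> d i x \<le> w i x" "\<And>i. i \<in> J \<Longrightarrow> \<rho> i = weighted_measure (d i)" for \<rho> d
    proof -
      have "energy_terms \<kappa> Ip \<rho> = (\<lambda>(i, j). ereal (s i) * ereal (s j) * mutual_energy \<kappa> (\<rho> i) (\<rho> j))"
        by (simp add: energy_terms_def ps)
      with signed_energy_series[OF fw w finw that(1-3) s that(4)]
      show ?fs ?ve by (simp_all add: vector_energy_def J_def[symmetric] sg_def)
    qed
    have em: "vector_energy \<kappa> Ip In \<mu> = energy_form (plate_sum (sg u)) (plate_sum (sg u))"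
      "vector_energy \<kappa> Ip In \<nu> = energy_form (plate_sum (sg v)) (plate_sum (sg v))"
      "vector_energy \<kappa> Ip In \<theta> = energy_form (plate_sum (sg h)) (plate_sum (sg h))"
      and fs\<theta>: "finite_series (J \<times> J) (energy_terms \<kappa> Ip \<theta>)"
      using energy(2)[OF fu nn(1) _ \<mu>u] energy(2)[OF fv nn(2) _ \<nu>v] energy[OF fh hnn, of \<theta>] nn
      by (auto simp: w_def \<theta>_def)
    have fields: "finite_series J (\<lambda>i. pairing (f i) (\<rho> i))" if "\<rho> \<in> {\<mu>, \<nu>}" for \<rho>
      using that adm\<mu> adm\<nu> by (auto simp: admissible_def J_def)
    have pf: "pairing (f i) (\<theta> i) = ereal ((real_of_ereal (pairing (f i) (\<mu> i)) + real_of_ereal (pairing (f i) (\<nu> i))) / 2)"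
      if i: "i \<in> J" for i
    proof -
      have rm: "radon_measurable S (f i)" using assms(7) i S(1) by (auto simp: J_def)
      obtain F where F: "F \<in> borel_measurable borel" "AE x in S. e2ennreal (f i x) = F x"
        using radon_measurable_AE_borel[OF S rm measurable_e2ennreal] by blast
      have "(\<lambda>y. e2ennreal (- y)) \<in> borel_measurable borel" by measurable
      then obtain G where G: "G \<in> borel_measurable borel" "AE x in S. e2ennreal (- f i x) = G x"
        using radon_measurable_AE_borel[OF S rm] by blast
      have "\<bar>pairing (f i) (\<mu> i)\<bar> \<noteq> \<infinity>" "\<bar>pairing (f i) (\<nu> i)\<bar> \<noteq> \<infinity>"
        using fields[of \<mu>] fields[of \<nu>] i by (auto simp: finite_series_def)
      then have "pairing (f i) (weighted_measure (u i)) = ereal (real_of_ereal (pairing (f i) (\<mu> i)))"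
        "pairing (f i) (weighted_measure (v i)) = ereal (real_of_ereal (pairing (f i) (\<nu> i)))"
        using \<mu>u[OF i] \<nu>v[OF i] by (auto simp: ereal_real)
      from pairing_weighted_measure_mid[OF u[OF i] v[OF i] F G this] show ?thesis using i by (simp add: \<theta>_def h_def)
    qed
    have sumf: "(\<lambda>i. real_of_ereal (pairing (f i) (\<rho> i))) summable_on J" if "\<rho> \<in> {\<mu>, \<nu>}" for \<rho>
      using fields[OF that, unfolded finite_series_def, THEN conjunct2]
      unfolding summable_on_iff_abs_summable_on_real[of "\<lambda>i. real_of_ereal (pairing (f i) (\<rho> i))"] real_norm_def .
    have half: "infsum (\<lambda>i. real_of_ereal (pairing (f i) (\<theta> i))) J =
        (infsum (\<lambda>i. real_of_ereal (pairing (f i) (\<mu> i))) J + infsum (\<lambda>i. real_of_ereal (pairing (f i) (\<nu> i))) J) / 2"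
    proof -
      have "infsum (\<lambda>i. real_of_ereal (pairing (f i) (\<theta> i))) J =
        infsum (\<lambda>i. (1/2) * (real_of_ereal (pairing (f i) (\<mu> i)) + real_of_ereal (pairing (f i) (\<nu> i)))) J"
        by (rule infsum_cong) (simp add: pf)
      also have "\<dots> = (1/2) * infsum (\<lambda>i. real_of_ereal (pairing (f i) (\<mu> i)) + real_of_ereal (pairing (f i) (\<nu> i))) J"
        by (rule infsum_cmult_right')
      finally show ?thesis using infsum_add[OF sumf[of \<mu>] sumf[of \<nu>]] by simp
    qed
    have adm\<theta>: "\<theta> \<in> admissible \<kappa> Ip In A a g f I0 \<xi>"
      unfolding admissible_def finite_energy_vectors_def vector_measures_def mem_Collect_eq J_def[symmetric]
    proof (intro conjI ballI)
      have em_mid: "emeasure (\<theta> i) E = (emeasure (\<mu> i) E + emeasure (\<nu> i) E) / 2" if "i \<in> J" "E \<in> sets borel" for i E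
        using emeasure_weighted_measure_mid[OF u v that(2)] that(1) \<mu>u \<nu>v by (simp add: \<theta>_def h_def)
      show "\<theta> \<in> (\<Pi>\<^sub>E i\<in>J. radon_on (A i))"
      proof (rule PiE_I)
        fix i assume i: "i \<in> J"
        have r: "radon (\<theta> i)" using radon_densityD(3)[OF hadm[OF i]] i by (simp add: \<theta>_def)
        have "emeasure (\<mu> i) (- A i) = 0" "emeasure (\<nu> i) (- A i) = 0"
          using adm_props(1,2)[OF adm\<mu> i] adm_props(1,2)[OF adm\<nu> i] carried_by_iff cond(3)[OF i] by blast+
        moreover have "- A i \<in> sets borel" using cond(3)[OF i] by auto
        ultimately have "emeasure (\<theta> i) (- A i) = 0" using em_mid[OF i] by simp
        then show "\<theta> i \<in> radon_on (A i)" using r carried_by_iff[OF r cond(3)[OF i]] by (simp add: radon_on_def)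
      qed (simp add: \<theta>_def)
      show "finite_series (J \<times> J) (energy_terms \<kappa> Ip \<theta>)" by (rule fs\<theta>)
      fix i assume i: "i \<in> J"
      have [measurable]: "g i \<in> borel_measurable borel" using gc(1)[OF i] by (rule borel_measurable_continuous_onI)
      have "pairing (\<lambda>x. ereal (g i x)) (weighted_measure (u i)) = ereal (a i)" "pairing (\<lambda>x. ereal (g i x)) (weighted_measure (v i)) = ereal (a i)"
        using adm_props(3)[OF adm\<mu> i] adm_props(3)[OF adm\<nu> i] \<mu>u[OF i] \<nu>v[OF i] by auto
      from pairing_weighted_measure_mid[OF u[OF i] v[OF i] _ _ _ _ this, of "\<lambda>x. e2ennreal (ereal (g i x))" "\<lambda>x. e2ennreal (- ereal (g i x))"]
      show "pairing (\<lambda>x. ereal (g i x)) (\<theta> i) = ereal (a i)" using i by (simp add: \<theta>_def h_def)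
    next
      fix i assume i0: "i \<in> I0"
      then have i: "i \<in> J" using assms(8) by (auto simp: J_def)
      have le: "\<mu> i \<le> \<xi> i" "\<nu> i \<le> \<xi> i" using adm\<mu> adm\<nu> i0 by (auto simp: admissible_def)
      have sets: "sets (\<xi> i) = sets borel" using assms(9) i0 radonD(1) by (auto simp: radon_on_def)
      have sl: "sets (\<theta> i) = sets borel" using i by (simp add: \<theta>_def)
      have "emeasure (\<theta> i) E \<le> emeasure (\<xi> i) E" if "E \<in> sets borel" for E
        using emeasure_weighted_measure_mid[OF u[OF i] v[OF i] that] i \<mu>u[OF i] \<nu>v[OF i]
          le_measureD3[OF le(1), of E] le_measureD3[OF le(2), of E] sets
          radonD(1)[OF adm_props(1)[OF adm\<mu> i]] radonD(1)[OF adm_props(1)[OF adm\<nu> i]]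
        by (auto simp: \<theta>_def h_def intro!: ennreal_mid_le)
      then show "\<theta> i \<le> \<xi> i" using sets sl by (subst le_measure) auto
    next
      show "finite_series J (\<lambda>i. pairing (f i) (\<theta> i))"
        unfolding finite_series_def
      proof
        show "\<forall>i\<in>J. \<bar>pairing (f i) (\<theta> i)\<bar> \<noteq> \<infinity>" using pf by auto
        have "(\<lambda>i. (1/2) * (real_of_ereal (pairing (f i) (\<mu> i)) + real_of_ereal (pairing (f i) (\<nu> i)))) summable_on J"
          by (intro summable_on_cmult_right summable_on_add sumf) auto
        then have "(\<lambda>i. real_of_ereal (pairing (f i) (\<theta> i))) summable_on J"
          by (subst summable_on_cong[of J _ "\<lambda>i. (1/2) * (real_of_ereal (pairing (f i) (\<mu> i)) + real_of_ereal (pairing (f i) (\<nu> i)))"])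
            (simp_all add: pf)
        then show "(\<lambda>i. \<bar>real_of_ereal (pairing (f i) (\<theta> i))\<bar>) summable_on J"
          unfolding summable_on_iff_abs_summable_on_real[of "\<lambda>i. real_of_ereal (pairing (f i) (\<theta> i))"] real_norm_def .
      qed
    qed

    \<comment> \<open>Vanishing of the energy of the difference\<close>
    let ?G = "gauss_functional \<kappa> Ip In f"
    have "ereal (?G \<mu>) = ereal (?G \<nu>)" using sol unfolding is_solution_def by metis
    moreover have "ereal (?G \<mu>) \<le> ereal (?G \<theta>)"
      using sol(1) adm\<theta> unfolding is_solution_def by (auto intro: INF_lower)
    ultimately have Gle: "?G \<mu> + ?G \<nu> \<le> 2 * ?G \<theta>" by simp
    have fU: "plate_supported (sg u)" "plate_supported (sg v)" using fu fv by (auto simp: plate_supported_def sg_def)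
    define U V where "U = plate_sum (sg u)" and "V = plate_sum (sg v)"
    have UVm: "U \<in> borel_measurable borel" "V \<in> borel_measurable borel"
      unfolding U_def V_def using fU by (auto intro: plate_sum_measurable)
    have UVw: "\<bar>U x\<bar> \<le> plate_sum w x" "\<bar>V x\<bar> \<le> plate_sum w x" for x
      unfolding U_def V_def using nn by (auto intro!: abs_plate_sum_le simp: sg_def abs_mult s w_def)
    have tH: "plate_sum (sg h) = (\<lambda>x. (1/2) * U x + (1/2) * V x)"
      unfolding U_def V_def by (auto simp: plate_sum_def sg_def h_def sum_distrib_left sum.distrib[symmetric] field_simps intro!: sum.cong)
    have tD: "(\<lambda>x. 1 * U x + (-1) * V x) = (\<lambda>x. U x - V x)" by auto
    \<comment> \<open>Together with \<open>BH\<close> this is the parallelogram identity: the energy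
      of \<open>U - V\<close> is \<open>2 * energy_form U U + 2 * energy_form V V\<close> minus four
      times the energy of the midpoint.\<close>
    have BD: "energy_form (\<lambda>x. U x - V x) (\<lambda>x. U x - V x) = energy_form U U - (energy_form U V + energy_form V U) + energy_form V V"
      using energy_form_combination[OF atw finw UVm UVw, of 1 "-1"] unfolding tD by simp
    have BH: "4 * energy_form (plate_sum (sg h)) (plate_sum (sg h)) = energy_form U U + (energy_form U V + energy_form V U) + energy_form V V"
      using energy_form_combination[OF atw finw UVm UVw, of "1/2" "1/2"] unfolding tH by (simp add: power2_eq_square)
    \<comment> \<open>The field terms are affine, so by \<open>half\<close> they cancel from
      \<open>Gle\<close> and only energies remain.\<close>
    have "energy_form U U + energy_form V V \<le> 2 * energy_form (plate_sum (sg h)) (plate_sum (sg h))"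
      using Gle half unfolding gauss_functional_def em series_sum_def J_def[symmetric] U_def[symmetric] V_def[symmetric]
      by (simp add: field_simps)
    then have B0: "energy_form (\<lambda>x. U x - V x) (\<lambda>x. U x - V x) \<le> 0" using BD BH by simp
    have dm': "(\<lambda>x. U x - V x) \<in> borel_measurable borel" using UVm by measurable
    \<comment> \<open>The triangle inequality for \<open>U\<close> and \<open>V\<close> would double
      the bound. Regrouping by plates and using that \<open>u i\<close> and \<open>v i\<close> are
      nonnegative keeps the same majorant.\<close>
    have dw: "\<bar>U x - V x\<bar> \<le> plate_sum w x" for x
    proof -
      have "U x - V x = plate_sum (sg (\<lambda>i x. u i x - v i x)) x"
        unfolding U_def V_def plate_sum_def sg_def by (simp add: sum_subtractf[symmetric] algebra_simps)
      also have "\<bar>\<dots>\<bar> \<le> plate_sum w x"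
      proof (rule abs_plate_sum_le)
        fix i x assume i: "i \<in> J"
        have "\<bar>sg (\<lambda>i x. u i x - v i x) i x\<bar> = \<bar>u i x - v i x\<bar>" by (simp add: sg_def abs_mult s)
        also have "\<dots> \<le> w i x" using nn[OF i, of x] by (simp add: w_def abs_if)
        finally show "\<bar>sg (\<lambda>i x. u i x - v i x) i x\<bar> \<le> w i x" .
      qed
      finally show ?thesis .
    qed
    have "0 \<le> energy_form (\<lambda>x. U x - V x) (\<lambda>x. U x - V x)" by (rule energy_form_nonneg[OF atw finw dm' dw pd])
    then have ae: "AE x in S. U x - V x = 0" using B0 by (intro energy_form_eq_0_imp[OF atw finw dm' dw spd]) simp

    \<comment> \<open>Recovering the components from the signed sum\<close>
    have small: "AE x in S. x \<in> A i \<inter> A j \<longrightarrow> D \<rho> i x = 0" if "i \<in> J" "j \<in> J" "i \<noteq> j" "\<rho> \<in> {\<mu>, \<nu>}" for i j \<rho>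
    proof -
      have ad: "radon_density (D \<rho> i)" using that(4) u[OF that(1)] v[OF that(1)] by (auto simp: u_def v_def)
      have plate_supported: "plate_supported (D \<rho>)" using that(4) fu fv by (auto simp: u_def v_def)
      have le: "D \<rho> i x \<le> plate_sum (D \<rho>) x" for x
        using le_plate_sum[OF plate_supported _ that(1)] D(3)[OF _ that(4)] by blast
      have "D \<rho> i x * D \<rho> i y \<le> plate_sum (D \<rho>) x * plate_sum (D \<rho>) y" for x y
        using le D(3)[OF that(1,4)] by (intro mult_mono) (auto intro: order.trans[OF _ le])
      then have f: "abs_energy (D \<rho> i) (D \<rho> i) < \<infinity>"
        by (intro le_less_trans[OF abs_energy_mono fin[OF that(4)]])
      have Q: "A i \<inter> A j \<in> sets borel" using cond(3) that by auto
      have "inner_capacity \<kappa> (A i \<inter> A j) = 0" using assms(12) that by (auto simp: J_def)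
      then have "A i \<inter> A j \<in> null_sets (weighted_measure (D \<rho> i))"
        using emeasure_weighted_measure_capacity_zero[OF pd ad f Q] Q by (auto simp: null_sets_def)
      moreover have "(\<lambda>x. ennreal (D \<rho> i x)) \<in> borel_measurable S" using radon_densityD(1)[OF ad] by (simp cong: measurable_cong_sets)
      ultimately have "AE x in S. x \<in> A i \<inter> A j \<longrightarrow> ennreal (D \<rho> i x) = 0"
        unfolding weighted_measure_def by (subst (asm) null_sets_density_iff) auto
      then show ?thesis using D(3)[OF that(1,4)] by (auto elim!: eventually_mono simp: ennreal_eq_0_iff intro: antisym)
    qed
    have "AE x in S. \<forall>i\<in>J. \<forall>j\<in>J. i \<noteq> j \<longrightarrow> x \<in> A i \<inter> A j \<longrightarrow> u i x = 0 \<and> v i x = 0"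
      unfolding AE_ball_countable[OF cond(1)]
    proof (intro ballI)
      fix i j assume ij: "i \<in> J" "j \<in> J"
      show "AE x in S. i \<noteq> j \<longrightarrow> x \<in> A i \<inter> A j \<longrightarrow> u i x = 0 \<and> v i x = 0"
      proof (cases "i = j")
        case False
        from small[OF ij False, of \<mu>] small[OF ij False, of \<nu>] show ?thesis
          by (auto simp: u_def v_def)
      qed simp
    qed
    with ae have ae': "AE x in S. \<forall>i\<in>J. u i x = v i x"
    proof eventually_elim
      case (elim x)
      show ?case
      proof
        fix i assume i: "i \<in> J"
        \<comment> \<open>Off \<open>A i\<close> both densities are 0 by choice; on an overlap they
          are 0 outside a null set; in the last case the vanishing plate sum consists of the single
          term of \<open>i\<close>.\<close>
        consider "x \<notin> A i" | j where "j \<in> J" "j \<noteq> i" "x \<in> A i" "x \<in> A j" | "plates_at x = {i}"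
          using i by fastforce
        then show "u i x = v i x"
        proof cases
          case 1
          then show ?thesis using plate_supportedD(2)[OF fu i] plate_supportedD(2)[OF fv i] by simp
        next
          case 2
          then show ?thesis using elim(2) i by auto
        next
          case 3
          then have "s i * (u i x - v i x) = 0" using elim(1)
            by (simp add: U_def V_def plate_sum_def sg_def algebra_simps)
          then show ?thesis using s[of i] by auto
        qed
      qed
    qed
    have "\<mu> i = \<nu> i" if i: "i \<in> J" for i
      unfolding \<mu>u[OF i] \<nu>v[OF i] weighted_measure_def
    proof (rule density_cong)
      show "(\<lambda>x. ennreal (u i x)) \<in> borel_measurable S" "(\<lambda>x. ennreal (v i x)) \<in> borel_measurable S"
        using plate_supportedD(1)[OF fu i] plate_supportedD(1)[OF fv i] by (simp_all cong: measurable_cong_sets)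
      show "AE x in S. ennreal (u i x) = ennreal (v i x)" using ae' i by (auto elim!: eventually_mono)
    qed
    then show ?thesis using ext by (intro PiE_ext) auto
  qed
qed

end
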